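(* Every polynomial $D(1)$-quadruple is regular. That is, if $\{a,b,c,d\}$ is a set of four distinct non-zero polynomials from $\mathbb{R}[X]$, not all constant, such that the product of any two of its distinct elements increased by $1$ is a square of a polynomial from $\mathbb{R}[X]$, then $$(a+b-c-d)^2=4(ab+1)(cd+1).$$
   Context: A polynomial $D(1)$-$m$-tuple is a set of $m$ distinct non-zero polynomials in $\mathbb{R}[X]$, not all constant, such that the product of any two distinct elements increased by $1$ is the square of an element of $\mathbb{R}[X]$. A polynomial $D(1)$-quadruple $\{a,b,c,d\}$ is called regular if $(d+c-a-b)^2=4(ab+1)(cd+1)$ (this condition is symmetric under permutations of $a,b,c,d$). *)

theory Defs
  imports "HOL-Computational_Algebra.Polynomial"
begin

definition polynomial_D1_tuple :: "nat \<Rightarrow> real poly set \<Rightarrow> bool" where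
  "polynomial_D1_tuple m S \<longleftrightarrow>
     finite S \<and> card S = m \<and>
     0 \<notin> S \<and>
     (\<exists>p\<in>S. degree p \<noteq> 0) \<and>
     (\<forall>p\<in>S. \<forall>q\<in>S. p \<noteq> q \<longrightarrow> (\<exists>r :: real poly. p * q + 1 = r ^ 2))"

text \<open>
  The equation below is invariant under permutations of the four polynomials, so a
  predicate on ordered quadruples loses nothing.
\<close>

definition regular_quadruple :: "real poly \<Rightarrow> real poly \<Rightarrow> real poly \<Rightarrow> real poly \<Rightarrow> bool" where
  "regular_quadruple a b c d \<longleftrightarrow>
     (a + b - c - d) ^ 2 = 4 * (a * b + 1) * (c * d + 1)"

end

theory Submission
  imports Defs
begin

text \<open>
  Order the ring \<open>\<real>[X]\<close> by the sign of leading coefficients, so that \<open>X\<close> is infinitely large. All members of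
  a quadruple have the same sign, and after a change of sign and of the order \<open>0 < a < b < c < d\<close>. Write
  \<open>r\<^sup>2 = a * b + 1\<close>, \<open>s\<^sup>2 = a * c + 1\<close>, \<open>t\<^sup>2 = b * c + 1\<close>, \<open>z\<^sup>2 = c * d + 1\<close>. Regularity is a quadratic equation for
  \<open>d\<close> with the solutions \<open>d_plus\<close> and \<open>d_minus\<close>, where \<open>d_plus\<close> is the one that exceeds \<open>c\<close>. The theorem says that
  nothing but \<open>d_plus\<close> extends \<open>{a, b, c}\<close> upwards.

  The common partners of \<open>a\<close> and \<open>c\<close>, that is, the \<open>d\<close> for which \<open>a * d + 1\<close> and \<open>c * d + 1\<close> are squares,
  correspond to the solutions of a Pellian equation and are arranged in ladders by the unit
  \<open>s + sqrt (a * c)\<close>. The degree drops on the way down a ladder until it is below that of \<open>c\<close>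
  (\<open>ladder_descent\<close>), and up to a factor \<open>s\<close> the residue of \<open>z\<close> modulo \<open>c\<close> does not change. The polynomial \<open>d\<close>
  lies on a ladder for \<open>(a, c)\<close> and on a ladder for \<open>(b, c)\<close>. A polynomial of degree less than \<open>degree c\<close> is
  determined by its residue modulo \<open>c\<close>, so the two ladders start at bases that match: the base is \<open>0\<close>, or
  \<open>a\<close> or \<open>b\<close>, or an extension of the triple \<open>{a, b, c}\<close> of smaller degree than \<open>c\<close>, which is \<open>d_minus\<close> by induction on the
  total degree. Expanding powers of the units modulo \<open>c\<^sup>2\<close> turns the equality of the two expressions for \<open>z\<close>
  into a congruence modulo \<open>c\<close> that is quadratic in the numbers of steps \<open>\<mu>\<close> and \<open>\<nu>\<close>. For the base \<open>d_minus\<close> it reads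

    \<open>(2 * \<mu>\<^sup>2 - \<mu> - \<nu>) * a - (2 * \<nu>\<^sup>2 - \<mu> - \<nu>) * b + (\<nu> - \<mu>) * d_minus = 0\<close> modulo \<open>c\<close>.

  If \<open>degree b < degree c\<close>, all terms have degree less than \<open>degree c\<close> and the congruence is an equation. The
  triple \<open>{a, b, d_minus}\<close> lies on a quadric, or its largest member has larger degree than the others, or it is
  \<open>{p, q, \<kappa>\<^sup>2 * q + 2 * \<kappa>}\<close> with scalars \<open>p\<close> and \<open>\<kappa> > 1\<close>. In each case a linear relation can only hold if the
  dual quadratic form of its coefficients is not negative (\<open>linear_relation_dual_nonneg\<close>), but the value
  is \<open>- (2 * \<mu> * \<nu> - \<mu> - \<nu>)\<^sup>2\<close>. So \<open>(2 * \<mu> - 1) * (2 * \<nu> - 1) = 1\<close>, whose solution \<open>\<mu> = \<nu> = 1\<close> is \<open>d_plus\<close>. The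
  equations for the other bases only have solutions for which \<open>d\<close> would be the base itself. For the base \<open>0\<close> the equation factors (\<open>solve_base_0\<close>);
  for bases \<open>0\<close> and \<open>a\<close> or \<open>b\<close> with an odd number of steps on one side, it expresses \<open>s\<close> or \<open>t\<close> by the triple, and
  there is no cancellation between leading terms that would allow this (\<open>root_relation_scalar\<close>). If \<open>a\<close>
  is a scalar, \<open>b\<close> and \<open>d_minus\<close> must have the same degree, one of them is explicitly given by the other, and
  coefficients can be compared (\<open>scalar_a_shapes\<close>).

  If \<open>b\<close> and \<open>c\<close> have the same degree, either \<open>c = a + b + 2 * r\<close>, or \<open>a\<close> is a scalar and
  \<open>c = \<kappa>\<^sup>2 * b + 2 * \<kappa>\<close>. In the first case \<open>b\<close>, \<open>s\<close>, \<open>t\<close> reduce modulo \<open>c\<close> to combinations of \<open>a\<close> and \<open>r\<close>, in the second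
  \<open>b\<close> and \<open>t\<close> reduce to scalars, and the congruences become equations for numbers; where they
  are too weak, comparing the degrees of \<open>d\<close> on both ladders gives a relation between \<open>\<mu>\<close> and \<open>\<nu>\<close>.

  That the scalars are real is used through the order, and through the inequality \<open>\<kappa> > 1\<close> for
  \<open>\<kappa> = p + sqrt (p\<^sup>2 + 1)\<close>.
\<close>

section \<open>The ordered ring of real polynomials\<close>

lemma pos_iff_lead_coeff: "0 < p \<longleftrightarrow> 0 < lead_coeff p" for p :: "real poly"
  by (simp add: less_poly_def pos_poly_def)

lemma degree_add_nonneg:
  fixes p q :: "real poly"
  assumes "0 \<le> p" "0 \<le> q"
  shows "degree (p + q) = max (degree p) (degree q)"
proof -
  consider "p = 0" | "q = 0" | "0 < p" "0 < q" using assms by (auto simp: order_le_less)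
  then show ?thesis
  proof cases
    case 3
    then have l: "0 < lead_coeff p" "0 < lead_coeff q" by (auto simp: pos_iff_lead_coeff)
    consider "degree p < degree q" | "degree q < degree p" | "degree p = degree q" by linarith
    then show ?thesis
    proof cases
      case 3
      then have "coeff (p + q) (degree p) \<noteq> 0" using l by simp
      then have "degree p \<le> degree (p + q)" by (rule le_degree)
      then show ?thesis using degree_add_le_max[of p q] 3 by simp
    qed (auto simp: degree_add_eq_left degree_add_eq_right)
  qed auto
qed

lemma degree_mono_nonneg:
  fixes p q :: "real poly"
  assumes "0 \<le> p" "p \<le> q"
  shows "degree p \<le> degree q"
  using degree_add_nonneg[of p "q - p"] assms by simp

lemma less_of_degree_less:
  fixes p q :: "real poly"
  assumes "0 < q" "degree p < degree q"
  shows "p < q"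
proof -
  have "degree (q - p) = degree q" "coeff (q - p) (degree q) = lead_coeff q"
    using assms(2) degree_add_eq_left[of "- p" q] by (auto simp: coeff_eq_0)
  then have "0 < q - p" using assms(1) by (simp add: pos_iff_lead_coeff)
  then show ?thesis by simp
qed

lemma degree_mult_pos:
  fixes p q :: "real poly"
  assumes "0 < p" "0 < q"
  shows "degree (p * q) = degree p + degree q"
  using assms by (simp add: degree_mult_eq)

lemma degree_sq: "degree (p\<^sup>2) = 2 * degree p" for p :: "real poly"
  by (cases "p = 0") (auto simp: degree_power_eq)

lemma degree_diff_lt: "degree (p - q) < n" if "degree p < n" "degree q < n" for p q :: "real poly"
  using that degree_diff_less by blast

lemma const_factors:
  fixes p q :: "real poly"
  assumes "degree (p * q) = 0" "p * q \<noteq> 0"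
  shows "degree p = 0" "degree q = 0"
  using assms degree_mult_eq[of p q] by auto

text \<open>Real scalars inside the polynomial ring. Keeping the embedding opaque lets the ring
  normalizer treat a scalar as an atom instead of unfolding it to a coefficient list.\<close>

definition const :: "real \<Rightarrow> real poly" where "const x = [:x:]"

lemma const_hom:
  "const (x + y) = const x + const y" "const (x - y) = const x - const y"
  "const (- x) = - const x" "const (x * y) = const x * const y" "const (x ^ n) = const x ^ n"
  "const 0 = 0" "const 1 = 1" "const (numeral m) = numeral m"
  by (auto simp: const_def one_pCons numeral_poly poly_const_pow)

lemma const_of_int: "const (of_int i) = of_int i"
  by (simp add: const_def of_int_poly)

lemma const_inject: "const x = const y \<longleftrightarrow> x = y"
  by (simp add: const_def)

lemma const_eq_0: "const x = 0 \<longleftrightarrow> x = 0"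
  by (simp add: const_def)

lemma const_pos: "0 < const x \<longleftrightarrow> 0 < x"
  by (simp add: const_def pos_iff_lead_coeff)

lemma degree_const_zero [simp]: "degree (const x) = 0"
  by (simp add: const_def)

lemma degree_0_const: "degree p = 0 \<Longrightarrow> \<exists>x. p = const x"
  using degree_0_id[of p] unfolding const_def by metis

lemma degree_const_mult [simp]: "degree (const x * p) = (if x = 0 then 0 else degree p)"
  by (simp add: const_def)

lemma const_mult_degree_le: "degree (const x * p) \<le> degree p"
  by simp

lemma degree_of_int_mult_le: "degree (of_int i * p) \<le> degree p" for p :: "real poly"
  by (metis const_of_int const_mult_degree_le)

lemma const_mult_eq_low:
  assumes "const x * p + q = 0" "degree q < degree p"
  shows "x = 0"
proof (rule ccontr)
  assume x: "x \<noteq> 0"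
  have "const x * p = - q" using assms(1) by (simp add: eq_neg_iff_add_eq_0)
  then have "degree (const x * p) = degree q" by simp
  then show False using x assms(2) by simp
qed

lemma linear_relation_coeffs:
  assumes "const x * p + const y = 0" "0 < degree p"
  shows "x = 0" "y = 0"
proof -
  show "x = 0" using const_mult_eq_low[of x p "const y"] assms by simp
  then show "y = 0" using assms(1) by (simp add: const_hom const_eq_0)
qed

lemma quadratic_relation_coeffs:
  assumes "const x * p\<^sup>2 + const y * p + const w = 0" "0 < degree p"
  shows "x = 0" "y = 0" "w = 0"
proof -
  have "degree (const y * p + const w) < degree (p\<^sup>2)"
    using assms(2) degree_add_le[of "const y * p" "degree p" "const w", OF const_mult_degree_le]
    by (simp add: degree_sq)
  then show x: "x = 0" using const_mult_eq_low[of x "p\<^sup>2" "const y * p + const w"] assms(1)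
    by (simp add: add.assoc)
  show "y = 0" "w = 0" using linear_relation_coeffs[of y p w] assms x by (auto simp: const_hom)
qed

lemma dvd_degree_less_zero:
  fixes c p :: "real poly"
  assumes "c dvd p" "degree p < degree c"
  shows "p = 0"
  using assms dvd_imp_degree_le[of c p] by fastforce

section \<open>Products that miss a square by one\<close>

lemma square_root_nonneg:
  fixes p :: "real poly"
  assumes "\<exists>r. p = r\<^sup>2"
  shows "\<exists>r\<ge>0. r\<^sup>2 = p"
  using assms by (metis abs_ge_zero power2_abs)

lemma square_root_pos:
  fixes p q :: "real poly"
  assumes "\<exists>r. p * q + 1 = r\<^sup>2" "0 \<le> p" "0 \<le> q"
  shows "\<exists>r>0. r\<^sup>2 = p * q + 1"
proof -
  obtain r where r: "r \<ge> 0" "r\<^sup>2 = p * q + 1" using square_root_nonneg[OF assms(1)] by auto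
  have "0 < p * q + 1" using assms by (simp add: add_nonneg_pos)
  then show ?thesis using r by (metis order_le_less power_zero_numeral less_irrefl)
qed

text \<open>Two squares that differ by \<open>1\<close> are scalars.\<close>

lemma self_product_not_square:
  fixes p r :: "real poly"
  assumes "0 < degree p"
  shows "p * p + 1 \<noteq> r\<^sup>2"
proof
  assume "p * p + 1 = r\<^sup>2"
  then have "(r - p) * (r + p) = 1" by algebra
  then have "degree (r - p) = 0" "degree (r + p) = 0"
    using const_factors[of "r - p" "r + p"] by auto
  then have "degree ((r + p) - (r - p)) = 0"
    using degree_diff_le[of "r + p" 0 "r - p"] by simp
  moreover have "(r + p) - (r - p) = const 2 * p" by (simp add: const_hom)
  ultimately show False using assms by simp
qed

text \<open>For negative \<open>f\<close> the product \<open>c * f\<close> is negative of positive degree, hence below every scalar, and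
  \<open>c * f + 1\<close> is negative too.\<close>

lemma nonneg_of_square:
  fixes c f z :: "real poly"
  assumes "0 < c" "0 < degree c" "z\<^sup>2 = c * f + 1"
  shows "0 \<le> f"
proof (rule ccontr)
  assume "\<not> 0 \<le> f"
  then have f: "0 < - f" by simp
  have "0 < degree (c * (- f))" using assms f degree_mult_pos[of c "- f"] by simp
  then have "1 < c * (- f)"
    using less_of_degree_less[of "c * (- f)" 1] mult_pos_pos[OF assms(1) f] by simp
  then have "z\<^sup>2 < 0" using assms(3) by simp
  then show False by (simp add: not_less)
qed

text \<open>If \<open>q\<close> and \<open>p\<close> are positive scalars and \<open>x\<^sup>2 = p * c + 1\<close>, \<open>y\<^sup>2 = q * c + 1\<close>, then
  \<open>q * x\<^sup>2 - p * y\<^sup>2\<close> is a scalar that factors over the reals; unless it vanishes both factors,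
  and with them \<open>x\<close>, are constant.\<close>

lemma const_partner_unique:
  fixes p q c x y :: "real poly"
  assumes "degree p = 0" "degree q = 0" "0 < p" "0 < q" "0 < degree c"
    and "x\<^sup>2 = p * c + 1" "y\<^sup>2 = q * c + 1"
  shows "p = q"
proof (rule ccontr)
  assume ne: "p \<noteq> q"
  obtain p' q' where pq: "p = const p'" "q = const q'"
    using degree_0_const assms(1,2) by blast
  have p': "0 < p'" "0 < q'" "p' \<noteq> q'" using assms pq ne by (auto simp: const_pos)
  define l where "l = sqrt (q' / p')"
  have l: "l\<^sup>2 = q' / p'" "l > 0" using p' by (auto simp: l_def)
  have l2: "const l ^ 2 * p = q" using l p' pq by (simp flip: const_hom)
  have "(const l * x - y) * (const l * x + y) = (const l)\<^sup>2 * x\<^sup>2 - y\<^sup>2" by algebra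
  also have "\<dots> = (const l)\<^sup>2 * p * c - q * c + (const l)\<^sup>2 - 1"
    unfolding assms by algebra
  also have "\<dots> = const (l\<^sup>2 - 1)" unfolding l2 by (simp add: const_hom)
  finally have e: "(const l * x - y) * (const l * x + y) = const (l\<^sup>2 - 1)" .
  have "l\<^sup>2 \<noteq> 1" using l p' by simp
  then have "degree (const l * x - y) = 0" "degree (const l * x + y) = 0"
    using const_factors[of "const l * x - y" "const l * x + y"] e by (auto simp: const_eq_0)
  then have "degree ((const l * x - y) + (const l * x + y)) = 0"
    using degree_add_le[of "const l * x - y" 0 "const l * x + y"] by simp
  moreover have "(const l * x - y) + (const l * x + y) = const (2 * l) * x"
    by (simp add: const_hom)
  ultimately have "degree x = 0" using l by simp
  then have "degree (p * c + 1) = 0" using assms(6) by (metis degree_sq mult_0_right)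
  moreover have "degree (p * c + 1) = degree c"
    using p' pq assms(5) by (simp add: degree_add_eq_left)
  ultimately show False using assms(5) by simp
qed

section \<open>Triples and their regular extensions\<close>

text \<open>Regularity of \<open>{p, q, w, f}\<close> is a quadratic equation for \<open>f\<close>, and the polynomial \<open>f\<close> below is one
  of its two solutions; the other one has the opposite sign in front of \<open>\<rho> * \<sigma> * \<tau>\<close>. The first three
  identities make \<open>f\<close> an extension of the triple, the next three recover \<open>w\<close>, \<open>\<sigma>\<close>, \<open>\<tau>\<close> from \<open>p\<close>, \<open>q\<close>, \<open>f\<close>, and
  the last one is the product of the two solutions.\<close>

lemma minus_extension_identities:
  fixes p q w \<rho> \<sigma> \<tau> :: "real poly"
  assumes "\<rho>\<^sup>2 = p * q + 1" "\<sigma>\<^sup>2 = p * w + 1" "\<tau>\<^sup>2 = q * w + 1"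
    and f: "f = p + q + w + 2 * p * q * w - 2 * \<rho> * \<sigma> * \<tau>"
  shows "(\<rho> * \<sigma> - p * \<tau>)\<^sup>2 = p * f + 1"
    and "(\<rho> * \<tau> - q * \<sigma>)\<^sup>2 = q * f + 1"
    and "(w * \<rho> - \<sigma> * \<tau>)\<^sup>2 = w * f + 1"
    and "w = p + q + f + 2 * p * q * f + 2 * \<rho> * (\<rho> * \<sigma> - p * \<tau>) * (\<rho> * \<tau> - q * \<sigma>)"
    and "\<sigma> = \<rho> * (\<rho> * \<sigma> - p * \<tau>) + p * (\<rho> * \<tau> - q * \<sigma>)"
    and "\<tau> = \<rho> * (\<rho> * \<tau> - q * \<sigma>) + q * (\<rho> * \<sigma> - p * \<tau>)"
    and "f * (p + q + w + 2 * p * q * w + 2 * \<rho> * \<sigma> * \<tau>) = (w - p - q)\<^sup>2 - 4 * \<rho>\<^sup>2"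
  using assms(1-3) unfolding f by algebra+

lemma degree_root:
  fixes p q r :: "real poly"
  assumes "0 < p" "0 < q" "r\<^sup>2 = p * q + 1"
  shows "2 * degree r = degree p + degree q"
proof -
  have "degree (p * q + 1) = degree (p * q)"
    using degree_add_nonneg[of "p * q" 1] assms mult_pos_pos[of p q] by simp
  then show ?thesis using assms degree_sq[of r] degree_mult_pos[of p q] by simp
qed

text \<open>All summands are positive, so their leading terms cannot cancel.\<close>

lemma degree_plus_extension:
  fixes p q w \<rho> \<sigma> \<tau> :: "real poly"
  assumes pos: "0 < p" "0 < q" "0 < w" "0 < \<rho>" "0 < \<sigma>" "0 < \<tau>"
    and eqs: "\<rho>\<^sup>2 = p * q + 1" "\<sigma>\<^sup>2 = p * w + 1" "\<tau>\<^sup>2 = q * w + 1"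
  shows "degree (p + q + w + 2 * p * q * w + 2 * \<rho> * \<sigma> * \<tau>) = degree p + degree q + degree w"
proof -
  have 1: "degree (2 * p * q * w) = degree p + degree q + degree w"
    using pos by (simp add: degree_mult_pos)
  have "2 * (degree \<rho> + degree \<sigma> + degree \<tau>) = 2 * (degree p + degree q + degree w)"
    using degree_root[OF pos(1,2) eqs(1)] degree_root[OF pos(1,3) eqs(2)]
      degree_root[OF pos(2,3) eqs(3)] by simp
  then have 2: "degree (2 * \<rho> * \<sigma> * \<tau>) = degree p + degree q + degree w"
    using pos by (simp add: degree_mult_pos)
  have pp: "0 < 2 * p * q * w" "0 < 2 * \<rho> * \<sigma> * \<tau>" using pos by simp_all
  have "degree (p + q + w + 2 * p * q * w) = degree p + degree q + degree w"
    using pos pp by (simp add: degree_add_nonneg 1)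
  then show ?thesis using pos pp by (simp add: degree_add_nonneg 2)
qed

text \<open>The inequality that gives the roots of the smaller extension their signs.\<close>

lemma root_difference_pos:
  fixes p q w \<rho> \<sigma> \<tau> :: "real poly"
  assumes "0 < p" "p < w" "0 < q" "0 < \<rho>" "0 < \<sigma>"
    and "\<rho>\<^sup>2 = p * q + 1" "\<sigma>\<^sup>2 = p * w + 1" "\<tau>\<^sup>2 = q * w + 1"
  shows "0 < \<rho> * \<sigma> - p * \<tau>"
proof -
  have "(\<rho> * \<sigma>)\<^sup>2 - (p * \<tau>)\<^sup>2 = p * (w - p) + p * q + 1"
    unfolding power_mult_distrib assms by algebra
  also have "0 < \<dots>" using assms by (simp add: add_pos_pos)
  finally have "(p * \<tau>)\<^sup>2 < (\<rho> * \<sigma>)\<^sup>2" by simp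
  then have "p * \<tau> < \<rho> * \<sigma>" by (rule power2_less_imp_less) (use assms in simp)
  then show ?thesis by simp
qed

text \<open>The three polynomials are ordered by the order of \<open>\<real>[X]\<close> in which \<open>X\<close> is infinitely large;
  \<open>d_minus\<close> and \<open>d_plus\<close> are the two polynomials that extend the triple to a regular quadruple, and
  \<open>u\<close>, \<open>v\<close> are the roots that belong to \<open>{a, d_minus}\<close> and \<open>{b, d_minus}\<close>. Hence \<open>c\<close> is in turn the larger
  regular extension of \<open>{a, b, d_minus}\<close>, which is how a triple is unfolded into a smaller one.\<close>

locale D1_triple =
  fixes a b c r s t :: "real poly"
  assumes a_pos: "0 < a" and a_less_b: "a < b" and b_less_c: "b < c"
    and degree_b_pos: "0 < degree b"
    and r_sq: "r\<^sup>2 = a * b + 1" and s_sq: "s\<^sup>2 = a * c + 1" and t_sq: "t\<^sup>2 = b * c + 1"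
    and r_pos: "0 < r" and s_pos: "0 < s" and t_pos: "0 < t"
begin

definition d_minus :: "real poly" where
  "d_minus = a + b + c + 2 * a * b * c - 2 * r * s * t"

definition d_plus :: "real poly" where
  "d_plus = a + b + c + 2 * a * b * c + 2 * r * s * t"

definition u :: "real poly" where "u = r * s - a * t"

definition v :: "real poly" where "v = r * t - b * s"

lemma b_pos: "0 < b" and c_pos: "0 < c" and a_less_c: "a < c"
  using a_pos a_less_b b_less_c by simp_all

lemma degree_a_le_b: "degree a \<le> degree b" and degree_b_le_c: "degree b \<le> degree c"
  using degree_mono_nonneg a_pos a_less_b b_less_c b_pos by (simp_all add: order_less_imp_le)

lemma degree_c_pos: "0 < degree c"
  using degree_b_le_c degree_b_pos by simp

lemmas minus_identities = minus_extension_identities[OF r_sq s_sq t_sq d_minus_def, folded u_def v_def]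

lemma u_sq: "u\<^sup>2 = a * d_minus + 1" and v_sq: "v\<^sup>2 = b * d_minus + 1"
  and c_minus_sq: "(c * r - s * t)\<^sup>2 = c * d_minus + 1"
  and c_eq: "c = a + b + d_minus + 2 * a * b * d_minus + 2 * r * u * v"
  and s_eq: "s = r * u + a * v" and t_eq: "t = r * v + b * u"
  using minus_identities by simp_all

lemma plus_sq: "(c * r + s * t)\<^sup>2 = c * d_plus + 1"
  using r_sq s_sq t_sq unfolding d_plus_def by algebra

lemma minus_nonneg: "0 \<le> d_minus"
  using nonneg_of_square[OF b_pos degree_b_pos v_sq] .

lemma u_pos: "0 < u"
  unfolding u_def by (rule root_difference_pos[OF a_pos a_less_c b_pos r_pos s_pos r_sq s_sq t_sq])

lemma v_pos: "0 < v"
  unfolding v_def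
  by (rule root_difference_pos[OF b_pos b_less_c a_pos r_pos t_pos _ t_sq s_sq]) (use r_sq in \<open>simp add: mult.commute\<close>)

lemma degree_r: "2 * degree r = degree a + degree b"
  and degree_s: "2 * degree s = degree a + degree c"
  and degree_t: "2 * degree t = degree b + degree c"
  using degree_root a_pos b_pos c_pos r_sq s_sq t_sq by auto

lemma degree_plus: "degree d_plus = degree a + degree b + degree c"
  unfolding d_plus_def using degree_plus_extension
    a_pos b_pos c_pos r_pos s_pos t_pos r_sq s_sq t_sq by blast

lemma minus_eq_0:
  assumes "d_minus = 0"
  shows "c = a + b + 2 * r" "s = a + r" "t = b + r" "degree c = degree b"
proof -
  have uv: "u = 1" "v = 1"
    using u_sq v_sq u_pos v_pos assms by (auto simp: power2_eq_1_iff)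
  show c: "c = a + b + 2 * r" "s = a + r" "t = b + r"
    using c_eq s_eq t_eq uv assms by simp_all
  have "degree c = max (max (degree a) (degree b)) (degree r)"
    using a_pos b_pos r_pos unfolding c(1) by (simp add: degree_add_nonneg degree_mult_eq)
  then show "degree c = degree b" using degree_r degree_a_le_b by simp
qed

lemma degree_c_minus_ne_0:
  assumes "d_minus \<noteq> 0"
  shows "degree c = degree a + degree b + degree d_minus"
proof -
  have "0 < d_minus" using minus_nonneg assms by simp
  then have "degree (a + b + d_minus + 2 * a * b * d_minus + 2 * r * u * v) = degree a + degree b + degree d_minus"
    using degree_plus_extension a_pos b_pos r_pos u_pos v_pos r_sq u_sq v_sq by blast
  then show ?thesis using c_eq by simp
qed

text \<open>When the two largest members have the same degree and \<open>d_minus\<close> does not vanish, \<open>a\<close> is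
  a scalar, \<open>d_minus\<close> equals \<open>a\<close>, and \<open>c\<close> is an affine function of \<open>b\<close>. The scalar
  \<open>\<kappa> = a + sqrt (a\<^sup>2 + 1)\<close> is the fundamental unit of the equation \<open>x\<^sup>2 - a\<^sup>2 = 1\<close>, so
  \<open>\<kappa> > 1\<close>; this is where the ground field being real is essential.\<close>

lemma same_degree_minus_ne_0:
  assumes "d_minus \<noteq> 0" "degree c = degree b"
  obtains \<kappa> where "\<kappa> > 1" "a = const ((\<kappa> - 1 / \<kappa>) / 2)" "u = const ((\<kappa> + 1 / \<kappa>) / 2)" "d_minus = a" "v = r"
    "c = const (\<kappa>\<^sup>2) * b + const (2 * \<kappa>)" "s = const \<kappa> * r" "t = const \<kappa> * b + 1"
proof -
  have d0: "degree a = 0" "degree d_minus = 0" using degree_c_minus_ne_0 assms by simp_all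
  have m: "d_minus = a"
    using const_partner_unique[OF d0(2,1) _ a_pos degree_b_pos, of v r] minus_nonneg assms(1) v_sq r_sq
    by (simp add: mult.commute)
  have vr: "v = r" using v_sq r_sq m v_pos r_pos
    by (metis mult.commute order_less_imp_le power2_eq_imp_eq)
  obtain a0 where a0: "a = const a0" using degree_0_const d0 by blast
  have a0p: "a0 > 0" using a_pos a0 by (simp add: const_pos)
  define k where "k = sqrt (a0\<^sup>2 + 1)"
  have k2: "k\<^sup>2 = a0\<^sup>2 + 1" and kp: "k > 0"
    by (auto simp: k_def add_nonneg_pos)
  have "u\<^sup>2 = (const k)\<^sup>2" using u_sq m a0 k2
    by (simp add: power2_eq_square flip: const_hom)
  then have u: "u = const k"
    using u_pos kp by (metis const_pos order_less_imp_le power2_eq_imp_eq)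
  define \<kappa> where "\<kappa> = a0 + k"
  have "1 < k" using k2 a0p kp by (metis add.commute less_add_same_cancel1 one_power2 power2_less_imp_less order_less_imp_le zero_less_power)
  then have \<kappa>1: "\<kappa> > 1" using a0p by (simp add: \<kappa>_def)
  have inv: "1 / \<kappa> = k - a0"
    using \<kappa>1 k2 by (simp add: \<kappa>_def field_simps power2_eq_square)
  have A: "a = const ((\<kappa> - 1 / \<kappa>) / 2)" "u = const ((\<kappa> + 1 / \<kappa>) / 2)"
  proof -
    have "(\<kappa> - (k - a0)) / 2 = a0" "(\<kappa> + (k - a0)) / 2 = k" by (simp_all add: \<kappa>_def)
    then show "a = const ((\<kappa> - 1 / \<kappa>) / 2)" "u = const ((\<kappa> + 1 / \<kappa>) / 2)"
      unfolding inv using a0 u by (simp_all only:)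
  qed
  have a2: "const k ^ 2 = a\<^sup>2 + 1" using k2 a0 by (simp flip: const_hom)
  have K: "const \<kappa> = a + const k" by (simp add: \<kappa>_def const_hom a0)
  have c1: "c = 2 * a + b + 2 * a\<^sup>2 * b + 2 * const k * r\<^sup>2"
    using c_eq m vr u by (simp add: power2_eq_square algebra_simps)
  have C: "c = const (\<kappa>\<^sup>2) * b + const (2 * \<kappa>)"
    unfolding const_hom K using c1 r_sq a2 by algebra
  have S: "s = const \<kappa> * r" using s_eq u vr unfolding K by (simp add: algebra_simps)
  have T: "t = const \<kappa> * b + 1" using t_eq u vr r_sq unfolding K by algebra
  show ?thesis by (rule that[OF \<kappa>1 A m vr C S T])
qed

end

section \<open>Ladders of extensions of a pair\<close>

text \<open>If \<open>z\<^sup>2 = c * d + 1\<close> and \<open>x\<^sup>2 = a * d + 1\<close>, one step multiplies \<open>z * sqrt a + x * sqrt c\<close> by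
  the unit \<open>s + sqrt (a * c)\<close> and so passes to another common partner of \<open>a\<close> and \<open>c\<close>. Steps in the
  opposite direction are obtained by changing the sign of \<open>x\<close>.\<close>

primrec ladder :: "real poly \<Rightarrow> real poly \<Rightarrow> real poly \<Rightarrow> real poly \<Rightarrow> real poly \<Rightarrow> nat \<Rightarrow> real poly \<times> real poly"
  where
    "ladder a c s z x 0 = (z, x)"
  | "ladder a c s z x (Suc k) = ladder a c s (s * z + c * x) (s * x + a * z) k"

lemma ladder_Suc_end:
  "ladder a c s z x (Suc k) =
    (s * fst (ladder a c s z x k) + c * snd (ladder a c s z x k),
     s * snd (ladder a c s z x k) + a * fst (ladder a c s z x k))"
  by (induction k arbitrary: z x) auto

text \<open>Powers of the unit \<open>s + sqrt (a * c)\<close> expanded modulo \<open>c\<^sup>2\<close>. Since \<open>s\<^sup>2\<close> is congruent to \<open>1\<close> modulo \<open>c\<close>,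
  two steps change \<open>z\<close> only by a multiple of \<open>c\<close>, and that multiple is quadratic in the number of
  steps.\<close>

lemma ladder_even_mod:
  assumes s: "s\<^sup>2 = a * c + 1"
  shows "\<exists>p q. ladder a c s z x (2 * m) =
    (z + 2 * c * (a * z * of_nat m ^ 2 + s * x * of_nat m) + c\<^sup>2 * p, x + 2 * of_nat m * a * s * z + c * q)"
proof (induction m)
  case (Suc m)
  then obtain p q where l: "ladder a c s z x (2 * m) =
    (z + 2 * c * (a * z * of_nat m ^ 2 + s * x * of_nat m) + c\<^sup>2 * p, x + 2 * of_nat m * a * s * z + c * q)"
    by blast
  define M :: "real poly" where "M = of_nat m"
  define Z where "Z = fst (ladder a c s z x (2 * m))"
  define X where "X = snd (ladder a c s z x (2 * m))"
  have Z: "Z = z + 2 * c * (a * z * M ^ 2 + s * x * M) + c\<^sup>2 * p"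
    and X: "X = x + 2 * M * a * s * z + c * q"
    using l by (simp_all add: Z_def X_def M_def)
  have M1: "of_nat (Suc m) = M + 1" by (simp add: M_def)
  have l2: "ladder a c s z x (2 * Suc m) = (s * (s * Z + c * X) + c * (s * X + a * Z), s * (s * X + a * Z) + a * (s * Z + c * X))"
    unfolding mult_2 add_Suc add_Suc_right ladder_Suc_end fst_conv snd_conv Z_def X_def by simp
  have "s * (s * Z + c * X) + c * (s * X + a * Z)
      = z + 2 * c * (a * z * (M + 1) ^ 2 + s * x * (M + 1))
        + c\<^sup>2 * (p + 2 * a * (2 * (a * z * M ^ 2 + s * x * M) + c * p) + 2 * s * q + 4 * M * a\<^sup>2 * z)"
    unfolding Z X using s by algebra
  moreover have "s * (s * X + a * Z) + a * (s * Z + c * X)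
      = x + 2 * (M + 1) * a * s * z + c * (q + 2 * a * X + 2 * a * s * (2 * (a * z * M ^ 2 + s * x * M) + c * p))"
    unfolding Z X using s by algebra
  ultimately show ?case unfolding l2 M1 by blast
qed auto

lemma ladder_odd_mod:
  assumes s: "s\<^sup>2 = a * c + 1"
  shows "\<exists>p. fst (ladder a c s z x (2 * m + 1)) =
    s * z + c * (2 * a * s * z * (of_nat m ^ 2 + of_nat m) + (2 * of_nat m + 1) * x) + c\<^sup>2 * p"
proof -
  obtain p q where l: "ladder a c s z x (2 * m) =
    (z + 2 * c * (a * z * of_nat m ^ 2 + s * x * of_nat m) + c\<^sup>2 * p, x + 2 * of_nat m * a * s * z + c * q)"
    using ladder_even_mod[OF s] by blast
  define M :: "real poly" where "M = of_nat m"
  have "fst (ladder a c s z x (2 * m + 1)) = s * (z + 2 * c * (a * z * M ^ 2 + s * x * M) + c\<^sup>2 * p)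
      + c * (x + 2 * M * a * s * z + c * q)"
    unfolding Suc_eq_plus1[symmetric] ladder_Suc_end l by (simp add: M_def)
  also have "\<dots> = s * z + c * (2 * a * s * z * (M ^ 2 + M) + (2 * M + 1) * x) + c\<^sup>2 * (s * p + q + 2 * a * x * M)"
    using s by algebra
  finally show ?thesis unfolding M_def by blast
qed

lemma abs_sign: "\<exists>\<epsilon>. (\<epsilon> = 1 \<or> \<epsilon> = - 1) \<and> p = \<epsilon> * \<bar>p\<bar>" for p :: "real poly"
  by (cases "0 \<le> p") (auto intro: exI[of _ 1] exI[of _ "- 1"])

text \<open>Going down: a partner \<open>d\<close> of degree at least \<open>degree c\<close> is replaced by its lower neighbour, the
  smaller regular extension of \<open>{a, c, d}\<close>, until the degree drops below \<open>degree c\<close>. From a partner of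
  degree greater than \<open>degree c\<close> each step lowers the degree by exactly \<open>degree a + degree c\<close>;
  a partner of degree equal to \<open>degree c\<close> lies next to \<open>0\<close> or next to a scalar.\<close>

lemma ladder_descent:
  fixes a c s d x z :: "real poly"
  assumes a: "0 < a" and ac: "a < c" and c: "0 < degree c" and s: "0 < s" "s\<^sup>2 = a * c + 1"
    and d: "0 < d" and x: "0 < x" "x\<^sup>2 = a * d + 1" and z: "0 < z" "z\<^sup>2 = c * d + 1"
  obtains f z0 x0 k where "ladder a c s z0 x0 k = (z, x)" "z0\<^sup>2 = c * f + 1" "x0\<^sup>2 = a * f + 1"
    "0 \<le> f" "degree f < degree c" "0 < x0"
    "f = 0 \<Longrightarrow> 1 \<le> k \<and> degree d = degree c + (k - 1) * (degree a + degree c)"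
    "f \<noteq> 0 \<Longrightarrow> degree d = degree f + k * (degree a + degree c)"
    "f \<noteq> 0 \<Longrightarrow> degree a \<noteq> 0 \<Longrightarrow> 0 < z0"
proof -
  have c_pos: "0 < c" using a ac by simp
  have dac: "degree a \<le> degree c" using degree_mono_nonneg a ac by (simp add: order_less_imp_le)
  let ?G = "\<lambda>d z x f z0 x0 k. ladder a c s z0 x0 k = (z, x) \<and> z0\<^sup>2 = c * f + 1 \<and> x0\<^sup>2 = a * f + 1
    \<and> 0 \<le> f \<and> degree f < degree c \<and> 0 < x0
    \<and> (f = 0 \<longrightarrow> 1 \<le> k \<and> degree d = degree c + (k - 1) * (degree a + degree c))
    \<and> (f \<noteq> 0 \<longrightarrow> degree d = degree f + k * (degree a + degree c))
    \<and> (f \<noteq> 0 \<longrightarrow> degree a \<noteq> 0 \<longrightarrow> 0 < z0)"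
  have "\<exists>f z0 x0 k. ?G d z x f z0 x0 k"
    using d x z
  proof (induction "degree d" arbitrary: d x z rule: less_induct)
    case less
    note d = less.prems(1) and x = less.prems(2,3) and z = less.prems(4,5)
    show ?case
    proof (cases "degree d < degree c")
      case True
      have "?G d z x d z x 0" using True d x z by (simp add: order_less_imp_le)
      then show ?thesis by blast
    next
      case False
      define d' where "d' = a + c + d + 2 * a * c * d - 2 * s * x * z"
      define x' where "x' = s * x - a * z"
      define z' where "z' = s * z - c * x"
      define D where "D = a + c + d + 2 * a * c * d + 2 * s * x * z"
      note ids = minus_extension_identities[OF s(2) x(2) z(2) d'_def]
      have x'2: "x'\<^sup>2 = a * d' + 1" and z'2: "z'\<^sup>2 = c * d' + 1"
        and prod: "d' * D = (d - a - c)\<^sup>2 - 4 * s\<^sup>2"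
        using ids(1,2,7) by (simp_all add: x'_def z'_def D_def)
      have up: "s * z' + c * x' = z" "s * x' + a * z' = x"
        using ids(5,6) by (simp_all add: x'_def z'_def)
      have d'0: "0 \<le> d'" using nonneg_of_square[OF c_pos c z'2] .
      have degD: "degree D = degree a + degree c + degree d"
        unfolding D_def by (rule degree_plus_extension[OF a c_pos d s(1) x(1) z(1) s(2) x(2) z(2)])
      have D0: "D \<noteq> 0" using degD c by auto
      have "(s * x)\<^sup>2 - (a * z)\<^sup>2 = a * (c - a) + a * d + 1"
        unfolding power_mult_distrib s(2) x(2) z(2) by algebra
      also have "0 < \<dots>" using a ac d by (simp add: add_pos_pos)
      finally have "(a * z)\<^sup>2 < (s * x)\<^sup>2" by simp
      then have "a * z < s * x" by (rule power2_less_imp_less) (use s x in simp)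
      then have x'pos: "0 < x'" by (simp add: x'_def)
      have degs: "2 * degree s = degree a + degree c" using degree_root a c_pos s by blast
      have degs4: "degree (4 * s\<^sup>2) = degree a + degree c"
        using degs s(1) by (simp add: degree_mult_eq degree_sq)
      have lad: "ladder a c s z' x' 1 = (z, x)" using up by simp
      show ?thesis
      proof (cases "degree c < degree d")
        case True
        have "degree (d + (- a - c)) = degree d"
          by (rule degree_add_eq_left) (use True dac degree_diff_le[of "- a" "degree c" c] in simp)
        moreover have "d + (- a - c) = d - a - c" by simp
        ultimately have "degree ((d - a - c)\<^sup>2) = 2 * degree d" by (simp only: degree_sq)
        then have dp: "degree (d' * D) = 2 * degree d"
          unfolding prod using degree_add_eq_left[of "- (4 * s\<^sup>2)" "(d - a - c)\<^sup>2"] degs4 True dac by simp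
        then have "d' \<noteq> 0" using True by auto
        then have d'pos: "0 < d'" and dd: "degree d = degree d' + (degree a + degree c)"
          using d'0 dp D0 degD by (auto simp: degree_mult_eq)
        have cd: "c < d" using less_of_degree_less d True by blast
        have "(s * z)\<^sup>2 - (c * x)\<^sup>2 = c * (d - c) + a * c + 1"
          unfolding power_mult_distrib s(2) x(2) z(2) by algebra
        also have "0 < \<dots>" using a c_pos cd by (simp add: add_pos_pos)
        finally have "(c * x)\<^sup>2 < (s * z)\<^sup>2" by simp
        then have "c * x < s * z" by (rule power2_less_imp_less) (use s z in simp)
        then have z'pos: "0 < z'" by (simp add: z'_def)
        have "degree d' < degree d" using dd c by simp
        then obtain f z0 x0 k where g: "?G d' z' x' f z0 x0 k"
          using less.hyps[of d' x' z'] d'pos x'pos x'2 z'pos z'2 by blast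
        have "ladder a c s z0 x0 (Suc k) = (z, x)"
          unfolding ladder_Suc_end using g up by simp
        moreover have "f = 0 \<longrightarrow> degree d = degree c + (Suc k - 1) * (degree a + degree c)"
        proof
          assume "f = 0"
          then have k: "1 \<le> k" and e: "degree d' = degree c + (k - 1) * (degree a + degree c)" using g by auto
          obtain j where j: "k = Suc j" using k by (cases k) auto
          show "degree d = degree c + (Suc k - 1) * (degree a + degree c)" using e dd j by simp
        qed
        ultimately have "?G d z x f z0 x0 (Suc k)" using g dd by simp
        then show ?thesis by blast
      next
        case eq: False
        then have dd: "degree d = degree c" using False by simp
        show ?thesis
        proof (cases "d' = 0")
          case True
          have "?G d z x d' z' x' 1"
            using lad x'pos x'2 z'2 True dd c by simp
          then show ?thesis by blast
        next
          case ne: False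
          have "degree (d - a - c) \<le> degree c"
            using dd dac by (intro degree_diff_le) auto
          then have "degree ((d - a - c)\<^sup>2) \<le> 2 * degree c" by (simp add: degree_sq)
          then have "degree (d' * D) \<le> 2 * degree c"
            unfolding prod using degs4 dac by (intro degree_diff_le) auto
          then have "degree d' + (degree a + degree c + degree c) \<le> 2 * degree c"
            using ne D0 degD dd by (simp add: degree_mult_eq)
          then have z0: "degree d' = 0" "degree a = 0" by auto
          have "?G d z x d' z' x' 1"
            using lad x'pos x'2 z'2 ne dd z0 c d'0 by simp
          then show ?thesis by blast
        qed
      qed
    qed
  qed
  then show ?thesis using that by blast
qed

text \<open>Near the bottom of a ladder one can move by one step without leaving the range of degrees below
  \<open>degree c\<close>, so the number of steps may be assumed to be even. The exceptions are the base \<open>0\<close>, whose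
  neighbours are \<open>a + c \<plusminus> 2 * s\<close>, and scalar bases if \<open>a\<close> is a scalar.\<close>

lemma ladder_even_base:
  fixes a c s z0 x0 f :: "real poly"
  assumes a: "0 < a" and ac: "a < c" and c: "0 < degree c" and s: "0 < s" "s\<^sup>2 = a * c + 1"
    and z0: "z0\<^sup>2 = c * f + 1" and x0: "x0\<^sup>2 = a * f + 1"
    and f: "0 < f" "degree f < degree c" and nconst: "degree a \<noteq> 0 \<or> degree f \<noteq> 0"
  obtains g z1 x1 l where "even l" "ladder a c s z1 x1 l = ladder a c s z0 x0 k"
    "z1\<^sup>2 = c * g + 1" "x1\<^sup>2 = a * g + 1" "0 \<le> g" "degree g < degree c"
    "degree (a + c - 2 * s) = degree c \<Longrightarrow> g \<noteq> 0"
    "g \<noteq> 0 \<Longrightarrow> degree a \<noteq> 0 \<or> degree g \<noteq> 0"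
proof (cases "even k")
  case True
  show ?thesis by (rule that[of k z0 x0 f]) (use True z0 x0 f nconst in auto)
next
  case False
  have c_pos: "0 < c" using a ac by simp
  have dac: "degree a \<le> degree c" using degree_mono_nonneg a ac by (simp add: order_less_imp_le)
  define X where "X = \<bar>x0\<bar>"
  define Z where "Z = \<bar>z0\<bar>"
  have X2: "X\<^sup>2 = a * f + 1" and Z2: "Z\<^sup>2 = c * f + 1" by (simp_all add: X_def Z_def x0 z0)
  have "X\<^sup>2 \<noteq> 0" "Z\<^sup>2 \<noteq> 0" unfolding X2 Z2 using a c_pos f mult_pos_pos[of a f] mult_pos_pos[of c f]
    by (smt (verit) add_pos_pos less_irrefl zero_less_one)+
  then have XZ: "0 < X" "0 < Z" by (auto simp: X_def Z_def)
  define g where "g = a + c + f + 2 * a * c * f - 2 * s * X * Z"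
  define x' where "x' = s * X - a * Z"
  define z' where "z' = s * Z - c * X"
  define D where "D = a + c + f + 2 * a * c * f + 2 * s * X * Z"
  note ids = minus_extension_identities[OF s(2) X2 Z2 g_def]
  have x'2: "x'\<^sup>2 = a * g + 1" and z'2: "z'\<^sup>2 = c * g + 1"
    and prod: "g * D = (f - a - c)\<^sup>2 - 4 * s\<^sup>2"
    using ids(1,2,7) by (simp_all add: x'_def z'_def D_def)
  have up: "s * z' + c * x' = Z" "s * x' + a * z' = X"
    using ids(5,6) by (simp_all add: x'_def z'_def)
  have g0: "0 \<le> g" using nonneg_of_square[OF c_pos c z'2] .
  have degD: "degree D = degree a + degree c + degree f"
    unfolding D_def by (rule degree_plus_extension[OF a c_pos f(1) s(1) XZ s(2) X2 Z2])
  have D0: "D \<noteq> 0" using degD c by auto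
  \<comment> \<open>The product of both neighbours of \<open>f\<close>, now seen from the largest member \<open>c\<close>.\<close>
  have prod2: "g * D = (c - a - f)\<^sup>2 - 4 * X\<^sup>2"
    unfolding prod X2 s(2) by algebra
  have degX: "2 * degree X = degree a + degree f" using degree_root a f X2 by blast
  have degX4: "degree (4 * X\<^sup>2) = degree a + degree f"
    using degX XZ(1) by (simp add: degree_mult_eq degree_sq)
  have "degree (c - a - f) \<le> degree c"
    using f(2) dac by (intro degree_diff_le) auto
  then have "degree ((c - a - f)\<^sup>2) \<le> 2 * degree c" by (simp add: degree_sq)
  then have dle: "degree (g * D) \<le> 2 * degree c"
    unfolding prod2 using degX4 f(2) dac by (intro degree_diff_le) auto
  have dg: "degree g < degree c"
  proof (cases "g = 0")
    case False
    then have "degree g + (degree a + degree c + degree f) \<le> 2 * degree c"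
      using dle D0 degD by (simp add: degree_mult_eq)
    then show ?thesis using nconst by auto
  qed (use c in simp)
  have gne: "g \<noteq> 0" if H: "degree (a + c - 2 * s) = degree c"
  proof
    assume "g = 0"
    then have "(f - a - c)\<^sup>2 = (2 * s)\<^sup>2" using prod by (simp add: power_mult_distrib)
    then have "f - a - c = 2 * s \<or> f - a - c = - (2 * s)" by (simp only: power2_eq_iff)
    then have "f = a + c + 2 * s \<or> f = a + c - 2 * s" by (auto simp: algebra_simps)
    moreover have "degree c \<le> degree (a + c + 2 * s)"
      using a c_pos s(1) by (intro degree_mono_nonneg) auto
    ultimately show False using H f(2) by auto
  qed
  have gnc: "degree a \<noteq> 0 \<or> degree g \<noteq> 0" if "g \<noteq> 0"
  proof (cases "degree a = 0")
    case True
    have "degree (c + (- a - f)) = degree c"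
      by (rule degree_add_eq_left) (use True f c degree_diff_lt[of "- a" "degree c" f] in simp)
    moreover have "c + (- a - f) = c - a - f" by simp
    ultimately have "degree ((c - a - f)\<^sup>2) = 2 * degree c" by (simp only: degree_sq)
    then have "degree (g * D) = 2 * degree c"
      unfolding prod2 using degree_add_eq_left[of "- (4 * X\<^sup>2)" "(c - a - f)\<^sup>2"] degX4 True f by simp
    then have "degree g + (degree a + degree c + degree f) = 2 * degree c"
      using that D0 degD by (simp add: degree_mult_eq)
    then show ?thesis using True f by simp
  qed simp
  have k: "1 \<le> k" using False by (cases k) auto
  obtain \<epsilon> \<delta> :: "real poly" where ed: "\<epsilon> = 1 \<or> \<epsilon> = - 1" "\<delta> = 1 \<or> \<delta> = - 1" "z0 = \<epsilon> * Z" "x0 = \<delta> * X"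
    unfolding X_def Z_def using abs_sign by metis
  have e2: "\<epsilon>\<^sup>2 = 1" using ed by auto
  show ?thesis
  proof (cases "\<delta> = \<epsilon>")
    case True
    have "ladder a c s (\<epsilon> * z') (\<epsilon> * x') (Suc k) = ladder a c s z0 x0 k"
      unfolding ladder.simps ed True up[symmetric] by (simp add: algebra_simps)
    then show ?thesis
      by (intro that[of "Suc k" "\<epsilon> * z'" "\<epsilon> * x'" g])
        (use False g0 dg gne gnc e2 x'2 z'2 in \<open>auto simp: power_mult_distrib\<close>)
  next
    case ne: False
    then have d: "\<delta> = - \<epsilon>" using ed by auto
    obtain j where j: "k = Suc j" using k by (cases k) auto
    have st: "s * z0 + c * x0 = \<epsilon> * z'" "s * x0 + a * z0 = - \<epsilon> * x'"
      unfolding ed d z'_def x'_def by algebra+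
    have "ladder a c s (\<epsilon> * z') (- \<epsilon> * x') j = ladder a c s z0 x0 k"
      unfolding j ladder.simps st ..
    then show ?thesis
      by (intro that[of j "\<epsilon> * z'" "- \<epsilon> * x'" g])
        (use False j g0 dg gne gnc e2 x'2 z'2 in \<open>auto simp: power_mult_distrib\<close>)
  qed
qed

section \<open>Linear relations between the members of a triple\<close>

lemma degree_add_same_sign:
  fixes p q :: "real poly"
  assumes "0 < p * q"
  shows "degree (p + q) = max (degree p) (degree q)"
proof -
  consider "0 < p" "0 < q" | "0 < - p" "0 < - q" using assms by (auto simp: zero_less_mult_iff)
  then show ?thesis
  proof cases
    case 2
    then show ?thesis using degree_add_nonneg[of "- p" "- q"] degree_minus[of "p + q"] by simp
  qed (simp add: degree_add_nonneg)
qed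

text \<open>Let \<open>w\<close> be the larger regular extension of \<open>{p, y, f}\<close> and \<open>S\<close> the root belonging to \<open>p\<close> and
  the larger regular extension of \<open>{p, y, w}\<close>. A scalar combination of \<open>S\<close> and \<open>w\<close> that is as small as
  \<open>p\<close> and \<open>y\<close> forces cancellation between \<open>(2 * p * y + 1) * R\<close> and \<open>2 * u * h * Q\<close> below. The
  relation \<open>g * R = f * Q + W\<close> shows that \<open>R\<close> and \<open>Q\<close> have the same sign, so there is no cancellation
  at all, and the only way out is that \<open>y\<close>, \<open>Q\<close> and \<open>R\<close> are scalars.\<close>

lemma root_relation_scalar:
  fixes p y w f u g h S :: "real poly" and W k P q :: real
  assumes p: "0 < p" "0 < degree p" and y: "0 < y" and f: "0 \<le> f"
    and u: "0 < u" "u\<^sup>2 = p * y + 1" and g: "0 < g" "g\<^sup>2 = p * f + 1" and h: "0 < h" "h\<^sup>2 = y * f + 1"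
    and w: "w = p + y + f + 2 * p * y * f + 2 * u * g * h"
    and S: "S = g * (2 * u\<^sup>2 - 1) + 2 * p * u * h"
    and W: "W \<noteq> 0" and k: "k \<noteq> 0"
    and rel: "const W * S - const k * w = const P * p + const q * y"
  obtains y0 \<sigma> where "y = const y0" "0 < W / k" "\<sigma> = 1 \<or> \<sigma> = - 1"
    "2 * \<sigma> * (W / k) * y0 = 1 - (W / k)\<^sup>2" "4 * \<sigma> * W * y0 = P + k" "3 * \<sigma> * W = (q + k) * y0"
proof -
  define Q where "Q = const W * p - const k * g"
  define R where "R = const W * g - const k * f"
  have gR: "g * R = f * Q + const W" unfolding R_def Q_def using g(2) by algebra
  have main: "(2 * p * y + 1) * R + 2 * (u * h) * Q = const (P + k) * p + const (q + k) * y"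
    using rel u(2) unfolding w S Q_def R_def const_hom by algebra
  have u2: "2 * degree u = degree p + degree y" using degree_root p y u by blast
  have degQ: "degree Q = degree p" if "degree f = 0"
  proof -
    have "2 * degree g \<le> degree p"
    proof (cases "f = 0")
      case True
      then show ?thesis using degree_sq[of g] g by simp
    next
      case False
      then have "0 < f" using f by simp
      then show ?thesis using degree_root[of p f g] p g that by simp
    qed
    then have "degree (- (const k * g)) < degree (const W * p)" using p W k by simp
    then show ?thesis
      unfolding Q_def using degree_add_eq_left[of "- (const k * g)" "const W * p"] W by simp
  qed
  have Q0: "Q \<noteq> 0"
  proof
    assume Q: "Q = 0"
    then have "degree (g * R) = 0" "g * R \<noteq> 0" using gR W by (auto simp: const_eq_0)
    then have "degree g = 0" using const_factors by blast
    then have "degree (p * f + 1) = 0" using g(2) by (metis degree_sq mult_0_right)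
    moreover have "degree (p * f + 1) = degree (p * f)"
      using degree_add_nonneg[of "p * f" 1] p f by simp
    ultimately have "degree f = 0" using p f degree_mult_eq[of p f] by (cases "f = 0") auto
    then show False using degQ Q p by simp
  qed
  have RQ: "0 < R * Q"
  proof (cases "degree (f * Q) = 0")
    case True
    have "f = 0"
    proof (rule ccontr)
      assume "f \<noteq> 0"
      then have "degree f = 0" "degree Q = 0" using True Q0 degree_mult_eq[of f Q] by auto
      then show False using degQ p by simp
    qed
    then have g1: "g = 1" using g by (simp add: power2_eq_1_iff)
    have "0 < const (W\<^sup>2) * p" using p W by (simp add: const_pos)
    moreover have "degree (const (W * k)) < degree (const (W\<^sup>2) * p)"
      using p(2) W by simp
    ultimately have "const (W * k) < const (W\<^sup>2) * p" by (rule less_of_degree_less)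
    moreover have "R * Q = const (W\<^sup>2) * p - const (W * k)"
      unfolding R_def Q_def g1 \<open>f = 0\<close> const_hom by algebra
    ultimately show ?thesis by simp
  next
    case False
    then have "f \<noteq> 0" by auto
    have "degree (- (const W * Q)) < degree (f * Q * Q)"
      using False Q0 \<open>f \<noteq> 0\<close> W by (simp add: degree_mult_eq)
    moreover have "0 < f * Q * Q" using f \<open>f \<noteq> 0\<close> Q0
      by (metis mult.assoc mult_pos_pos not_square_less_zero mult_eq_0_iff linorder_neqE order_le_less)
    ultimately have "- (const W * Q) < f * Q * Q" using less_of_degree_less by blast
    moreover have "g * (R * Q) = f * Q * Q + const W * Q" using gR by algebra
    ultimately have "0 < g * (R * Q)" by simp
    then show ?thesis using g(1) by (simp add: zero_less_mult_iff)
  qed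
  have py1: "0 < 2 * p * y + 1" using p y by (simp add: add_pos_pos)
  have dpy: "degree (2 * p * y + 1) = degree p + degree y"
    using degree_add_nonneg[of "2 * p * y" 1] p y by (simp add: degree_mult_pos)
  have R0: "R \<noteq> 0" using RQ by auto
  have "0 < ((2 * p * y + 1) * R) * (2 * (u * h) * Q)"
  proof -
    have "((2 * p * y + 1) * R) * (2 * (u * h) * Q) = ((2 * p * y + 1) * (2 * (u * h))) * (R * Q)" by algebra
    then show ?thesis
      using mult_pos_pos[OF mult_pos_pos[OF py1 mult_pos_pos[OF zero_less_numeral mult_pos_pos[OF u(1) h(1)]]] RQ]
      by (simp only:)
  qed
  then have "degree (const (P + k) * p + const (q + k) * y)
      = max (degree ((2 * p * y + 1) * R)) (degree (2 * (u * h) * Q))"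
    unfolding main[symmetric] by (rule degree_add_same_sign)
  also have "\<dots> = max (degree p + degree y + degree R) (degree u + degree h + degree Q)"
    using R0 Q0 u h py1 dpy by (simp add: degree_mult_eq)
  finally have dd: "max (degree p + degree y + degree R) (degree u + degree h + degree Q) \<le> max (degree p) (degree y)"
    by (metis degree_add_le_max const_mult_degree_le max.mono order_trans)
  then have dy: "degree y = 0" and dR: "degree R = 0" and duQ: "degree u + degree h + degree Q \<le> degree p"
    using p by auto
  have df: "degree f \<noteq> 0" using degQ duQ u2 p by auto
  then have fpos: "0 < f" using f by (cases "f = 0") auto
  have g2: "2 * degree g = degree p + degree f" using degree_root p fpos g by blast
  have "degree (f * Q + const W) = degree (f * Q)"
    using df Q0 fpos by (intro degree_add_eq_left) (simp add: degree_mult_eq)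
  then have dgf: "degree g = degree f + degree Q"
    unfolding gR[symmetric] using g R0 Q0 fpos dR by (simp add: degree_mult_eq)
  have "degree g = degree f"
  proof (rule ccontr)
    assume "degree g \<noteq> degree f"
    then have "degree (- (const k * f)) < degree (const W * g)" using dgf W k by simp
    then have "degree R = degree g"
      unfolding R_def using degree_add_eq_left[of "- (const k * f)" "const W * g"] W by simp
    then show False using dR dgf df by simp
  qed
  then have dQ: "degree Q = 0" using dgf by simp
  obtain y0 \<theta> \<rho> where y0: "y = const y0" and \<theta>: "Q = const \<theta>" and \<rho>: "R = const \<rho>"
    using degree_0_const dy dQ dR by blast
  have kg: "const k * g = const W * p - const \<theta>" and kf: "const k * f = const W * g - const \<rho>"
    using \<theta> \<rho> unfolding Q_def R_def by (simp_all add: algebra_simps)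
  have "const (k * \<rho> - W * \<theta>) * p + const (\<theta>\<^sup>2 - k\<^sup>2) = 0"
  proof -
    have "(const k * g)\<^sup>2 = p * (const k * (const k * f)) + (const k)\<^sup>2" using g(2) by algebra
    also have "const k * (const k * f) = const W * (const k * g) - const k * const \<rho>" unfolding kf by algebra
    finally show ?thesis unfolding kg const_hom by algebra
  qed
  then have co: "k * \<rho> = W * \<theta>" "\<theta>\<^sup>2 = k\<^sup>2" using linear_relation_coeffs p(2) by force+
  define \<sigma> where "\<sigma> = \<theta> / k"
  define l where "l = W / k"
  have \<sigma>: "\<sigma> = 1 \<or> \<sigma> = - 1"
    using co(2) k unfolding \<sigma>_def power2_eq_iff by auto
  have \<sigma>2: "\<sigma>\<^sup>2 = 1" using \<sigma> by auto
  have kl: "W = k * l" "\<theta> = \<sigma> * k" using k by (simp_all add: l_def \<sigma>_def)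
  then have \<rho>l: "\<rho> = \<sigma> * W" using co k by simp
  have ck: "const k \<noteq> 0" using k by (simp add: const_eq_0)
  have "const k * g = const k * (const l * p - const \<sigma>)"
    using kg unfolding kl const_hom by algebra
  then have gl: "g = const l * p - const \<sigma>" using ck by (simp only: mult_cancel_left) auto
  have "const k * f = const k * (const (l\<^sup>2) * p - const (2 * \<sigma> * l))"
    using kf unfolding \<rho>l unfolding kl gl const_hom by algebra
  then have fl: "f = const (l\<^sup>2) * p - const (2 * \<sigma> * l)" using ck by (simp only: mult_cancel_left) auto
  have lpos: "0 < l"
  proof (rule ccontr)
    assume "\<not> 0 < l"
    moreover have "l \<noteq> 0" using W kl(1) by auto
    ultimately have "0 < const (- l) * p" using p by (simp add: const_pos)
    then have "degree (g + const (- l) * p) = max (degree g) (degree p)"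
      using g(1) \<open>l \<noteq> 0\<close> degree_add_nonneg[of g "const (- l) * p"] by simp
    moreover have "g + const (- l) * p = const (- \<sigma>)" unfolding gl const_hom by algebra
    ultimately show False using p by simp
  qed
  define \<eta> where "\<eta> = 1 - l\<^sup>2 - 2 * \<sigma> * l * y0"
  have fact: "(h - const l * u) * (h + const l * u) = const \<eta>"
  proof -
    have "(h - const l * u) * (h + const l * u) = h\<^sup>2 - (const l)\<^sup>2 * u\<^sup>2" by algebra
    also have "\<dots> = const \<eta>" unfolding h(2) u(2) fl \<eta>_def const_hom y0 by algebra
    finally show ?thesis .
  qed
  have \<eta>0: "\<eta> = 0"
  proof (rule ccontr)
    assume "\<eta> \<noteq> 0"
    then have "degree (h - const l * u) = 0" "degree (h + const l * u) = 0"
      using const_factors[of "h - const l * u" "h + const l * u"] fact by (auto simp: const_eq_0)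
    then have "degree ((h + const l * u) - (h - const l * u)) = 0"
      using degree_diff_le[of "h + const l * u" 0 "h - const l * u"] by simp
    moreover have "(h + const l * u) - (h - const l * u) = const (2 * l) * u" by (simp add: const_hom)
    ultimately show False using lpos u2 p by simp
  qed
  have "0 < h + const l * u" using h u lpos by (simp add: add_pos_pos const_pos)
  then have hl: "h = const l * u" using fact \<eta>0 by (auto simp: const_hom)
  have "const (4 * \<sigma> * W * y0 - (P + k)) * p + const (3 * \<sigma> * W - (q + k) * y0) = 0"
  proof -
    have "(2 * p * y + 1) * const (\<sigma> * W) + 2 * const l * u\<^sup>2 * const (\<sigma> * k)
        = const (P + k) * p + const (q + k) * y"
      using main unfolding hl \<theta> \<rho> \<rho>l kl(2) by algebra
    moreover have "const W = const k * const l" using kl by (simp add: const_hom)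
    ultimately show ?thesis unfolding u(2) y0 const_hom by algebra
  qed
  then have "4 * \<sigma> * W * y0 = P + k" "3 * \<sigma> * W = (q + k) * y0"
    using linear_relation_coeffs p(2) by force+
  then show ?thesis using that[of y0 \<sigma>] y0 lpos \<sigma> \<eta>0 unfolding \<eta>_def l_def by simp
qed

text \<open>If \<open>b\<close> were \<open>l * a\<close> with a scalar \<open>l\<close>, then \<open>r\<^sup>2 - l * a\<^sup>2 = 1\<close> would factor over the reals.\<close>

lemma (in D1_triple) independent_a_b:
  assumes "const x * a + const y * b = 0"
  shows "x = 0" "y = 0"
proof -
  have "y = 0"
  proof (rule ccontr)
    assume y: "y \<noteq> 0"
    define l where "l = - x / y"
    have bl: "b = const l * a"
    proof -
      have "const y * const l = - const x" using y by (simp add: l_def flip: const_hom)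
      then have "const y * b = const y * (const l * a)" using assms unfolding const_hom by algebra
      then show ?thesis using y by (simp add: const_eq_0)
    qed
    have l: "0 < l" using bl b_pos a_pos by (simp add: zero_less_mult_iff const_pos)
    have da: "0 < degree a" using bl degree_b_pos l by simp
    have ls: "const (sqrt l) ^ 2 = const l" using l by (simp flip: const_hom)
    have "(r - const (sqrt l) * a) * (r + const (sqrt l) * a) = 1"
      using r_sq ls unfolding bl by algebra
    then have "degree (r - const (sqrt l) * a) = 0" "degree (r + const (sqrt l) * a) = 0"
      using const_factors[of "r - const (sqrt l) * a" "r + const (sqrt l) * a"] by auto
    then have "degree ((r + const (sqrt l) * a) - (r - const (sqrt l) * a)) = 0"
      using degree_diff_le[of "r + const (sqrt l) * a" 0 "r - const (sqrt l) * a"] by simp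
    moreover have "(r + const (sqrt l) * a) - (r - const (sqrt l) * a) = const (2 * sqrt l) * a"
      by (simp add: const_hom)
    ultimately show False using l da by simp
  qed
  then show "y = 0" "x = 0" using assms a_pos by (auto simp: const_hom const_eq_0)
qed

text \<open>The triples with \<open>d_minus = 0\<close> lie on the quadric
  \<open>a\<^sup>2 + b\<^sup>2 + c\<^sup>2 - 2 * a * b - 2 * b * c - 2 * c * a = 4\<close>. A plane through the origin on which the
  quadratic form is indefinite meets it in no polynomial point, because there the form is a product
  of two linear forms; \<open>x * y + y * z + z * x\<close> is the dual form, whose sign decides which planes
  are of this kind. For the other triples the degrees or the explicit form of \<open>c\<close> leave few relations.\<close>

lemma (in D1_triple) linear_relation_dual_nonneg:
  assumes rel: "const x * a + const y * b + const z * c = 0"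
  shows "0 \<le> x * y + y * z + z * x"
proof (cases "z = 0")
  case True
  then show ?thesis using independent_a_b[of x y] rel by (simp add: const_hom)
next
  case z: False
  consider "d_minus = 0" | "degree b < degree c" | "d_minus \<noteq> 0" "degree c = degree b"
    using degree_b_le_c by force
  then show ?thesis
  proof cases
    case 1
    define M where "M = - x / z - 1"
    define N where "N = - y / z - 1"
    have cMN: "c = const (M + 1) * a + const (N + 1) * b"
    proof -
      have "const z * c = - (const x * a) - const y * b" using rel by algebra
      also have "\<dots> = const z * (const (M + 1) * a + const (N + 1) * b)"
      proof -
        have "const z * const (M + 1) = - const x" "const z * const (N + 1) = - const y"
          using z by (simp_all add: M_def N_def flip: const_hom)
        then show ?thesis by algebra
      qed
      finally show ?thesis using z by (simp add: const_eq_0)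
    qed
    then have r2: "2 * r = const M * a + const N * b"
      using minus_eq_0(1)[OF 1] unfolding const_hom by algebra
    have q4: "(const M * a + const N * b)\<^sup>2 = 4 * a * b + 4" unfolding r2[symmetric] using r_sq by algebra
    have "1 \<le> M * N"
    proof (rule ccontr)
      assume "\<not> 1 \<le> M * N"
      define e where "e = sqrt (1 - M * N)"
      have e: "0 < e" "e\<^sup>2 = 1 - M * N" using \<open>\<not> 1 \<le> M * N\<close> by (auto simp: e_def)
      show False
      proof (cases "M = 0")
        case True
        then have "b * (const (N\<^sup>2) * b - 4 * a) = 4" using q4 unfolding True const_hom by algebra
        then have "degree b = 0" using const_factors[of b "const (N\<^sup>2) * b - 4 * a"] by simp
        then show False using degree_b_pos by simp
      next
        case False
        define A where "A = const (M\<^sup>2) * a + const (M * N - 2) * b"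
        have "const e ^ 2 = 1 - const M * const N" using e by (simp flip: const_hom)
        then have AB: "(A - const (2 * e) * b) * (A + const (2 * e) * b) = const (4 * M\<^sup>2)"
          unfolding A_def const_hom using q4 by algebra
        then have "degree (A - const (2 * e) * b) = 0" "degree (A + const (2 * e) * b) = 0"
          using const_factors[of "A - const (2 * e) * b" "A + const (2 * e) * b"] False by (auto simp: const_eq_0)
        then have "degree ((A + const (2 * e) * b) - (A - const (2 * e) * b)) = 0"
          using degree_diff_le[of "A + const (2 * e) * b" 0 "A - const (2 * e) * b"] by simp
        moreover have "(A + const (2 * e) * b) - (A - const (2 * e) * b) = const (4 * e) * b"
          by (simp add: const_hom)
        ultimately show False using e degree_b_pos by simp
      qed
    qed
    moreover have "x * y + y * z + z * x = z\<^sup>2 * (M * N - 1)"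
      using z by (simp add: M_def N_def field_simps power2_eq_square)
    ultimately show ?thesis by simp
  next
    case 2
    have "degree (const x * a + const y * b) < degree c"
      using 2 degree_a_le_b by (intro degree_add_less) auto
    then show ?thesis using const_mult_eq_low[of z c "const x * a + const y * b"] rel z
      by (simp add: algebra_simps)
  next
    case 3
    then obtain \<kappa> where \<kappa>: "\<kappa> > 1" "a = const ((\<kappa> - 1 / \<kappa>) / 2)" "c = const (\<kappa>\<^sup>2) * b + const (2 * \<kappa>)"
      using same_degree_minus_ne_0 by metis
    have "const (y + z * \<kappa>\<^sup>2) * b + const (x * ((\<kappa> - 1 / \<kappa>) / 2) + z * (2 * \<kappa>)) = 0"
      using rel unfolding \<kappa>(3) unfolding \<kappa>(2) const_hom by algebra
    then have "y + z * \<kappa>\<^sup>2 = 0" "x * ((\<kappa> - 1 / \<kappa>) / 2) + z * (2 * \<kappa>) = 0"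
      using linear_relation_coeffs degree_b_pos by blast+
    then have y: "y = - z * \<kappa>\<^sup>2" and "x * (\<kappa>\<^sup>2 - 1) + 4 * z * \<kappa>\<^sup>2 = 0"
      using \<kappa>(1) by (simp_all add: field_simps power2_eq_square)
    then have "x * y + y * z + z * x = 3 * (z * \<kappa>)\<^sup>2"
      unfolding y by algebra
    then show ?thesis by simp
  qed
qed

section \<open>First-order congruences\<close>

text \<open>The sign of \<open>x\<close> at the base is moved into the step count, which becomes a signed integer.\<close>

lemma ladder_even_signed:
  assumes s: "s\<^sup>2 = a * c + 1" and x: "x\<^sup>2 = X\<^sup>2"
  obtains \<mu> :: int and p where "\<bar>\<mu>\<bar> = int m" "of_nat m * x = of_int \<mu> * X"
    "fst (ladder a c s z x (2 * m)) = z + c * (2 * (a * z * of_int \<mu> ^ 2 + s * X * of_int \<mu>)) + c\<^sup>2 * p"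
proof -
  obtain p q where l: "ladder a c s z x (2 * m) =
    (z + 2 * c * (a * z * of_nat m ^ 2 + s * x * of_nat m) + c\<^sup>2 * p, x + 2 * of_nat m * a * s * z + c * q)"
    using ladder_even_mod[OF s] by blast
  from x have "x = X \<or> x = - X" by (simp only: power2_eq_iff)
  then show ?thesis
  proof
    assume "x = X"
    then show ?thesis using that[of "int m" p] l by (simp add: algebra_simps)
  next
    assume "x = - X"
    then show ?thesis using that[of "- int m" p] l by (simp add: algebra_simps)
  qed
qed

lemma ladder_odd_signed:
  assumes s: "s\<^sup>2 = a * c + 1" and x: "x\<^sup>2 = X\<^sup>2"
  obtains j :: int and p where "\<bar>2 * j + 1\<bar> = 2 * int m + 1" "(2 * of_nat m + 1) * x = (2 * of_int j + 1) * X"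
    "fst (ladder a c s z x (2 * m + 1)) =
      s * z + c * (2 * a * s * z * (of_int j ^ 2 + of_int j) + (2 * of_int j + 1) * X) + c\<^sup>2 * p"
proof -
  obtain p where l: "fst (ladder a c s z x (2 * m + 1)) =
    s * z + c * (2 * a * s * z * (of_nat m ^ 2 + of_nat m) + (2 * of_nat m + 1) * x) + c\<^sup>2 * p"
    using ladder_odd_mod[OF s] by blast
  from x have "x = X \<or> x = - X" by (simp only: power2_eq_iff)
  then show ?thesis
  proof
    assume "x = X"
    then show ?thesis using that[of "int m" p] l by simp
  next
    assume x: "x = - X"
    show ?thesis
    proof (rule that[of "- int m - 1" p])
      show "(2 * of_nat m + 1) * x = (2 * of_int (- int m - 1) + 1) * X"
        unfolding x by (simp add: algebra_simps)
      define M :: "real poly" where "M = of_nat m"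
      have M: "of_int (- int m - 1) = - M - 1" by (simp add: M_def)
      show "fst (ladder a c s z x (2 * m + 1)) = s * z + c * (2 * a * s * z *
          (of_int (- int m - 1) ^ 2 + of_int (- int m - 1)) + (2 * of_int (- int m - 1) + 1) * X) + c\<^sup>2 * p"
        unfolding l M M_def[symmetric] unfolding x by algebra
    qed simp
  qed
qed

text \<open>Two expansions of the same polynomial modulo \<open>c\<^sup>2\<close> are compared after dividing by \<open>c\<close>.\<close>

lemma first_order_dvd:
  fixes c :: "real poly"
  assumes "\<rho> + c * \<tau> + c\<^sup>2 * p = \<rho>' + c * \<tau>' + c\<^sup>2 * p'" "\<rho> - \<rho>' = c * g" "c \<noteq> 0"
  shows "c dvd g + \<tau> - \<tau>'"
proof -
  have "c * (g + \<tau> - \<tau>') = c * (c * (p' - p))" using assms(1,2) by algebra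
  then show ?thesis using assms(3) by simp
qed

text \<open>Normalizing a congruence modulo \<open>c\<close>: \<open>M\<close> is usually the root at the base, which is its own inverse
  modulo \<open>c\<close>, and \<open>Q\<close> collects the multiples of \<open>c\<close>.\<close>

lemma dvd_linear_shift: "c dvd X \<Longrightarrow> Y = M * X + c * Q \<Longrightarrow> c dvd Y" for c :: "real poly"
  by simp

lemma dvd_two_mult: "c dvd 2 * p \<Longrightarrow> c dvd p" for c p :: "real poly"
  using dvd_linear_shift[of c "2 * p" p "const (1 / 2)" 0]
  by (simp add: mult.assoc[symmetric] const_hom(8)[symmetric] const_hom(4)[symmetric] const_def)

text \<open>In the five congruences below the same polynomial is reached on the ladders of \<open>(a, c)\<close> and
  \<open>(b, c)\<close>. The names record the base, which is \<open>0\<close>, the smaller regular extension \<open>e\<close>, or \<open>a\<close> itself, and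
  the parity of the number of steps where it differs on the two sides. A base \<open>a\<close> on the side of \<open>(a, c)\<close>
  requires \<open>a\<^sup>2 + 1 = k\<^sup>2\<close>. The locale can also be interpreted with the parts of
  \<open>a\<close> and \<open>b\<close> exchanged.\<close>

locale D1_roots =
  fixes a b c r s t e :: "real poly"
  assumes r: "r\<^sup>2 = a * b + 1" and s: "s\<^sup>2 = a * c + 1" and t: "t\<^sup>2 = b * c + 1"
    and e: "e = a + b + c + 2 * a * b * c - 2 * r * s * t" and c0: "c \<noteq> 0"
begin

lemma congruence_base_0:
  assumes z: "\<zeta>\<^sup>2 = 1" and x0: "x0\<^sup>2 = 1" and y0: "y0\<^sup>2 = 1"
    and eq: "fst (ladder a c s \<zeta> x0 (2 * m)) = fst (ladder b c t \<zeta> y0 (2 * n))"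
  obtains \<mu> \<nu> :: int where "\<bar>\<mu>\<bar> = int m" "\<bar>\<nu>\<bar> = int n" "of_nat m * x0 = of_int \<mu> * \<zeta>"
    "c dvd a * of_int \<mu> ^ 2 + s * of_int \<mu> - (b * of_int \<nu> ^ 2 + t * of_int \<nu>)"
proof -
  have xz: "x0\<^sup>2 = \<zeta>\<^sup>2" "y0\<^sup>2 = \<zeta>\<^sup>2" using assms by simp_all
  obtain \<mu> p where m: "\<bar>\<mu>\<bar> = int m" "of_nat m * x0 = of_int \<mu> * \<zeta>"
    "fst (ladder a c s \<zeta> x0 (2 * m)) = \<zeta> + c * (2 * (a * \<zeta> * of_int \<mu> ^ 2 + s * \<zeta> * of_int \<mu>)) + c\<^sup>2 * p"
    using ladder_even_signed[OF s xz(1)] by metis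
  obtain \<nu> q where n: "\<bar>\<nu>\<bar> = int n" "of_nat n * y0 = of_int \<nu> * \<zeta>"
    "fst (ladder b c t \<zeta> y0 (2 * n)) = \<zeta> + c * (2 * (b * \<zeta> * of_int \<nu> ^ 2 + t * \<zeta> * of_int \<nu>)) + c\<^sup>2 * q"
    using ladder_even_signed[OF t xz(2)] by metis
  have "c dvd 0 + 2 * (a * \<zeta> * of_int \<mu> ^ 2 + s * \<zeta> * of_int \<mu>) - 2 * (b * \<zeta> * of_int \<nu> ^ 2 + t * \<zeta> * of_int \<nu>)"
    by (rule first_order_dvd[OF eq[unfolded m n]]) (use c0 in simp_all)
  then have "c dvd 2 * (a * of_int \<mu> ^ 2 + s * of_int \<mu> - (b * of_int \<nu> ^ 2 + t * of_int \<nu>))"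
    by (rule dvd_linear_shift[of _ _ _ \<zeta> 0]) (use z in algebra)
  then show ?thesis using that m n dvd_two_mult by blast
qed

lemma congruence_base_minus:
  assumes \<epsilon>: "\<epsilon>\<^sup>2 = 1" and x0: "x0\<^sup>2 = a * e + 1" and y0: "y0\<^sup>2 = b * e + 1"
    and eq: "fst (ladder a c s (\<epsilon> * (c * r - s * t)) x0 (2 * m)) = fst (ladder b c t (\<epsilon> * (c * r - s * t)) y0 (2 * n))"
  obtains \<mu> \<nu> :: int where "\<bar>\<mu>\<bar> = int m" "\<bar>\<nu>\<bar> = int n" "of_nat m * x0 = of_int \<mu> * (\<epsilon> * (a * t - r * s))"
    "c dvd 2 * a * of_int \<mu> ^ 2 + (b - a - e) * of_int \<mu> - (2 * b * of_int \<nu> ^ 2 + (a - b - e) * of_int \<nu>)"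
proof -
  define w where "w = c * r - s * t"
  define u where "u = a * t - r * s"
  define v where "v = b * s - r * t"
  note ids = minus_extension_identities[OF r s t e]
  have xz: "x0\<^sup>2 = (\<epsilon> * u)\<^sup>2" "y0\<^sup>2 = (\<epsilon> * v)\<^sup>2"
    using ids(1,2) x0 y0 \<epsilon> unfolding u_def v_def power_mult_distrib
    by (simp_all add: power2_commute)
  obtain \<mu> p where m: "\<bar>\<mu>\<bar> = int m" "of_nat m * x0 = of_int \<mu> * (\<epsilon> * u)"
    "fst (ladder a c s (\<epsilon> * w) x0 (2 * m)) = \<epsilon> * w + c * (2 * (a * (\<epsilon> * w) * of_int \<mu> ^ 2 + s * (\<epsilon> * u) * of_int \<mu>)) + c\<^sup>2 * p"
    using ladder_even_signed[OF s xz(1)] by metis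
  obtain \<nu> q where n: "\<bar>\<nu>\<bar> = int n" "of_nat n * y0 = of_int \<nu> * (\<epsilon> * v)"
    "fst (ladder b c t (\<epsilon> * w) y0 (2 * n)) = \<epsilon> * w + c * (2 * (b * (\<epsilon> * w) * of_int \<nu> ^ 2 + t * (\<epsilon> * v) * of_int \<nu>)) + c\<^sup>2 * q"
    using ladder_even_signed[OF t xz(2)] by metis
  define M :: "real poly" where "M = of_int \<mu>"
  define N :: "real poly" where "N = of_int \<nu>"
  have "c dvd 0 + 2 * (a * (\<epsilon> * w) * M ^ 2 + s * (\<epsilon> * u) * M) - 2 * (b * (\<epsilon> * w) * N ^ 2 + t * (\<epsilon> * v) * N)"
    unfolding M_def N_def by (rule first_order_dvd[OF eq[folded w_def, unfolded m n]]) (use c0 in simp_all)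
  \<comment> \<open>The root \<open>\<epsilon> * w\<close> at the base is congruent to \<open>- (s * t * \<epsilon>)\<close>, and \<open>2 * r * s * t\<close> to \<open>a + b - e\<close>.\<close>
  moreover have "2 * a * M ^ 2 + (b - a - e) * M - (2 * b * N ^ 2 + (a - b - e) * N)
    = - (s * t * \<epsilon>) * (0 + 2 * (a * (\<epsilon> * w) * M ^ 2 + s * (\<epsilon> * u) * M) - 2 * (b * (\<epsilon> * w) * N ^ 2 + t * (\<epsilon> * v) * N))
      + c * ((2 * b * N\<^sup>2 * (a + b + a * b * c - r * s * t) + (1 + b * (a - b + c - e)) * N)
           - (2 * a * M\<^sup>2 * (a + b + a * b * c - r * s * t) + (1 + a * (b - a + c - e)) * M))"
  proof -
    define g where "g = r * s * t"
    have 1: "s * t * (a * w * M ^ 2 + s * u * M) = a * M\<^sup>2 * (c * g - s\<^sup>2 * t\<^sup>2) + s\<^sup>2 * (a * t\<^sup>2 - g) * M"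
      unfolding w_def u_def g_def by algebra
    have 2: "s * t * (b * w * N ^ 2 + t * v * N) = b * N\<^sup>2 * (c * g - s\<^sup>2 * t\<^sup>2) + t\<^sup>2 * (b * s\<^sup>2 - g) * N"
      unfolding w_def v_def g_def by algebra
    have 3: "- (s * t * \<epsilon>) * (0 + 2 * (a * (\<epsilon> * w) * M ^ 2 + s * (\<epsilon> * u) * M) - 2 * (b * (\<epsilon> * w) * N ^ 2 + t * (\<epsilon> * v) * N))
      = - 2 * \<epsilon>\<^sup>2 * (s * t * (a * w * M ^ 2 + s * u * M)) + 2 * \<epsilon>\<^sup>2 * (s * t * (b * w * N ^ 2 + t * v * N))" by algebra
    have eg: "e = a + b + c + 2 * a * b * c - 2 * g" unfolding e g_def by algebra
    show ?thesis unfolding 3 1 2 \<epsilon> s t g_def[symmetric] eg by algebra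
  qed
  ultimately have "c dvd 2 * a * M ^ 2 + (b - a - e) * M - (2 * b * N ^ 2 + (a - b - e) * N)"
    by (rule dvd_linear_shift)
  then show ?thesis using that[of \<mu> \<nu>] m n unfolding M_def N_def u_def by blast
qed

lemma two_rst: "2 * (r * s * t) = (a + b - e) + c * (1 + 2 * a * b)"
  unfolding e by algebra

lemma congruence_base_a:
  assumes \<epsilon>: "\<epsilon>\<^sup>2 = 1" and x0: "x0\<^sup>2 = k\<^sup>2" and y0: "y0\<^sup>2 = r\<^sup>2"
    and eq: "fst (ladder a c s (\<epsilon> * s) x0 (2 * m)) = fst (ladder b c t (\<epsilon> * s) y0 (2 * n))"
  obtains \<mu> \<nu> :: int where "\<bar>\<mu>\<bar> = int m" "\<bar>\<nu>\<bar> = int n" "of_nat m * x0 = of_int \<mu> * (\<epsilon> * k)"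
    "of_nat n * y0 = of_int \<nu> * (\<epsilon> * r)"
    "c dvd 2 * a * of_int \<mu> ^ 2 + 2 * k * of_int \<mu> - (2 * b * of_int \<nu> ^ 2 + (a + b - e) * of_int \<nu>)"
proof -
  have xz: "x0\<^sup>2 = (\<epsilon> * k)\<^sup>2" "y0\<^sup>2 = (\<epsilon> * r)\<^sup>2"
    using x0 y0 \<epsilon> by (simp_all add: power_mult_distrib)
  obtain \<mu> p where m: "\<bar>\<mu>\<bar> = int m" "of_nat m * x0 = of_int \<mu> * (\<epsilon> * k)"
    "fst (ladder a c s (\<epsilon> * s) x0 (2 * m)) = \<epsilon> * s + c * (2 * (a * (\<epsilon> * s) * of_int \<mu> ^ 2 + s * (\<epsilon> * k) * of_int \<mu>)) + c\<^sup>2 * p"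
    using ladder_even_signed[OF s xz(1)] by metis
  obtain \<nu> q where n: "\<bar>\<nu>\<bar> = int n" "of_nat n * y0 = of_int \<nu> * (\<epsilon> * r)"
    "fst (ladder b c t (\<epsilon> * s) y0 (2 * n)) = \<epsilon> * s + c * (2 * (b * (\<epsilon> * s) * of_int \<nu> ^ 2 + t * (\<epsilon> * r) * of_int \<nu>)) + c\<^sup>2 * q"
    using ladder_even_signed[OF t xz(2)] by metis
  define M :: "real poly" where "M = of_int \<mu>"
  define N :: "real poly" where "N = of_int \<nu>"
  have "c dvd 0 + 2 * (a * (\<epsilon> * s) * M ^ 2 + s * (\<epsilon> * k) * M) - 2 * (b * (\<epsilon> * s) * N ^ 2 + t * (\<epsilon> * r) * N)"
    unfolding M_def N_def by (rule first_order_dvd[OF eq[unfolded m n]]) (use c0 in simp_all)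
  moreover have "2 * a * M ^ 2 + 2 * k * M - (2 * b * N ^ 2 + (a + b - e) * N)
    = (s * \<epsilon>) * (0 + 2 * (a * (\<epsilon> * s) * M ^ 2 + s * (\<epsilon> * k) * M) - 2 * (b * (\<epsilon> * s) * N ^ 2 + t * (\<epsilon> * r) * N))
      + c * ((1 + 2 * a * b) * N - 2 * a * (a * M\<^sup>2 + k * M - b * N\<^sup>2))"
  proof -
    have 3: "(s * \<epsilon>) * (0 + 2 * (a * (\<epsilon> * s) * M ^ 2 + s * (\<epsilon> * k) * M) - 2 * (b * (\<epsilon> * s) * N ^ 2 + t * (\<epsilon> * r) * N))
      = \<epsilon>\<^sup>2 * (2 * s\<^sup>2 * (a * M\<^sup>2 + k * M - b * N\<^sup>2) - 2 * (r * s * t) * N)" by algebra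
    show ?thesis unfolding 3 \<epsilon> s two_rst by algebra
  qed
  ultimately have "c dvd 2 * a * M ^ 2 + 2 * k * M - (2 * b * N ^ 2 + (a + b - e) * N)"
    by (rule dvd_linear_shift)
  then show ?thesis using that[of \<mu> \<nu>] m n unfolding M_def N_def by blast
qed

lemma congruence_base_0_odd_a_even:
  assumes z: "\<zeta>\<^sup>2 = 1" and x0: "x0\<^sup>2 = 1" and y1: "y1\<^sup>2 = r\<^sup>2"
    and eq: "fst (ladder a c s \<zeta> x0 (2 * m + 1)) = fst (ladder b c t (s * \<zeta>) y1 (2 * n))"
  obtains j \<nu> :: int where "\<bar>\<nu>\<bar> = int n"
    "c dvd 2 * a * (of_int j ^ 2 + of_int j) + (2 * of_int j + 1) * s - (2 * b * of_int \<nu> ^ 2 + (a + b - e) * of_int \<nu>)"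
proof -
  have xz: "x0\<^sup>2 = \<zeta>\<^sup>2" "y1\<^sup>2 = (\<zeta> * r)\<^sup>2"
    using assms by (simp_all add: power_mult_distrib)
  obtain j p where m: "\<bar>2 * j + 1\<bar> = 2 * int m + 1" "(2 * of_nat m + 1) * x0 = (2 * of_int j + 1) * \<zeta>"
    "fst (ladder a c s \<zeta> x0 (2 * m + 1)) =
      s * \<zeta> + c * (2 * a * s * \<zeta> * (of_int j ^ 2 + of_int j) + (2 * of_int j + 1) * \<zeta>) + c\<^sup>2 * p"
    using ladder_odd_signed[OF s xz(1)] by metis
  obtain \<nu> q where n: "\<bar>\<nu>\<bar> = int n" "of_nat n * y1 = of_int \<nu> * (\<zeta> * r)"
    "fst (ladder b c t (s * \<zeta>) y1 (2 * n)) = s * \<zeta> + c * (2 * (b * (s * \<zeta>) * of_int \<nu> ^ 2 + t * (\<zeta> * r) * of_int \<nu>)) + c\<^sup>2 * q"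
    using ladder_even_signed[OF t xz(2)] by metis
  define J :: "real poly" where "J = of_int j ^ 2 + of_int j"
  define W :: "real poly" where "W = 2 * of_int j + 1"
  define N :: "real poly" where "N = of_int \<nu>"
  have "c dvd 0 + (2 * a * s * \<zeta> * J + W * \<zeta>) - 2 * (b * (s * \<zeta>) * N ^ 2 + t * (\<zeta> * r) * N)"
    unfolding J_def W_def N_def by (rule first_order_dvd[OF eq[unfolded m n]]) (use c0 in simp_all)
  moreover have "2 * a * J + W * s - (2 * b * N ^ 2 + (a + b - e) * N)
    = (s * \<zeta>) * (0 + (2 * a * s * \<zeta> * J + W * \<zeta>) - 2 * (b * (s * \<zeta>) * N ^ 2 + t * (\<zeta> * r) * N))
      + c * ((1 + 2 * a * b) * N - 2 * a * (a * J - b * N\<^sup>2))"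
  proof -
    have 3: "(s * \<zeta>) * (0 + (2 * a * s * \<zeta> * J + W * \<zeta>) - 2 * (b * (s * \<zeta>) * N ^ 2 + t * (\<zeta> * r) * N))
      = \<zeta>\<^sup>2 * (2 * s\<^sup>2 * (a * J - b * N\<^sup>2) + W * s - 2 * (r * s * t) * N)" by algebra
    show ?thesis unfolding 3 z s two_rst by algebra
  qed
  ultimately have "c dvd 2 * a * J + W * s - (2 * b * N ^ 2 + (a + b - e) * N)"
    by (rule dvd_linear_shift)
  then show ?thesis using that[of \<nu> j] n unfolding J_def W_def N_def by blast
qed

lemma congruence_base_a_odd_0_even:
  assumes z: "\<zeta>\<^sup>2 = 1" and x0: "x0\<^sup>2 = k\<^sup>2" and y1: "y1\<^sup>2 = 1"
    and eq: "fst (ladder a c s (\<zeta> * s) x0 (2 * m + 1)) = fst (ladder b c t \<zeta> y1 (2 * n))"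
  obtains j \<nu> :: int where "\<bar>2 * j + 1\<bar> = 2 * int m + 1" "(2 * of_nat m + 1) * x0 = (2 * of_int j + 1) * (\<zeta> * k)"
    "\<bar>\<nu>\<bar> = int n" "of_nat n * y1 = of_int \<nu> * \<zeta>"
    "c dvd a + 2 * a * (of_int j ^ 2 + of_int j) + (2 * of_int j + 1) * k - (2 * b * of_int \<nu> ^ 2 + 2 * t * of_int \<nu>)"
proof -
  have xz: "x0\<^sup>2 = (\<zeta> * k)\<^sup>2" "y1\<^sup>2 = \<zeta>\<^sup>2"
    using assms by (simp_all add: power_mult_distrib)
  obtain j p where m: "\<bar>2 * j + 1\<bar> = 2 * int m + 1" "(2 * of_nat m + 1) * x0 = (2 * of_int j + 1) * (\<zeta> * k)"
    "fst (ladder a c s (\<zeta> * s) x0 (2 * m + 1)) =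
      s * (\<zeta> * s) + c * (2 * a * s * (\<zeta> * s) * (of_int j ^ 2 + of_int j) + (2 * of_int j + 1) * (\<zeta> * k)) + c\<^sup>2 * p"
    using ladder_odd_signed[OF s xz(1)] by metis
  obtain \<nu> q where n: "\<bar>\<nu>\<bar> = int n" "of_nat n * y1 = of_int \<nu> * \<zeta>"
    "fst (ladder b c t \<zeta> y1 (2 * n)) = \<zeta> + c * (2 * (b * \<zeta> * of_int \<nu> ^ 2 + t * \<zeta> * of_int \<nu>)) + c\<^sup>2 * q"
    using ladder_even_signed[OF t xz(2)] by metis
  define J :: "real poly" where "J = of_int j ^ 2 + of_int j"
  define W :: "real poly" where "W = 2 * of_int j + 1"
  define N :: "real poly" where "N = of_int \<nu>"
  have g: "s * (\<zeta> * s) - \<zeta> = c * (\<zeta> * a)" using s by algebra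
  have "c dvd \<zeta> * a + (2 * a * s * (\<zeta> * s) * J + W * (\<zeta> * k)) - 2 * (b * \<zeta> * N ^ 2 + t * \<zeta> * N)"
    unfolding J_def W_def N_def by (rule first_order_dvd[OF eq[unfolded m n] g c0])
  moreover have "a + 2 * a * J + W * k - (2 * b * N ^ 2 + 2 * t * N)
    = \<zeta> * (\<zeta> * a + (2 * a * s * (\<zeta> * s) * J + W * (\<zeta> * k)) - 2 * (b * \<zeta> * N ^ 2 + t * \<zeta> * N))
      + c * (- 2 * a\<^sup>2 * J)"
  proof -
    have 3: "\<zeta> * (\<zeta> * a + (2 * a * s * (\<zeta> * s) * J + W * (\<zeta> * k)) - 2 * (b * \<zeta> * N ^ 2 + t * \<zeta> * N))
      = \<zeta>\<^sup>2 * (a + 2 * a * s\<^sup>2 * J + W * k - 2 * (b * N\<^sup>2 + t * N))" by algebra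
    show ?thesis unfolding 3 z s by algebra
  qed
  ultimately have "c dvd a + 2 * a * J + W * k - (2 * b * N ^ 2 + 2 * t * N)"
    by (rule dvd_linear_shift)
  then show ?thesis using that[of j \<nu>] m n unfolding J_def W_def N_def by blast
qed

end

section \<open>Solving the congruences when \<open>b\<close> has smaller degree than \<open>c\<close>\<close>

lemma degree_of_int_mult: "degree (of_int i * p) = (if i = 0 then 0 else degree p)" for p :: "real poly"
  using degree_const_mult[of "of_int i" p] by (simp add: const_of_int)

lemma degree_mult_of_int_le: "degree (p * of_int i) \<le> degree p" for p :: "real poly"
  using degree_of_int_mult[of i p] by (simp add: mult.commute)

lemma odd_ne_0: "2 * j + 1 \<noteq> (0 :: int)"
  by presburger

lemma consecutive_product_nonneg: "0 \<le> j\<^sup>2 + (j :: int)"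
proof -
  have "j\<^sup>2 + j = j * (j + 1)" by (simp add: power2_eq_square algebra_simps)
  also have "0 \<le> \<dots>" by (cases "0 \<le> j") (auto simp: mult_nonpos_nonpos)
  finally show ?thesis .
qed

context D1_triple
begin

sublocale roots: D1_roots a b c r s t d_minus
  using r_sq s_sq t_sq d_minus_def c_pos by unfold_locales auto

end

text \<open>Under this hypothesis \<open>d_minus\<close> is not zero, and every polynomial in the first-order congruences has
  degree less than \<open>degree c\<close>: the congruences modulo \<open>c\<close> are equations.\<close>

locale D1_triple_gap = D1_triple +
  assumes gap: "degree b < degree c"
begin

lemma d_minus_ne_0: "d_minus \<noteq> 0"
  using minus_eq_0 gap by auto

lemma d_minus_pos: "0 < d_minus"
  using d_minus_ne_0 minus_nonneg by simp

lemma degree_c_eq: "degree c = degree a + degree b + degree d_minus"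
  using degree_c_minus_ne_0 d_minus_ne_0 .

lemma gap': "0 < degree a + degree d_minus"
  using degree_c_eq gap by simp

lemma degree_t_less: "degree t < degree c" and degree_s_less: "degree s < degree c"
  and degree_b_less_t: "degree b < degree t"
  using degree_t degree_s gap degree_a_le_b by simp_all

lemma d_minus_ne_a: "d_minus \<noteq> a"
proof
  assume "d_minus = a"
  then have "degree a = 0" using self_product_not_square[of a u] u_sq by auto
  then show False using \<open>d_minus = a\<close> gap' by simp
qed

lemma d_minus_ne_b: "d_minus \<noteq> b"
  using self_product_not_square[of b v] v_sq degree_b_pos by auto

lemma d_minus_triple_cases:
  obtains (least) "d_minus < a" "0 < degree a" "D1_triple d_minus a b u v r"
  | (middle) "a < d_minus" "d_minus < b" "0 < degree d_minus" "D1_triple a d_minus b u r v"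
  | (greatest) "b < d_minus" "D1_triple a b d_minus r u v"
proof -
  consider "d_minus < a" | "a < d_minus" "d_minus < b" | "b < d_minus"
    using d_minus_ne_a d_minus_ne_b by force
  then show ?thesis
  proof cases
    case 1
    then have "0 < degree a"
      using degree_mono_nonneg[of d_minus a] minus_nonneg gap' by (auto simp: order_less_imp_le)
    moreover from this have "D1_triple d_minus a b u v r"
      using 1 d_minus_pos a_less_b u_sq v_sq r_sq u_pos v_pos r_pos
      by unfold_locales (simp_all add: mult.commute)
    ultimately show ?thesis using 1 least by blast
  next
    case 2
    then have "0 < degree d_minus"
      using degree_mono_nonneg[of a d_minus] a_pos gap' by (auto simp: order_less_imp_le)
    moreover from this have "D1_triple a d_minus b u r v"
      using 2 a_pos u_sq v_sq r_sq u_pos v_pos r_pos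
      by unfold_locales (simp_all add: mult.commute)
    ultimately show ?thesis using 2 middle by blast
  next
    case 3
    then have "D1_triple a b d_minus r u v"
      using a_pos a_less_b degree_b_pos u_sq v_sq r_sq u_pos v_pos r_pos
      by unfold_locales simp_all
    then show ?thesis using 3 greatest by blast
  qed
qed

text \<open>The members of \<open>{a, b, d_minus}\<close> form a triple whatever their order, and the dual form is symmetric.\<close>

lemma minus_relation_dual_nonneg:
  assumes "const x * a + const y * b + const z * d_minus = 0"
  shows "0 \<le> x * y + y * z + z * x"
proof (cases rule: d_minus_triple_cases)
  case least
  then show ?thesis
    using D1_triple.linear_relation_dual_nonneg[of d_minus a b u v r z x y] assms by (simp add: algebra_simps)
next
  case middle
  then show ?thesis
    using D1_triple.linear_relation_dual_nonneg[of a d_minus b u r v x z y] assms by (simp add: algebra_simps)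
next
  case greatest
  then show ?thesis
    using D1_triple.linear_relation_dual_nonneg[of a b d_minus r u v x y z] assms by (simp add: algebra_simps)
qed

text \<open>Set \<open>P = a * \<mu>\<^sup>2 - b * \<nu>\<^sup>2\<close>. The congruence becomes the equation \<open>P = t * \<nu> - s * \<mu>\<close>, and multiplying
  by \<open>t * \<nu> + s * \<mu>\<close> gives \<open>P * (t * \<nu> + s * \<mu> + c) = \<nu>\<^sup>2 - \<mu>\<^sup>2\<close>, where the second factor has the degree
  of \<open>c\<close>.\<close>

lemma solve_base_0:
  assumes dv: "c dvd a * of_int \<mu> ^ 2 + s * of_int \<mu> - (b * of_int \<nu> ^ 2 + t * of_int \<nu>)"
  shows "\<mu> = 0" "\<nu> = 0"
proof -
  define M :: "real poly" where "M = of_int \<mu>"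
  define N :: "real poly" where "N = of_int \<nu>"
  have le: "degree (a * M ^ 2) < degree c" "degree (b * N ^ 2) < degree c" "degree (s * M) < degree c"
    "degree (t * N) < degree c"
    using degree_mult_of_int_le[of a "\<mu>\<^sup>2"] degree_mult_of_int_le[of b "\<nu>\<^sup>2"] degree_mult_of_int_le[of s \<mu>]
      degree_mult_of_int_le[of t \<nu>] gap degree_a_le_b degree_s_less degree_t_less
    by (simp_all add: M_def N_def)
  then have "degree (a * M ^ 2 + s * M - (b * N ^ 2 + t * N)) < degree c"
    by (intro degree_diff_lt degree_add_less)
  then have eq: "a * M ^ 2 + s * M - (b * N ^ 2 + t * N) = 0"
    using dvd_degree_less_zero dv unfolding M_def N_def by blast
  define P where "P = a * M ^ 2 - b * N ^ 2"
  have P: "P * (t * N + s * M + c) = N\<^sup>2 - M\<^sup>2"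
  proof -
    have "P = t * N - s * M" using eq unfolding P_def by algebra
    then have "P * (t * N + s * M) = t\<^sup>2 * N\<^sup>2 - s\<^sup>2 * M\<^sup>2" by algebra
    then show ?thesis unfolding t_sq s_sq P_def by algebra
  qed
  have "degree (t * N + s * M + c) = degree c"
    using le by (intro degree_add_eq_right degree_add_less)
  moreover have "degree (N\<^sup>2 - M\<^sup>2) = 0"
    unfolding M_def N_def by (metis degree_of_int of_int_diff of_int_power)
  ultimately have z: "N\<^sup>2 - M\<^sup>2 = 0"
    using const_factors(2)[of P "t * N + s * M + c"] degree_c_pos unfolding P by auto
  have "t * N + s * M + c \<noteq> 0" using \<open>degree (t * N + s * M + c) = degree c\<close> degree_c_pos by auto
  then have "P = 0" using P z by simp
  then have "(a - b) * M\<^sup>2 = 0" using z unfolding P_def by algebra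
  then have "M = 0" using a_less_b by auto
  then show "\<mu> = 0" "\<nu> = 0" using z by (simp_all add: M_def N_def)
qed

text \<open>The congruence becomes a linear relation between \<open>a\<close>, \<open>b\<close>, \<open>d_minus\<close> with integer coefficients. Their
  dual form is minus the square of \<open>2 * \<mu> * \<nu> - \<mu> - \<nu>\<close>, whereas it cannot be negative.\<close>

lemma solve_base_minus:
  assumes dv: "c dvd 2 * a * of_int \<mu> ^ 2 + (b - a - d_minus) * of_int \<mu>
      - (2 * b * of_int \<nu> ^ 2 + (a - b - d_minus) * of_int \<nu>)"
  shows "\<mu> = 0 \<and> \<nu> = 0 \<or> \<mu> = 1 \<and> \<nu> = 1"
proof -
  define A where "A = 2 * \<mu>\<^sup>2 - \<mu> - \<nu>"
  define B where "B = \<mu> + \<nu> - 2 * \<nu>\<^sup>2"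
  define E where "E = \<nu> - \<mu>"
  have eq: "2 * a * of_int \<mu> ^ 2 + (b - a - d_minus) * of_int \<mu>
      - (2 * b * of_int \<nu> ^ 2 + (a - b - d_minus) * of_int \<nu>) = of_int A * a + of_int B * b + of_int E * d_minus"
    unfolding A_def B_def E_def by (simp add: algebra_simps)
  have "degree d_minus < degree c" using degree_c_eq degree_b_pos by simp
  then have "degree (of_int A * a + of_int B * b + of_int E * d_minus) < degree c"
    using degree_of_int_mult_le[of A a] degree_of_int_mult_le[of B b] degree_of_int_mult_le[of E d_minus]
      gap degree_a_le_b by (intro degree_add_less) auto
  then have "of_int A * a + of_int B * b + of_int E * d_minus = 0"
    using dvd_degree_less_zero dv unfolding eq by blast
  then have "0 \<le> real_of_int A * real_of_int B + real_of_int B * real_of_int E + real_of_int E * real_of_int A"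
    by (intro minus_relation_dual_nonneg) (simp add: const_of_int)
  then have "0 \<le> A * B + B * E + E * A"
    by (simp flip: of_int_mult of_int_add)
  also have "A * B + B * E + E * A = - ((2 * \<mu> * \<nu> - \<mu> - \<nu>)\<^sup>2)"
    unfolding A_def B_def E_def by algebra
  finally have "(2 * \<mu> * \<nu> - \<mu> - \<nu>)\<^sup>2 \<le> 0" by simp
  then have "2 * \<mu> * \<nu> - \<mu> - \<nu> = 0" by simp
  then have "(2 * \<mu> - 1) * (2 * \<nu> - 1) = 1" by algebra
  then have "2 * \<mu> - 1 = 1 \<and> 2 * \<nu> - 1 = 1 \<or> 2 * \<mu> - 1 = - 1 \<and> 2 * \<nu> - 1 = - 1"
    by (simp only: zmult_eq_1_iff)
  then show ?thesis by auto
qed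

text \<open>The term with \<open>t\<close> has larger degree than all the others.\<close>

lemma solve_base_a_odd_0_even:
  assumes a: "degree a = 0" and k: "degree k = 0"
    and dv: "c dvd a + 2 * a * (of_int j ^ 2 + of_int j) + (2 * of_int j + 1) * k - (2 * b * of_int \<nu> ^ 2 + 2 * t * of_int \<nu>)"
  shows "\<nu> = 0"
proof (rule ccontr)
  assume nu: "\<nu> \<noteq> 0"
  define L where "L = a + 2 * a * (of_int j ^ 2 + of_int j) + (2 * of_int j + 1) * k"
  obtain a0 k0 where ak: "a = const a0" "k = const k0" using degree_0_const a k by blast
  have "L = const (a0 + 2 * a0 * ((of_int j) ^ 2 + of_int j) + (2 * of_int j + 1) * k0)"
    unfolding L_def ak const_hom const_of_int ..
  then have L: "degree L = 0" by simp
  have eq: "a + 2 * a * (of_int j ^ 2 + of_int j) + (2 * of_int j + 1) * k - (2 * b * of_int \<nu> ^ 2 + 2 * t * of_int \<nu>)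
    = L - (of_int (2 * \<nu>\<^sup>2) * b + of_int (2 * \<nu>) * t)"
    unfolding L_def by (simp add: algebra_simps)
  have 1: "degree (of_int (2 * \<nu>) * t) = degree t" "degree (of_int (2 * \<nu>\<^sup>2) * b) = degree b"
    using degree_of_int_mult[of "2 * \<nu>" t] degree_of_int_mult[of "2 * \<nu> ^ 2" b] nu by simp_all
  have "degree (L - (of_int (2 * \<nu>\<^sup>2) * b + of_int (2 * \<nu>) * t)) < degree c"
    using L 1 gap degree_t_less by (intro degree_diff_lt degree_add_less) linarith+
  then have "L - (of_int (2 * \<nu>\<^sup>2) * b + of_int (2 * \<nu>) * t) = 0"
    using dvd_degree_less_zero dv unfolding eq by blast
  then have "of_int (2 * \<nu>) * t = L - of_int (2 * \<nu>\<^sup>2) * b" by algebra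
  moreover have "degree (L - of_int (2 * \<nu>\<^sup>2) * b) < degree t"
    using L 1 degree_b_less_t by (intro degree_diff_lt) linarith+
  ultimately show False using 1 by simp
qed

text \<open>Here the relation \<open>W * t + \<mu> * d_minus = (\<mu> - 2 * J) * b + (2 * \<mu>\<^sup>2 + \<mu>) * a\<close> is of the kind excluded
  by \<open>root_relation_scalar\<close>, up to the case of a scalar \<open>a\<close>, where
  \<open>4 * \<sigma> * W * a = - 2 * J\<close> with a positive left-hand side and \<open>J \<ge> 0\<close>.\<close>

lemma solve_base_b_even_0_odd:
  assumes dv: "c dvd 2 * b * (of_int j ^ 2 + of_int j) + (2 * of_int j + 1) * t
      - (2 * a * of_int \<mu> ^ 2 + (b + a - d_minus) * of_int \<mu>)"
  shows "\<mu> = 0"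
proof (rule ccontr)
  assume mu: "\<mu> \<noteq> 0"
  define J where "J = j\<^sup>2 + j"
  define W where "W = 2 * j + 1"
  have W0: "W \<noteq> 0" unfolding W_def by presburger
  have J0: "0 \<le> J" unfolding J_def by (rule consecutive_product_nonneg)
  have eq: "2 * b * (of_int j ^ 2 + of_int j) + (2 * of_int j + 1) * t
      - (2 * a * of_int \<mu> ^ 2 + (b + a - d_minus) * of_int \<mu>)
    = of_int W * t + of_int (2 * J - \<mu>) * b - of_int (2 * \<mu>\<^sup>2 + \<mu>) * a + of_int \<mu> * d_minus"
    unfolding J_def W_def by (simp add: algebra_simps)
  have dmc: "degree d_minus < degree c" using degree_c_eq degree_b_pos by simp
  have "degree (of_int W * t + of_int (2 * J - \<mu>) * b - of_int (2 * \<mu>\<^sup>2 + \<mu>) * a + of_int \<mu> * d_minus) < degree c"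
    using degree_of_int_mult_le[of W t] degree_of_int_mult_le[of "2 * J - \<mu>" b]
      degree_of_int_mult_le[of "2 * \<mu>\<^sup>2 + \<mu>" a] degree_of_int_mult_le[of \<mu> d_minus]
      gap degree_a_le_b degree_t_less dmc
    by (intro degree_add_less degree_diff_lt) (blast intro: le_less_trans less_le_trans)+
  then have rel: "of_int W * t + of_int (2 * J - \<mu>) * b - of_int (2 * \<mu>\<^sup>2 + \<mu>) * a + of_int \<mu> * d_minus = 0"
    using dvd_degree_less_zero dv unfolding eq by blast
  show False
  proof (cases "b < d_minus")
    case False
    then have dmb: "degree d_minus \<le> degree b"
      using degree_mono_nonneg[of d_minus b] minus_nonneg by simp
    have "of_int W * t = of_int (\<mu> - 2 * J) * b + of_int (2 * \<mu>\<^sup>2 + \<mu>) * a + of_int (- \<mu>) * d_minus"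
      using rel by (simp add: algebra_simps)
    moreover have "degree (of_int (\<mu> - 2 * J) * b + of_int (2 * \<mu>\<^sup>2 + \<mu>) * a + of_int (- \<mu>) * d_minus) \<le> degree b"
      using degree_of_int_mult_le[of "\<mu> - 2 * J" b] degree_of_int_mult_le[of "2 * \<mu>\<^sup>2 + \<mu>" a]
        degree_of_int_mult_le[of "- \<mu>" d_minus] dmb degree_a_le_b
      by (intro degree_add_le) (blast intro: order_trans)+
    ultimately have "degree t \<le> degree b" using degree_of_int_mult[of W t] W0 by simp
    then show False using degree_b_less_t by simp
  next
    case True
    then interpret g: D1_triple a b d_minus r u v
      using a_pos a_less_b degree_b_pos u_sq v_sq r_sq u_pos v_pos r_pos
      by unfold_locales simp_all
    have w: "d_minus = b + a + g.d_minus + 2 * b * a * g.d_minus + 2 * r * g.v * g.u"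
      using g.c_eq by (simp add: algebra_simps)
    have r': "r\<^sup>2 = b * a + 1" using r_sq by (simp add: mult.commute)
    have S: "t = g.v * (2 * r\<^sup>2 - 1) + 2 * b * r * g.u"
    proof -
      have "t = r * (r * g.v + b * g.u) + b * (r * g.u + a * g.v)"
        using t_eq by (simp only: g.t_eq[symmetric] g.s_eq[symmetric])
      then show ?thesis using r_sq by algebra
    qed
    have rel': "const (of_int W) * t - const (of_int (- \<mu>)) * d_minus = const (of_int (\<mu> - 2 * J)) * b + const (of_int (2 * \<mu>\<^sup>2 + \<mu>)) * a"
      unfolding const_of_int using rel by (simp add: algebra_simps)
    obtain y0 \<sigma> where ys: "a = const y0" "\<sigma> = 1 \<or> \<sigma> = - 1" "4 * \<sigma> * real_of_int W * y0 = real_of_int (\<mu> - 2 * J) + real_of_int (- \<mu>)"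
      "3 * \<sigma> * real_of_int W = (real_of_int (2 * \<mu>\<^sup>2 + \<mu>) + real_of_int (- \<mu>)) * y0"
      by (rule root_relation_scalar[OF b_pos degree_b_pos a_pos g.minus_nonneg r_pos r' g.v_pos g.v_sq
            g.u_pos g.u_sq w S _ _ rel']) (use W0 mu in auto)
    have y0: "0 < y0" using a_pos ys(1) by (simp add: const_pos)
    have "0 < 2 * (real_of_int \<mu>)\<^sup>2 * y0" using y0 mu by simp
    moreover have "3 * (\<sigma> * real_of_int W) = 2 * (real_of_int \<mu>)\<^sup>2 * y0"
      using ys(4) by (simp add: algebra_simps)
    ultimately have "0 < \<sigma> * real_of_int W" by linarith
    then have "0 < 4 * (\<sigma> * real_of_int W) * y0" using y0 by simp
    moreover have "4 * (\<sigma> * real_of_int W) * y0 = - 2 * real_of_int J"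
      using ys(3) by (simp add: algebra_simps)
    ultimately have "real_of_int J < 0" by linarith
    then show False using J0 by simp
  qed
qed

end

lemma int_product_zero_cases: "\<nu>\<^sup>2 + \<nu> = (0 :: int) \<Longrightarrow> \<nu> = 0 \<or> \<nu> = - 1"
  by (metis add_eq_0_iff mult_cancel_left power2_eq_square mult_minus_right mult.right_neutral equation_minus_iff)

context D1_triple_gap
begin

text \<open>If \<open>a\<close> is a scalar and \<open>b\<close>, \<open>d_minus\<close> have the same degree, then the larger of the two is one of
  the explicit extensions of \<open>a\<close> and the smaller one. Everything becomes a polynomial in the root \<open>X\<close>
  that belongs to \<open>a\<close> and the smaller one.\<close>

lemma scalar_a_shapes:
  assumes a: "degree a = 0" and eq: "degree d_minus = degree b"
  obtains
    (minus_low) X where "0 < degree X" "a * b = a\<^sup>2 + X\<^sup>2 - 1 + 2 * a * X" "a * d_minus = X\<^sup>2 - 1"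
      "s = 2 * X\<^sup>2 + 2 * a * X - 1"
  | (minus_high) X where "0 < degree X" "a * b = X\<^sup>2 - 1" "a * d_minus = a\<^sup>2 + X\<^sup>2 - 1 + 2 * a * X"
      "s = 2 * X\<^sup>2 + 2 * a * X - 1"
  | (scaled_low) X \<kappa> where "0 < degree X" "1 < \<kappa>" "a = const ((\<kappa> - 1 / \<kappa>) / 2)"
      "a * b = const (\<kappa>\<^sup>2) * (X\<^sup>2 - 1) + const (2 * \<kappa>) * a" "a * d_minus = X\<^sup>2 - 1"
      "s = 2 * const \<kappa> * X\<^sup>2 - const \<kappa> + a"
  | (scaled_high) X \<kappa> where "0 < degree X" "1 < \<kappa>" "a = const ((\<kappa> - 1 / \<kappa>) / 2)"
      "a * b = X\<^sup>2 - 1" "a * d_minus = const (\<kappa>\<^sup>2) * (X\<^sup>2 - 1) + const (2 * \<kappa>) * a"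
      "s = 2 * const \<kappa> * X\<^sup>2 - const \<kappa> + a"
proof -
  have du: "0 < degree u" "0 < degree r"
    using degree_root[OF a_pos d_minus_pos u_sq] degree_r a eq degree_b_pos by simp_all
  have st: "s = r * u + a * v" by (rule s_eq)
  show ?thesis
  proof (cases rule: d_minus_triple_cases)
    case least
    then show ?thesis using a by simp
  next
    case middle
    then interpret m: D1_triple a d_minus b u r v by simp
    show ?thesis
    proof (cases "m.d_minus = 0")
      case True
      note q = m.minus_eq_0[OF True]
      show ?thesis
      proof (rule minus_low[OF du(1)])
        show "a * b = a\<^sup>2 + u\<^sup>2 - 1 + 2 * a * u" using q(1) u_sq by algebra
        show "a * d_minus = u\<^sup>2 - 1" using u_sq by simp
        show "s = 2 * u\<^sup>2 + 2 * a * u - 1" using st q(2,3) u_sq by algebra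
      qed
    next
      case False
      obtain \<kappa> where k: "\<kappa> > 1" "a = const ((\<kappa> - 1 / \<kappa>) / 2)"
        "b = const (\<kappa>\<^sup>2) * d_minus + const (2 * \<kappa>)" "r = const \<kappa> * u" "v = const \<kappa> * d_minus + 1"
        using m.same_degree_minus_ne_0[OF False] eq by metis
      show ?thesis
      proof (rule scaled_low[OF du(1) k(1,2)])
        show "a * b = const (\<kappa>\<^sup>2) * (u\<^sup>2 - 1) + const (2 * \<kappa>) * a" using k(3) u_sq by algebra
        show "a * d_minus = u\<^sup>2 - 1" using u_sq by simp
        show "s = 2 * const \<kappa> * u\<^sup>2 - const \<kappa> + a" using st k(4,5) u_sq by algebra
      qed
    qed
  next
    case greatest
    then interpret m: D1_triple a b d_minus r u v by simp
    show ?thesis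
    proof (cases "m.d_minus = 0")
      case True
      note q = m.minus_eq_0[OF True]
      show ?thesis
      proof (rule minus_high[OF du(2)])
        show "a * d_minus = a\<^sup>2 + r\<^sup>2 - 1 + 2 * a * r" using q(1) r_sq by algebra
        show "a * b = r\<^sup>2 - 1" using r_sq by simp
        show "s = 2 * r\<^sup>2 + 2 * a * r - 1" using st q(2,3) r_sq by algebra
      qed
    next
      case False
      obtain \<kappa> where k: "\<kappa> > 1" "a = const ((\<kappa> - 1 / \<kappa>) / 2)"
        "d_minus = const (\<kappa>\<^sup>2) * b + const (2 * \<kappa>)" "u = const \<kappa> * r" "v = const \<kappa> * b + 1"
        using m.same_degree_minus_ne_0[OF False] eq by metis
      show ?thesis
      proof (rule scaled_high[OF du(2) k(1,2)])
        show "a * d_minus = const (\<kappa>\<^sup>2) * (r\<^sup>2 - 1) + const (2 * \<kappa>) * a" using k(3) r_sq by algebra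
        show "a * b = r\<^sup>2 - 1" using r_sq by simp
        show "s = 2 * const \<kappa> * r\<^sup>2 - const \<kappa> + a" using st k(4,5) r_sq by algebra
      qed
    qed
  qed
qed

end

text \<open>The numerical contradictions behind the two scaled shapes. The real number \<open>q\<close> is the square of
  the unit \<open>\<kappa>\<close>; eliminating it leaves an equation between integers with all terms of one sign.\<close>

lemma scaled_low_contradiction:
  fixes q :: real and \<nu> j :: int
  defines "W \<equiv> 2 * j + 1" and "J \<equiv> j\<^sup>2 + j" and "K \<equiv> 2 * \<nu>\<^sup>2 + \<nu>"
  assumes q: "1 < q" and \<nu>: "\<nu> \<noteq> 0"
    and e1: "(q - 1) * W = K * q - \<nu>"
    and e2: "W * (3 * q - 1) + (2 * J - \<nu>) * (q - 1) - 4 * K * q = 0"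
  shows False
proof -
  define S where "S = W - K"
  have 1: "(q - 1) * S = 2 * (real_of_int \<nu>)\<^sup>2"
    using e1 unfolding S_def K_def by (simp add: algebra_simps)
  moreover have "0 < 2 * (real_of_int \<nu>)\<^sup>2" using \<nu> by simp
  ultimately have "0 < (q - 1) * S" by simp
  then have S: "1 \<le> S" using q by (simp add: zero_less_mult_iff)
  have "(q - 1) * (2 * J - \<nu> - W) = 4 * \<nu> - 2 * W"
    using e1 e2 by (simp add: algebra_simps)
  then have "((q - 1) * S) * (2 * J - \<nu> - W) = S * (4 * \<nu> - 2 * W)" unfolding of_int_mult of_int_add of_int_diff of_int_numeral by algebra
  then have "2 * (real_of_int \<nu>)\<^sup>2 * (2 * J - \<nu> - W) = S * (4 * \<nu> - 2 * W)" unfolding 1 .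
  then have "real_of_int (2 * \<nu>\<^sup>2 * (2 * J - \<nu> - W)) = real_of_int (S * (4 * \<nu> - 2 * W))" by simp
  then have E: "2 * \<nu>\<^sup>2 * (2 * J - \<nu> - W) = S * (4 * \<nu> - 2 * W)" by (simp only: of_int_eq_iff)
  have W: "W = S + K" by (simp add: S_def)
  have J: "4 * J = W\<^sup>2 - 1" unfolding J_def W_def by algebra
  have K: "1 \<le> K"
  proof -
    have "K = \<nu> * (2 * \<nu> + 1)" unfolding K_def by algebra
    moreover have "0 < \<nu> * (2 * \<nu> + 1)" using \<nu> by (cases "0 < \<nu>") (auto simp: mult_neg_neg)
    ultimately show ?thesis by simp
  qed
  have "\<nu>\<^sup>2 * (W\<^sup>2 - 1) + 2 * S * (S + \<nu>\<^sup>2 - \<nu>) = \<nu>\<^sup>2 * (4 * \<nu>\<^sup>2 + 4 * \<nu>)"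
    using E J unfolding W K_def by algebra
  moreover have "\<nu>\<^sup>2 * (4 * \<nu>\<^sup>2 + 4 * \<nu>) \<le> \<nu>\<^sup>2 * (W\<^sup>2 - 1)"
  proof -
    have "(K + 1)\<^sup>2 \<le> W\<^sup>2" using W S K by (intro power_mono) auto
    moreover have "(K + 1)\<^sup>2 - 1 = 4 * \<nu>\<^sup>2 + 4 * \<nu> + (\<nu>\<^sup>2 * (2 * \<nu> + 1)\<^sup>2 - 2 * \<nu>)" unfolding K_def by algebra
    moreover have "0 \<le> \<nu>\<^sup>2 * (2 * \<nu> + 1)\<^sup>2 - 2 * \<nu>"
    proof (cases "0 < \<nu>")
      case True
      have "2 * \<nu> \<le> \<nu>\<^sup>2 * (2 * \<nu> + 1)\<^sup>2"
      proof -
        have "9 \<le> (2 * \<nu> + 1)\<^sup>2" using power_mono[of 3 "2 * \<nu> + 1" 2] True by simp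
        then have "\<nu>\<^sup>2 * 9 \<le> \<nu>\<^sup>2 * (2 * \<nu> + 1)\<^sup>2" by (intro mult_left_mono) auto
        moreover have "\<nu> \<le> \<nu>\<^sup>2" using consecutive_product_nonneg[of "- \<nu>"] by simp
        ultimately show ?thesis using True by linarith
      qed
      then show ?thesis by simp
    next
      case False
      then have "2 * \<nu> \<le> 0" by simp
      also have "0 \<le> \<nu>\<^sup>2 * (2 * \<nu> + 1)\<^sup>2" by simp
      finally show ?thesis by simp
    qed
    ultimately show ?thesis by (intro mult_left_mono) auto
  qed
  moreover have "0 < 2 * S * (S + \<nu>\<^sup>2 - \<nu>)"
  proof -
    have "\<nu> \<le> \<nu>\<^sup>2" using consecutive_product_nonneg[of "- \<nu>"] by simp
    then show ?thesis using S by simp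
  qed
  ultimately show False by linarith
qed

lemma scaled_high_contradiction:
  fixes q :: real and \<nu> j :: int
  defines "W \<equiv> 2 * j + 1" and "J \<equiv> j\<^sup>2 + j" and "K \<equiv> 2 * \<nu>\<^sup>2 + \<nu>"
  assumes q: "1 < q" and \<nu>: "\<nu> \<noteq> 0"
    and e1: "(q - 1) * W = K - q * \<nu>"
    and e2: "W * (3 * q - 1) + (2 * J - \<nu>) * (q - 1) + 4 * real_of_int \<nu> * q = 0"
  shows False
proof -
  define S where "S = W + \<nu>"
  have 1: "(q - 1) * S = 2 * (real_of_int \<nu>)\<^sup>2"
    using e1 unfolding S_def K_def by (simp add: algebra_simps)
  moreover have "0 < 2 * (real_of_int \<nu>)\<^sup>2" using \<nu> by simp
  ultimately have "0 < (q - 1) * S" by simp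
  then have S: "1 \<le> S" using q by (simp add: zero_less_mult_iff)
  have "(q - 1) * (3 * S + 2 * J) + 2 * S + 2 * \<nu> = 0"
    using e2 unfolding S_def by (simp add: algebra_simps)
  then have "((q - 1) * S) * (3 * S + 2 * J) + 2 * S * S + 2 * \<nu> * S = 0"
    unfolding of_int_mult of_int_add of_int_diff of_int_numeral by algebra
  then have "2 * (real_of_int \<nu>)\<^sup>2 * (3 * S + 2 * J) + 2 * S * S + 2 * \<nu> * S = 0" unfolding 1 .
  then have "real_of_int (2 * \<nu>\<^sup>2 * (3 * S + 2 * J) + 2 * S * S + 2 * \<nu> * S) = 0" by simp
  then have E: "2 * \<nu>\<^sup>2 * (3 * S + 2 * J) + 2 * S * S + 2 * \<nu> * S = 0" by (simp only: of_int_eq_0_iff)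
  have "0 \<le> \<nu>\<^sup>2 * J" unfolding J_def using consecutive_product_nonneg by simp
  moreover have "0 \<le> (\<nu>\<^sup>2 + \<nu>) * S" using consecutive_product_nonneg S by simp
  moreover have "0 < S * S" using S by simp
  moreover have "0 \<le> \<nu>\<^sup>2 * S" using S by simp
  moreover have "2 * \<nu>\<^sup>2 * (3 * S + 2 * J) + 2 * S * S + 2 * \<nu> * S
    = 4 * (\<nu>\<^sup>2 * J) + 2 * ((\<nu>\<^sup>2 + \<nu>) * S) + 4 * (\<nu>\<^sup>2 * S) + 2 * (S * S)" by algebra
  ultimately show False using E by linarith
qed

lemma odd_even_contradiction:
  fixes \<nu> j :: int
  assumes \<nu>: "\<nu> \<noteq> 0" and W: "0 < 2 * j + 1" "2 * j + 1 < 2 * \<nu>\<^sup>2 + \<nu>"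
    and e: "(\<nu>\<^sup>2 + (j\<^sup>2 + j)) * (2 * \<nu>\<^sup>2 + \<nu>) = (2 * j + 1)\<^sup>2"
  shows False
proof -
  define K where "K = 2 * \<nu>\<^sup>2 + \<nu>"
  define J where "J = j\<^sup>2 + j"
  have J: "0 \<le> J" unfolding J_def by (rule consecutive_product_nonneg)
  have e': "(\<nu>\<^sup>2 + J) * K = 4 * J + 1" using e unfolding K_def J_def by algebra
  have n2: "1 \<le> \<nu>\<^sup>2" using \<nu> by (simp add: int_one_le_iff_zero_less)
  have K1: "2 \<le> K" using W unfolding K_def by simp
  have "K < 4"
  proof (rule ccontr)
    assume "\<not> K < 4"
    then have "(\<nu>\<^sup>2 + J) * 4 \<le> (\<nu>\<^sup>2 + J) * K" using n2 J by (intro mult_left_mono) auto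
    then show False using e' n2 by simp
  qed
  then have K: "K = 2 \<or> K = 3" using K1 by auto
  then have "j = 0" using W unfolding K_def[symmetric] by auto
  then have "\<nu>\<^sup>2 * K = 1" using e' unfolding J_def by simp
  then show False using n2 K by auto
qed

context D1_triple_gap
begin

text \<open>The relation \<open>W * s - K * b = (\<nu> - 2 * J) * a - \<nu> * d_minus\<close> with odd \<open>W\<close> falls under
  \<open>root_relation_scalar\<close> unless \<open>a\<close> is a scalar; the larger of \<open>b\<close> and \<open>d_minus\<close> plays the part
  of \<open>w\<close>.\<close>

lemma solve_base_0_odd_a_even:
  assumes dv: "c dvd 2 * a * (of_int j ^ 2 + of_int j) + (2 * of_int j + 1) * s
      - (2 * b * of_int \<nu> ^ 2 + (a + b - d_minus) * of_int \<nu>)"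
  shows "\<nu> = 0"
proof (rule ccontr)
  assume nu: "\<nu> \<noteq> 0"
  define J where "J = j\<^sup>2 + j"
  define W where "W = 2 * j + 1"
  define K where "K = 2 * \<nu>\<^sup>2 + \<nu>"
  have W0: "W \<noteq> 0" unfolding W_def by presburger
  have Kpos: "0 < K"
  proof -
    have "K = \<nu> * (2 * \<nu> + 1)" unfolding K_def by algebra
    moreover have "0 < \<nu> * (2 * \<nu> + 1)" using nu by (cases "0 < \<nu>") (auto simp: mult_neg_neg)
    ultimately show ?thesis by simp
  qed
  have eq: "2 * a * (of_int j ^ 2 + of_int j) + (2 * of_int j + 1) * s
      - (2 * b * of_int \<nu> ^ 2 + (a + b - d_minus) * of_int \<nu>)
    = of_int W * s + of_int (2 * J - \<nu>) * a - of_int K * b + of_int \<nu> * d_minus"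
    unfolding J_def W_def K_def by (simp add: algebra_simps)
  have dmc: "degree d_minus < degree c" using degree_c_eq degree_b_pos by simp
  have "degree (of_int W * s + of_int (2 * J - \<nu>) * a - of_int K * b + of_int \<nu> * d_minus) < degree c"
    using degree_of_int_mult_le[of W s] degree_of_int_mult_le[of "2 * J - \<nu>" a]
      degree_of_int_mult_le[of K b] degree_of_int_mult_le[of \<nu> d_minus]
      gap degree_a_le_b degree_s_less dmc
    by (intro degree_add_less degree_diff_lt) (blast intro: le_less_trans less_le_trans)+
  then have rel: "of_int W * s + of_int (2 * J - \<nu>) * a - of_int K * b + of_int \<nu> * d_minus = 0"
    using dvd_degree_less_zero dv unfolding eq by blast
  show False
  proof (cases "degree a = 0")
    case False
    show False
    proof (cases "b < d_minus")
      case True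
      then interpret g: D1_triple a b d_minus r u v
        using a_pos a_less_b degree_b_pos u_sq v_sq r_sq u_pos v_pos r_pos
        by unfold_locales simp_all
      have S: "s = g.u * (2 * r\<^sup>2 - 1) + 2 * a * r * g.v"
      proof -
        have "s = r * (r * g.u + a * g.v) + a * (r * g.v + b * g.u)"
          using s_eq by (simp only: g.t_eq[symmetric] g.s_eq[symmetric])
        then show ?thesis using r_sq by algebra
      qed
      have rel': "const (of_int W) * s - const (of_int (- \<nu>)) * d_minus = const (of_int (\<nu> - 2 * J)) * a + const (of_int K) * b"
        unfolding const_of_int using rel by (simp add: algebra_simps)
      obtain y0 where "b = const y0"
        by (rule root_relation_scalar[OF a_pos _ b_pos g.minus_nonneg r_pos r_sq g.u_pos g.u_sq
              g.v_pos g.v_sq g.c_eq S _ _ rel']) (use False W0 nu in auto)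
      then show False using degree_b_pos by simp
    next
      case nb: False
      then have lb: "d_minus < b" using d_minus_ne_b by auto
      define g where "g = u * r - a * v"
      define h where "h = u * v - d_minus * r"
      define f where "f = a + d_minus + b + 2 * a * d_minus * b - 2 * u * r * v"
      have v': "v\<^sup>2 = d_minus * b + 1" using v_sq by (simp add: mult.commute)
      note ids = minus_extension_identities[OF u_sq r_sq v' f_def, folded g_def h_def]
      have gp: "0 < g"
        unfolding g_def by (rule root_difference_pos[OF a_pos a_less_b d_minus_pos u_pos r_pos u_sq r_sq v'])
      have hp: "0 < h"
        unfolding h_def by (rule root_difference_pos[OF d_minus_pos lb a_pos u_pos v_pos _ v' r_sq])
          (use u_sq in \<open>simp add: mult.commute\<close>)
      have fp: "0 \<le> f" using nonneg_of_square[OF a_pos _ ids(1)] False by simp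
      have S: "s = g * (2 * u\<^sup>2 - 1) + 2 * a * u * h"
        using s_eq ids(5,6) u_sq by algebra
      have rel': "const (of_int W) * s - const (of_int K) * b = const (of_int (\<nu> - 2 * J)) * a + const (of_int (- \<nu>)) * d_minus"
        unfolding const_of_int using rel by (simp add: algebra_simps)
      obtain y0 \<sigma> where ys: "d_minus = const y0" "0 < real_of_int W / real_of_int K" "\<sigma> = 1 \<or> \<sigma> = - 1"
        "2 * \<sigma> * (real_of_int W / real_of_int K) * y0 = 1 - (real_of_int W / real_of_int K)\<^sup>2"
        "4 * \<sigma> * real_of_int W * y0 = real_of_int (\<nu> - 2 * J) + real_of_int K"
        "3 * \<sigma> * real_of_int W = (real_of_int (- \<nu>) + real_of_int K) * y0"
        by (rule root_relation_scalar[OF a_pos _ d_minus_pos fp u_pos u_sq gp ids(1) hp ids(2,4) S _ _ rel'])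
          (use False W0 Kpos in auto)
      have y0: "0 < y0" using d_minus_pos ys(1) by (simp add: const_pos)
      have Wpos: "0 < W" using ys(2) Kpos by (simp add: zero_less_divide_iff)
      have "0 < 2 * (real_of_int \<nu>)\<^sup>2 * y0" using y0 nu by simp
      moreover have "3 * (\<sigma> * real_of_int W) = 2 * (real_of_int \<nu>)\<^sup>2 * y0"
        using ys(6) unfolding K_def by (simp add: algebra_simps)
      ultimately have "0 < \<sigma> * real_of_int W" by linarith
      then have \<sigma>: "\<sigma> = 1" using ys(3) Wpos by auto
      define l where "l = real_of_int W / real_of_int K"
      have l: "0 < l" "2 * l * y0 = 1 - l\<^sup>2" "real_of_int W = l * real_of_int K"
        using ys(2,4) \<sigma> Kpos by (simp_all add: l_def)
      \<comment> \<open>The three equations for \<open>y0\<close> leave a Diophantine equation in \<open>\<nu>\<close> and \<open>W\<close> with \<open>0 < W < K\<close>.\<close>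
      have "l\<^sup>2 < 1" using l y0 by (smt (verit) mult_pos_pos)
      then have "l < 1" using l(1) by (simp add: power_less_one_iff abs_square_less_1)
      then have WK: "W < K" using l(3) Kpos
        by (metis mult.commute mult_less_cancel_left_pos mult.right_neutral of_int_0_less_iff of_int_less_iff)
      have "4 * real_of_int W * y0 = 2 * real_of_int K * (1 - l\<^sup>2)"
        unfolding l(2)[symmetric] unfolding l(3) by algebra
      moreover have "4 * real_of_int W * y0 = real_of_int (\<nu> - 2 * J) + real_of_int K"
        using ys(5) \<sigma> by simp
      ultimately have "real_of_int (\<nu> - 2 * J) + real_of_int K = 2 * real_of_int K * (1 - l\<^sup>2)"
        by (rule trans[OF sym, rotated])
      then have "(real_of_int (\<nu> - 2 * J) + real_of_int K) * real_of_int K = 2 * (real_of_int K)\<^sup>2 - 2 * (real_of_int W)\<^sup>2"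
        unfolding l(3) by algebra
      then have "real_of_int ((\<nu> - 2 * J + K) * K) = real_of_int (2 * K\<^sup>2 - 2 * W\<^sup>2)" by simp
      then have "(\<nu> - 2 * J + K) * K = 2 * K\<^sup>2 - 2 * W\<^sup>2" by (simp only: of_int_eq_iff)
      moreover have "K * (K - \<nu>) = 2 * \<nu>\<^sup>2 * K" unfolding K_def by algebra
      ultimately have "2 * ((\<nu>\<^sup>2 + J) * K) = 2 * W\<^sup>2" by algebra
      then have "(\<nu>\<^sup>2 + J) * K = W\<^sup>2" by simp
      then show False using odd_even_contradiction[OF nu] Wpos WK unfolding J_def K_def W_def by blast
    qed
  next
    case a0: True
    obtain A where A: "a = const A" using degree_0_const a0 by blast
    have Ap: "0 < A" using a_pos A by (simp add: const_pos)
    have ds: "2 * degree s = degree b + degree d_minus" using degree_s degree_c_eq a0 by simp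
    consider "degree d_minus < degree b" | "degree b < degree d_minus" | "degree d_minus = degree b" by linarith
    then show False
    proof cases
      case 1
      have "const (of_int (- K)) * b + (of_int W * s + of_int (2 * J - \<nu>) * a + of_int \<nu> * d_minus) = 0"
        unfolding const_of_int using rel by (simp add: algebra_simps)
      moreover have "degree (of_int W * s + of_int (2 * J - \<nu>) * a + of_int \<nu> * d_minus) < degree b"
        using degree_of_int_mult_le[of W s] degree_of_int_mult_le[of "2 * J - \<nu>" a]
          degree_of_int_mult_le[of \<nu> d_minus] 1 ds a0 by (intro degree_add_less) linarith+
      ultimately show False using const_mult_eq_low Kpos by force
    next
      case 2
      have "const (of_int \<nu>) * d_minus + (of_int W * s + of_int (2 * J - \<nu>) * a - of_int K * b) = 0"
        unfolding const_of_int using rel by (simp add: algebra_simps)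
      moreover have "degree (of_int W * s + of_int (2 * J - \<nu>) * a - of_int K * b) < degree d_minus"
        using degree_of_int_mult_le[of W s] degree_of_int_mult_le[of "2 * J - \<nu>" a]
          degree_of_int_mult_le[of K b] 2 ds a0 by (intro degree_add_less degree_diff_lt) linarith+
      ultimately show False using const_mult_eq_low nu by force
    next
      case 3
      have ra: "const (of_int W) * (a * s) + const (of_int (2 * J - \<nu>)) * a\<^sup>2 - const (of_int K) * (a * b) + const (of_int \<nu>) * (a * d_minus) = 0"
        unfolding const_of_int using rel by algebra
      define w where "w = real_of_int W"
      define n where "n = real_of_int \<nu>"
      define k where "k = real_of_int K"
      define i where "i = real_of_int (2 * J - \<nu>)"
      have kn: "k = 2 * n\<^sup>2 + n" unfolding k_def n_def K_def by simp
      have i: "i = 2 * real_of_int J - n" unfolding i_def n_def by simp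
      have Jp: "0 \<le> real_of_int J" unfolding J_def using consecutive_product_nonneg[of j]
        by (simp only: of_int_0_le_iff)
      note ra = ra[folded w_def n_def k_def i_def]
      have n0: "n \<noteq> 0" using nu by (simp add: n_def)
      from a0 3 show False
      proof (cases rule: scalar_a_shapes)
        case (minus_low X)
        have "const (2 * A * w - k + n) * X\<^sup>2 + const (2 * A\<^sup>2 * w - 2 * A * k) * X
            + const (i * A\<^sup>2 - A * w - k * (A\<^sup>2 - 1) - n) = 0"
          using ra unfolding minus_low(2,3) unfolding minus_low(4) A const_hom by algebra
        note co = quadratic_relation_coeffs[OF this minus_low(1)]
        have "A * w = k" using co(2) Ap by (simp add: power2_eq_square)
        then have "n * (n + 1) = 0" using co(1) kn by algebra
        then have n1: "n = - 1" using n0 by auto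
        then have "2 * real_of_int J * A\<^sup>2 + 1 = 0"
          using co(3) kn i \<open>A * w = k\<close> by (simp add: algebra_simps)
        then show False using Jp by (smt (verit) mult_nonneg_nonneg zero_le_power2)
      next
        case (minus_high X)
        have "const (2 * A * w - k + n) * X\<^sup>2 + const (2 * A\<^sup>2 * w + 2 * A * n) * X
            + const (i * A\<^sup>2 - A * w + k + n * (A\<^sup>2 - 1)) = 0"
          using ra unfolding minus_high(2,3) unfolding minus_high(4) A const_hom by algebra
        note co = quadratic_relation_coeffs[OF this minus_high(1)]
        have "A * (A * w + n) = 0" using co(2) by algebra
        then have Aw: "A * w = - n" using Ap by simp
        then have "n * (n + 1) = 0" using co(1) kn by algebra
        then have n1: "n = - 1" using n0 by auto
        then have "2 * real_of_int J * A\<^sup>2 + 1 = 0"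
          using co(3) kn i Aw by (simp add: algebra_simps)
        then show False using Jp by (smt (verit) mult_nonneg_nonneg zero_le_power2)
      next
        case (scaled_low X \<kappa>)
        have Ak: "A = (\<kappa> - 1 / \<kappa>) / 2" using scaled_low(3) A by (simp add: const_inject)
        then have Ak': "2 * A * \<kappa> = \<kappa>\<^sup>2 - 1" using scaled_low(2) by (simp add: field_simps power2_eq_square)
        have "const (2 * A * \<kappa> * w - k * \<kappa>\<^sup>2 + n) * X\<^sup>2 + const 0 * X
            + const (A * w * (A - \<kappa>) + i * A\<^sup>2 + k * \<kappa>\<^sup>2 - 2 * k * \<kappa> * A - n) = 0"
          using ra unfolding scaled_low(4,5) unfolding scaled_low(6) A const_hom by algebra
        note co = quadratic_relation_coeffs[OF this scaled_low(1)]
        have e1: "(\<kappa>\<^sup>2 - 1) * w = k * \<kappa>\<^sup>2 - n" using co(1) unfolding Ak' by simp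
        have "A * (w * (A + \<kappa>) + i * A - 2 * k * \<kappa>) = 0" using co(1,3) by algebra
        then have "2 * \<kappa> * (w * (A + \<kappa>) + i * A - 2 * k * \<kappa>) = 0" using Ap by simp
        then have "w * (3 * \<kappa>\<^sup>2 - 1) + i * (\<kappa>\<^sup>2 - 1) - 4 * k * \<kappa>\<^sup>2 = 0" using Ak' by algebra
        moreover have "1 < \<kappa>\<^sup>2" using scaled_low(2) by simp
        ultimately show False
          using scaled_low_contradiction[of "\<kappa>\<^sup>2" \<nu> j] nu e1
          unfolding w_def k_def n_def i_def W_def K_def J_def by blast
      next
        case (scaled_high X \<kappa>)
        have Ak: "A = (\<kappa> - 1 / \<kappa>) / 2" using scaled_high(3) A by (simp add: const_inject)
        then have Ak': "2 * A * \<kappa> = \<kappa>\<^sup>2 - 1" using scaled_high(2) by (simp add: field_simps power2_eq_square)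
        have "const (2 * A * \<kappa> * w - k + n * \<kappa>\<^sup>2) * X\<^sup>2 + const 0 * X
            + const (A * w * (A - \<kappa>) + i * A\<^sup>2 + k - n * \<kappa>\<^sup>2 + 2 * n * \<kappa> * A) = 0"
          using ra unfolding scaled_high(4,5) unfolding scaled_high(6) A const_hom by algebra
        note co = quadratic_relation_coeffs[OF this scaled_high(1)]
        have e1: "(\<kappa>\<^sup>2 - 1) * w = k - \<kappa>\<^sup>2 * n" using co(1) unfolding Ak' by (simp add: algebra_simps)
        have "A * (w * (A + \<kappa>) + i * A + 2 * n * \<kappa>) = 0" using co(1,3) by algebra
        then have "2 * \<kappa> * (w * (A + \<kappa>) + i * A + 2 * n * \<kappa>) = 0" using Ap by simp
        then have "w * (3 * \<kappa>\<^sup>2 - 1) + i * (\<kappa>\<^sup>2 - 1) + 4 * n * \<kappa>\<^sup>2 = 0" using Ak' by algebra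
        moreover have "1 < \<kappa>\<^sup>2" using scaled_high(2) by simp
        ultimately show False
          using scaled_high_contradiction[of "\<kappa>\<^sup>2" \<nu> j] nu e1
          unfolding w_def k_def n_def i_def W_def K_def J_def by blast
      qed
    qed
  qed
qed

text \<open>With \<open>a\<close> a scalar the equation relates \<open>b\<close> and \<open>d_minus\<close> modulo scalars, so they have the same degree,
  and of the possible shapes only the last one survives the comparison of coefficients. There
  \<open>\<kappa>\<^sup>2 = 2 * \<nu> + 1\<close>, and what remains is a quadratic equation for \<open>\<mu>\<close> with negative discriminant.\<close>

lemma solve_base_a:
  assumes a0: "degree a = 0" and k: "k\<^sup>2 = a\<^sup>2 + 1" "0 < k"
    and dv: "c dvd 2 * a * of_int \<mu> ^ 2 + 2 * k * of_int \<mu> - (2 * b * of_int \<nu> ^ 2 + (a + b - d_minus) * of_int \<nu>)"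
  shows "\<nu> = 0"
proof (rule ccontr)
  assume nu: "\<nu> \<noteq> 0"
  obtain A where A: "a = const A" using degree_0_const a0 by blast
  have Ap: "0 < A" using a_pos A by (simp add: const_pos)
  have "2 * degree k = 0"
  proof -
    have "k\<^sup>2 = const (A\<^sup>2 + 1)" unfolding k A const_hom ..
    then show ?thesis using degree_sq[of k] by simp
  qed
  then obtain k0 where k0: "k = const k0" using degree_0_const by auto
  have k0p: "0 < k0" using k(2) k0 by (simp add: const_pos)
  have k02: "k0\<^sup>2 = A\<^sup>2 + 1" using k(1) unfolding k0 A by (simp flip: const_hom add: const_inject)
  define K where "K = 2 * \<nu>\<^sup>2 + \<nu>"
  have K0: "K \<noteq> 0"
  proof
    assume "K = 0"
    then have "\<nu> * (2 * \<nu> + 1) = 0" unfolding K_def by algebra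
    then show False using nu odd_ne_0[of \<nu>] by simp
  qed
  define L where "L = 2 * A * (real_of_int \<mu>)\<^sup>2 + 2 * k0 * real_of_int \<mu> - A * real_of_int \<nu>"
  have eq: "2 * a * of_int \<mu> ^ 2 + 2 * k * of_int \<mu> - (2 * b * of_int \<nu> ^ 2 + (a + b - d_minus) * of_int \<nu>)
    = const L - const (of_int K) * b + const (of_int \<nu>) * d_minus"
    unfolding A k0 L_def K_def const_hom const_of_int by (simp add: const_hom const_of_int algebra_simps)
  have dmc: "degree d_minus < degree c" using degree_c_eq degree_b_pos by simp
  have "degree (const L - const (of_int K) * b + const (of_int \<nu>) * d_minus) < degree c"
    using const_mult_degree_le[of "of_int K" b] const_mult_degree_le[of "of_int \<nu>" d_minus] gap dmc
    by (intro degree_add_less degree_diff_lt) auto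
  then have rel: "const L - const (of_int K) * b + const (of_int \<nu>) * d_minus = 0"
    using dvd_degree_less_zero dv unfolding eq by blast
  consider "degree d_minus < degree b" | "degree b < degree d_minus" | "degree d_minus = degree b" by linarith
  then show False
  proof cases
    case 1
    have "const (of_int (- K)) * b + (const L + const (of_int \<nu>) * d_minus) = 0"
      using rel by (simp add: algebra_simps const_hom)
    moreover have "degree (const L + const (of_int \<nu>) * d_minus) < degree b"
      using const_mult_degree_le[of "of_int \<nu>" d_minus] 1 by (intro degree_add_less) auto
    ultimately show False using const_mult_eq_low K0 by force
  next
    case 2
    have "const (of_int \<nu>) * d_minus + (const L - const (of_int K) * b) = 0"
      using rel by (simp add: algebra_simps)
    moreover have "degree (const L - const (of_int K) * b) < degree d_minus"
      using const_mult_degree_le[of "of_int K" b] 2 by (intro degree_diff_lt) auto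
    ultimately show False using const_mult_eq_low nu by force
  next
    case 3
    define n where "n = real_of_int \<nu>"
    define m where "m = real_of_int \<mu>"
    define K' where "K' = real_of_int K"
    have kn: "K' = 2 * n\<^sup>2 + n" unfolding K'_def n_def K_def by simp
    have n0: "n \<noteq> 0" "K' \<noteq> 0" using nu K0 by (simp_all add: n_def K'_def)
    have ra: "a * const L - const K' * (a * b) + const n * (a * d_minus) = 0"
      using rel unfolding n_def K'_def by algebra
    from a0 3 show False
    proof (cases rule: scalar_a_shapes)
      case (minus_low X)
      have "const (n - K') * X\<^sup>2 + const (- 2 * A * K') * X + const (A * L - K' * (A\<^sup>2 - 1) - n) = 0"
        using ra unfolding minus_low(2,3) unfolding minus_low(4) A const_hom by algebra
      note co = quadratic_relation_coeffs[OF this minus_low(1)]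
      show False using co(2) Ap n0 by simp
    next
      case (minus_high X)
      have "const (n - K') * X\<^sup>2 + const (2 * A * n) * X + const (A * L + K' + n * (A\<^sup>2 - 1)) = 0"
        using ra unfolding minus_high(2,3) unfolding minus_high(4) A const_hom by algebra
      note co = quadratic_relation_coeffs[OF this minus_high(1)]
      show False using co(2) Ap n0 by simp
    next
      case (scaled_low X \<kappa>)
      have "const (n - K' * \<kappa>\<^sup>2) * X\<^sup>2 + const 0 * X + const (A * L + K' * \<kappa>\<^sup>2 - 2 * K' * \<kappa> * A - n) = 0"
        using ra unfolding scaled_low(4,5) unfolding A const_hom by algebra
      note co = quadratic_relation_coeffs[OF this scaled_low(1)]
      have "n * ((2 * n + 1) * \<kappa>\<^sup>2 - 1) = 0" using co(1) kn by algebra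
      then have e: "(2 * n + 1) * \<kappa>\<^sup>2 = 1" using n0 by simp
      have q: "1 < \<kappa>\<^sup>2" using scaled_low(2) by simp
      have "0 < 2 * n + 1" using e q by (smt (verit) zero_less_mult_iff)
      then have "0 < real_of_int (2 * \<nu> + 1)" by (simp add: n_def)
      then have "1 \<le> real_of_int (2 * \<nu> + 1)" by (simp only: of_int_0_less_iff of_int_1_le_iff)
      then have "1 \<le> 2 * n + 1" by (simp add: n_def)
      then have "1 * \<kappa>\<^sup>2 \<le> (2 * n + 1) * \<kappa>\<^sup>2" by (intro mult_right_mono) auto
      then show False using e q by simp
    next
      case (scaled_high X \<kappa>)
      have Ak: "A = (\<kappa> - 1 / \<kappa>) / 2" using scaled_high(3) A by (simp add: const_inject)
      then have Ak': "2 * A * \<kappa> = \<kappa>\<^sup>2 - 1" using scaled_high(2) by (simp add: field_simps power2_eq_square)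
      have "(2 * k0 * \<kappa>)\<^sup>2 = (\<kappa>\<^sup>2 + 1)\<^sup>2" using k02 Ak' by algebra
      then have kk: "2 * k0 * \<kappa> = \<kappa>\<^sup>2 + 1"
        by (rule power2_eq_imp_eq) (use k0p scaled_high(2) in auto)
      have "const (n * \<kappa>\<^sup>2 - K') * X\<^sup>2 + const 0 * X + const (A * L + K' - n * \<kappa>\<^sup>2 + 2 * n * \<kappa> * A) = 0"
        using ra unfolding scaled_high(4,5) unfolding A const_hom by algebra
      note co = quadratic_relation_coeffs[OF this scaled_high(1)]
      have "n * (\<kappa>\<^sup>2 - (2 * n + 1)) = 0" using co(1) kn by algebra
      then have q: "\<kappa>\<^sup>2 = 2 * n + 1" using n0 by simp
      have np: "0 < n" using q scaled_high(2) by (smt (verit) one_less_power zero_less_numeral)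
      have "A * (L + 2 * n * \<kappa>) = 0" using co(1,3) by algebra
      then have "2 * \<kappa> * (L + 2 * n * \<kappa>) = 0" using Ap by simp
      then have "2 * (n * m\<^sup>2) * 2 + 4 * (n + 1) * m + 6 * n\<^sup>2 + 4 * n = 0"
        using Ak' kk q unfolding L_def m_def[symmetric] n_def[symmetric] by algebra
      then have "n * (2 * (n * m\<^sup>2) * 2 + 4 * (n + 1) * m + 6 * n\<^sup>2 + 4 * n) = 0" by simp
      moreover have "n * (2 * (n * m\<^sup>2) * 2 + 4 * (n + 1) * m + 6 * n\<^sup>2 + 4 * n)
        = (2 * n * m + (n + 1))\<^sup>2 + (6 * n ^ 3 + 3 * n\<^sup>2 - 2 * n - 1)" by algebra
      moreover have "0 < 6 * n ^ 3 + 3 * n\<^sup>2 - 2 * n - 1"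
      proof -
        have n1: "1 \<le> n" using np unfolding n_def by (simp add: int_one_le_iff_zero_less)
        then have "1 \<le> n\<^sup>2" "n * 1 \<le> n * n\<^sup>2" by (simp_all add: mult_left_mono)
        moreover have "n * n\<^sup>2 = n ^ 3" by algebra
        ultimately show ?thesis using n1 by linarith
      qed
      ultimately show False by (smt (verit) zero_le_power2)
    qed
  qed
qed

end

section \<open>Solving the congruences when \<open>b\<close> and \<open>c\<close> have the same degree\<close>

locale D1_triple_sum = D1_triple +
  assumes minus_0: "d_minus = 0"
begin

lemma c_sum: "c = a + b + 2 * r" and s_sum: "s = a + r" and t_sum: "t = b + r"
  and degree_c_b: "degree c = degree b"
  using minus_eq_0 minus_0 by simp_all

lemma c_eq_s_plus_t: "c = s + t"
  using c_sum s_sum t_sum by simp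

text \<open>Modulo \<open>c\<close> the polynomials \<open>b\<close>, \<open>s\<close>, \<open>t\<close> are integer combinations of \<open>a\<close> and \<open>r\<close>. If \<open>a\<close> has smaller
  degree than \<open>c\<close>, the degree of \<open>r\<close> lies strictly between, so the coefficients of \<open>a\<close> and \<open>r\<close> in a
  congruence vanish separately.\<close>

lemma r_coefficient:
  assumes "degree a < degree c" and dv: "c dvd p + of_int x * r" and p: "degree p \<le> degree a"
  shows "x = 0" "c dvd p"
proof -
  have dr: "degree a < degree r" "degree r < degree c"
    using degree_r degree_c_b assms(1) by simp_all
  have "degree (p + of_int x * r) < degree c"
    using degree_of_int_mult_le[of x r] dr p by (intro degree_add_less) linarith+
  then have "p + of_int x * r = 0" using dvd_degree_less_zero dv by blast
  then have "const (of_int x) * r + p = 0" unfolding const_of_int by (simp add: add.commute)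
  then show x: "x = 0" using const_mult_eq_low[of "of_int x" r p] dr p by simp
  show "c dvd p" using dv unfolding x by simp
qed

lemma sum_solve_base_0:
  assumes ac: "degree a < degree c"
    and dv: "c dvd a * of_int \<mu> ^ 2 + s * of_int \<mu> - (b * of_int \<nu> ^ 2 + t * of_int \<nu>)"
  shows "\<mu> = 0 \<and> \<nu> = 0 \<or> \<mu> = - 1 \<and> \<nu> = - 1"
proof -
  \<comment> \<open>Adding \<open>(\<nu>\<^sup>2 + \<nu>) * c\<close> eliminates \<open>b\<close>.\<close>
  have d: "c dvd of_int (\<mu>\<^sup>2 + \<mu> + \<nu>\<^sup>2 + \<nu>) * a + of_int (\<mu> + 2 * \<nu>\<^sup>2 + \<nu>) * r"
    by (rule dvd_linear_shift[OF dv, of _ 1 "of_int (\<nu>\<^sup>2 + \<nu>)"]) (simp add: c_sum s_sum t_sum algebra_simps)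
  note rc = r_coefficient[OF ac d degree_of_int_mult_le]
  have "of_int (\<mu>\<^sup>2 + \<mu> + \<nu>\<^sup>2 + \<nu>) * a = 0"
    using dvd_degree_less_zero[OF rc(2)] degree_of_int_mult_le[of "\<mu>\<^sup>2 + \<mu> + \<nu>\<^sup>2 + \<nu>" a] ac by simp
  then have z: "of_int (\<mu>\<^sup>2 + \<mu> + \<nu>\<^sup>2 + \<nu>) = (0 :: real poly)" using a_pos by (simp only: mult_eq_0_iff) auto
  then have "\<mu>\<^sup>2 + \<mu> + \<nu>\<^sup>2 + \<nu> = 0" by (simp only: of_int_eq_0_iff)
  then have "\<nu>\<^sup>2 + \<nu> = 0" "\<mu>\<^sup>2 + \<mu> = 0"
    using consecutive_product_nonneg[of \<mu>] consecutive_product_nonneg[of \<nu>] by linarith+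
  then have "\<nu> = 0 \<or> \<nu> = - 1" "\<mu> = 0 \<or> \<mu> = - 1" using int_product_zero_cases by blast+
  then show ?thesis using rc(1) by auto
qed

lemma sum_solve_base_a:
  assumes a: "degree a = 0" and k: "degree k = 0"
    and dv: "c dvd 2 * a * of_int \<mu> ^ 2 + 2 * k * of_int \<mu> - (2 * b * of_int \<nu> ^ 2 + (a + b - d_minus) * of_int \<nu>)"
  shows "\<nu> = 0"
proof -
  have ac: "degree a < degree c" using a degree_c_pos by simp
  obtain A k0 where ak: "a = const A" "k = const k0" using degree_0_const a k by blast
  have "c dvd (2 * a * of_int \<mu> ^ 2 + 2 * k * of_int \<mu> + 2 * a * of_int \<nu> ^ 2) + of_int (2 * (2 * \<nu>\<^sup>2 + \<nu>)) * r"
    by (rule dvd_linear_shift[OF dv, of _ 1 "of_int (2 * \<nu>\<^sup>2 + \<nu>)"]) (unfold minus_0, simp add: c_sum algebra_simps)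
  moreover have "2 * a * of_int \<mu> ^ 2 + 2 * k * of_int \<mu> + 2 * a * of_int \<nu> ^ 2
    = const (2 * A * of_int \<mu> ^ 2 + 2 * k0 * of_int \<mu> + 2 * A * of_int \<nu> ^ 2)"
    unfolding ak const_hom const_of_int ..
  ultimately have "2 * (2 * \<nu>\<^sup>2 + \<nu>) = 0"
    using r_coefficient(1)[OF ac] by (metis degree_const_zero le0)
  then have "\<nu> * (2 * \<nu> + 1) = 0" by (simp add: algebra_simps power2_eq_square)
  then show ?thesis using odd_ne_0[of \<nu>] by simp
qed

lemma sum_solve_base_0_odd_a_even:
  assumes ac: "degree a < degree c"
    and dv: "c dvd 2 * a * (of_int j ^ 2 + of_int j) + (2 * of_int j + 1) * s
      - (2 * b * of_int \<nu> ^ 2 + (a + b - d_minus) * of_int \<nu>)"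
  shows False
proof -
  have "c dvd of_int (2 * (j\<^sup>2 + j) + (2 * j + 1) + 2 * \<nu>\<^sup>2) * a + of_int (2 * j + 1 + 2 * (2 * \<nu>\<^sup>2 + \<nu>)) * r"
    by (rule dvd_linear_shift[OF dv, of _ 1 "of_int (2 * \<nu>\<^sup>2 + \<nu>)"])
      (unfold minus_0, simp add: c_sum s_sum algebra_simps)
  then have "2 * j + 1 + 2 * (2 * \<nu>\<^sup>2 + \<nu>) = 0"
    using r_coefficient(1)[OF ac _ degree_of_int_mult_le] by blast
  then show False using odd_ne_0[of "j + (2 * \<nu>\<^sup>2 + \<nu>)"] by (simp add: algebra_simps)
qed

lemma sum_solve_base_a_odd_0_even:
  assumes a: "degree a = 0" and k: "degree k = 0"
    and dv: "c dvd a + 2 * a * (of_int j ^ 2 + of_int j) + (2 * of_int j + 1) * k - (2 * b * of_int \<nu> ^ 2 + 2 * t * of_int \<nu>)"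
  shows "\<nu> = 0"
proof -
  have ac: "degree a < degree c" using a degree_c_pos by simp
  obtain A k0 where ak: "a = const A" "k = const k0" using degree_0_const a k by blast
  have "c dvd (a + 2 * a * (of_int j ^ 2 + of_int j) + (2 * of_int j + 1) * k + a * (2 * of_int \<nu> ^ 2 + 2 * of_int \<nu>))
      + of_int (2 * (2 * \<nu>\<^sup>2 + \<nu>)) * r"
    by (rule dvd_linear_shift[OF dv, of _ 1 "of_int (2 * \<nu>\<^sup>2 + 2 * \<nu>)"])
      (simp add: c_sum t_sum algebra_simps)
  moreover have "a + 2 * a * (of_int j ^ 2 + of_int j) + (2 * of_int j + 1) * k + a * (2 * of_int \<nu> ^ 2 + 2 * of_int \<nu>)
    = const (A + 2 * A * (of_int j ^ 2 + of_int j) + (2 * of_int j + 1) * k0 + A * (2 * of_int \<nu> ^ 2 + 2 * of_int \<nu>))"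
    unfolding ak const_hom const_of_int ..
  ultimately have "2 * (2 * \<nu>\<^sup>2 + \<nu>) = 0"
    using r_coefficient(1)[OF ac] by (metis degree_const_zero le0)
  then have "\<nu> * (2 * \<nu> + 1) = 0" by (simp add: algebra_simps power2_eq_square)
  then show ?thesis using odd_ne_0[of \<nu>] by simp
qed

text \<open>If \<open>a\<close> and \<open>c\<close> have the same degree, combinations of \<open>a\<close> and \<open>r\<close> are no longer reduced. They are
  still conclusive if both coefficients agree, because \<open>s = a + r\<close> is invertible modulo \<open>c\<close>.\<close>

lemma dvd_int_mult_s:
  assumes "c dvd of_int x * s"
  shows "x = 0"
proof -
  have "c dvd of_int x" by (rule dvd_linear_shift[OF assms, of _ s "- (of_int x * a)"]) (use s_sq in algebra)
  then have "of_int x = (0 :: real poly)" by (rule dvd_degree_less_zero) (simp add: degree_c_pos)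
  then show ?thesis by simp
qed

lemma sum_solve_base_0_same_index:
  assumes mn: "\<bar>\<mu>\<bar> = \<bar>\<nu>\<bar>"
    and dv: "c dvd a * of_int \<mu> ^ 2 + s * of_int \<mu> - (b * of_int \<nu> ^ 2 + t * of_int \<nu>)"
  shows "\<mu> = 0 \<and> \<nu> = 0 \<or> \<mu> = - 1 \<and> \<nu> = - 1"
proof -
  have sq: "\<mu>\<^sup>2 = \<nu>\<^sup>2" using mn by (metis power2_abs)
  have "c dvd of_int (\<mu>\<^sup>2 + \<mu> + \<nu>\<^sup>2 + \<nu>) * a + of_int (\<mu> + 2 * \<nu>\<^sup>2 + \<nu>) * r"
    by (rule dvd_linear_shift[OF dv, of _ 1 "of_int (\<nu>\<^sup>2 + \<nu>)"]) (simp add: c_sum s_sum t_sum algebra_simps)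
  also have "of_int (\<mu>\<^sup>2 + \<mu> + \<nu>\<^sup>2 + \<nu>) * a + of_int (\<mu> + 2 * \<nu>\<^sup>2 + \<nu>) * r = of_int (2 * \<nu>\<^sup>2 + \<mu> + \<nu>) * s"
    unfolding sq s_sum by (simp add: algebra_simps)
  finally have z: "2 * \<nu>\<^sup>2 + \<mu> + \<nu> = 0" by (rule dvd_int_mult_s)
  have "\<mu> = \<nu> \<or> \<mu> = - \<nu>" using mn by (simp add: abs_eq_iff)
  then show ?thesis
  proof
    assume m: "\<mu> = \<nu>"
    then have "\<nu>\<^sup>2 + \<nu> = 0" using z by simp
    then show ?thesis using int_product_zero_cases m by blast
  next
    assume m: "\<mu> = - \<nu>"
    then show ?thesis using z by simp
  qed
qed

text \<open>Both ladders start at \<open>0\<close> and have the same odd number of steps. Because \<open>c = s + t\<close>, the residues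
  \<open>s\<close> and \<open>t\<close> are opposite modulo \<open>c\<close>, so the starting signs are opposite too, and the first-order
  congruence says that \<open>c\<close> divides \<open>W\<^sup>2 + W + W'\<close> times \<open>s\<close>.\<close>

lemma sum_odd_same_index:
  assumes z: "\<zeta> = 1 \<or> \<zeta> = - 1" and y: "\<xi> = 1 \<or> \<xi> = - 1" and x0: "x0\<^sup>2 = 1" and y0: "y0\<^sup>2 = 1"
    and eq: "fst (ladder a c s \<zeta> x0 (2 * m + 1)) = fst (ladder b c t \<xi> y0 (2 * m + 1))"
  shows False
proof -
  have x: "x0\<^sup>2 = \<zeta>\<^sup>2" "y0\<^sup>2 = \<xi>\<^sup>2" using assms by auto
  obtain j p where j: "\<bar>2 * j + 1\<bar> = 2 * int m + 1"
    "fst (ladder a c s \<zeta> x0 (2 * m + 1)) =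
      s * \<zeta> + c * (2 * a * s * \<zeta> * (of_int j ^ 2 + of_int j) + (2 * of_int j + 1) * \<zeta>) + c\<^sup>2 * p"
    using ladder_odd_signed[OF s_sq x(1)] by metis
  obtain i q where i: "\<bar>2 * i + 1\<bar> = 2 * int m + 1"
    "fst (ladder b c t \<xi> y0 (2 * m + 1)) =
      t * \<xi> + c * (2 * b * t * \<xi> * (of_int i ^ 2 + of_int i) + (2 * of_int i + 1) * \<xi>) + c\<^sup>2 * q"
    using ladder_odd_signed[OF t_sq x(2)] by metis
  define J :: "real poly" where "J = of_int j ^ 2 + of_int j"
  define W :: "real poly" where "W = 2 * of_int j + 1"
  define I :: "real poly" where "I = of_int i ^ 2 + of_int i"
  define V :: "real poly" where "V = 2 * of_int i + 1"
  note eq' = eq[unfolded j(2) i(2), folded J_def W_def I_def V_def]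
  have "\<xi> = - \<zeta>"
  proof (rule ccontr)
    assume "\<xi> \<noteq> - \<zeta>"
    then have xz: "\<xi> = \<zeta>" using z y by auto
    have t: "t = c - s" using c_eq_s_plus_t by simp
    have z2: "\<zeta>\<^sup>2 = 1" using z by auto
    have "of_int 2 * s = c * (1 - \<zeta> * (2 * a * s * \<zeta> * J + W * \<zeta> + c * p - (2 * b * t * \<zeta> * I + V * \<zeta> + c * q)))"
      using eq' z2 unfolding xz t of_int_numeral by algebra
    then have "c dvd of_int 2 * s" by simp
    then have "(2 :: int) = 0" by (rule dvd_int_mult_s)
    then show False by simp
  qed
  note xi = this
  have g: "s * \<zeta> - t * \<xi> = c * \<zeta>" unfolding xi using c_eq_s_plus_t by algebra
  have "c dvd \<zeta> + (2 * a * s * \<zeta> * J + W * \<zeta>) - (2 * b * t * \<xi> * I + V * \<xi>)"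
    by (rule first_order_dvd[OF eq' g]) (use c_pos in simp)
  moreover have JI: "I = J"
  proof -
    have "(2 * j + 1)\<^sup>2 = (2 * i + 1)\<^sup>2" using i(1) j(1) by (metis power2_abs)
    then have "4 * (j\<^sup>2 + j) = 4 * (i\<^sup>2 + i)" by algebra
    then have "j\<^sup>2 + j = i\<^sup>2 + i" by simp
    then show ?thesis unfolding I_def J_def by (metis of_int_add of_int_power)
  qed
  moreover have "(1 + W + V + 4 * J) * s = (s * \<zeta>) * (\<zeta> + (2 * a * s * \<zeta> * J + W * \<zeta>) - (2 * b * t * \<xi> * J + V * \<xi>))
    + c * (- 2 * a\<^sup>2 * J + 2 * J - 2 * b * s * J + 2 * a * b * J)"
  proof -
    have z2: "\<zeta>\<^sup>2 = 1" using z by auto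
    have bb: "b = c - a - 2 * r" and tt: "t = c - s" using c_sum c_eq_s_plus_t by simp_all
    have "(s * \<zeta>) * (\<zeta> + (2 * a * s * \<zeta> * J + W * \<zeta>) - (2 * b * t * \<xi> * J + V * \<xi>))
      = s * (1 + W + V) + 2 * a * s\<^sup>2 * J + 2 * b * t * s * J"
      unfolding xi using z2 by algebra
    also have "\<dots> = s * (1 + W + V) + 2 * (a - b) * s\<^sup>2 * J + 2 * b * c * s * J"
      unfolding tt by algebra
    also have "\<dots> = s * (1 + W + V) + 2 * (a - b) * J + 2 * (a - b) * a * c * J + 2 * b * c * s * J"
      unfolding s_sq by algebra
    finally have e: "(s * \<zeta>) * (\<zeta> + (2 * a * s * \<zeta> * J + W * \<zeta>) - (2 * b * t * \<xi> * J + V * \<xi>)) = \<dots>" .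
    have "2 * (a - b) * J = 4 * J * s - 2 * c * J" unfolding bb s_sum by algebra
    then show ?thesis unfolding e by algebra
  qed
  ultimately have "c dvd (1 + W + V + 4 * J) * s" using dvd_linear_shift by metis
  moreover have "1 + W + V + 4 * J = of_int (1 + (2 * j + 1) + (2 * i + 1) + 4 * (j\<^sup>2 + j))"
    unfolding W_def V_def J_def by simp
  ultimately have "1 + (2 * j + 1) + (2 * i + 1) + 4 * (j\<^sup>2 + j) = 0" using dvd_int_mult_s by metis
  then show False by presburger
qed

end

text \<open>The triples of \<open>same_degree_minus_ne_0\<close>. Modulo \<open>c\<close>, both \<open>b\<close> and \<open>t\<close> are scalars.\<close>

locale D1_triple_scaled = D1_triple +
  fixes \<kappa> :: real
  assumes kappa: "1 < \<kappa>" and a_scaled: "a = const ((\<kappa> - 1 / \<kappa>) / 2)" and minus_a: "d_minus = a"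
    and c_scaled: "c = const (\<kappa>\<^sup>2) * b + const (2 * \<kappa>)" and s_scaled: "s = const \<kappa> * r"
    and t_scaled: "t = const \<kappa> * b + 1"
begin

definition k0 :: real where "k0 = (\<kappa> + 1 / \<kappa>) / 2"

lemma k0_sq: "(const k0)\<^sup>2 = a\<^sup>2 + 1"
proof -
  have "k0\<^sup>2 = ((\<kappa> - 1 / \<kappa>) / 2)\<^sup>2 + 1"
    using kappa unfolding k0_def by (simp add: field_simps power2_eq_square)
  then show ?thesis unfolding a_scaled by (simp flip: const_hom add: const_inject)
qed

lemma scalar_relations: "\<kappa> * (1 / \<kappa>) = 1" "2 * ((\<kappa> - 1 / \<kappa>) / 2) = \<kappa> - 1 / \<kappa>" "2 * k0 = \<kappa> + 1 / \<kappa>"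
  "2 / \<kappa> = 2 * (1 / \<kappa>)"
  using kappa by (simp_all add: k0_def)

lemma degree_a_0: "degree a = 0"
  by (simp add: a_scaled)

lemma degree_c_b: "degree c = degree b"
proof -
  have "degree (const (\<kappa>\<^sup>2) * b + const (2 * \<kappa>)) = degree b"
    using degree_add_eq_left[of "const (2 * \<kappa>)" "const (\<kappa>\<^sup>2) * b"] kappa degree_b_pos by simp
  then show ?thesis using c_scaled by simp
qed

lemma degree_s_half: "2 * degree s = degree c"
  using degree_s degree_a_0 by simp

lemma b_mod: "b = c * const (1 / \<kappa>\<^sup>2) - const (2 / \<kappa>)"
proof -
  have "const (1 / \<kappa>\<^sup>2) * const (\<kappa>\<^sup>2) = 1" "const (1 / \<kappa>\<^sup>2) * const (2 * \<kappa>) = const (2 / \<kappa>)"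
    using kappa by (simp_all add: power2_eq_square flip: const_hom)
  then show ?thesis unfolding c_scaled by algebra
qed

lemma t_mod: "t = c * const (1 / \<kappa>) - 1"
proof -
  have k: "const (1 / \<kappa>) * const (\<kappa>\<^sup>2) = const \<kappa>" "const (1 / \<kappa>) * const (2 * \<kappa>) = 2"
    using kappa by (simp_all add: power2_eq_square flip: const_hom)
  have "c * const (1 / \<kappa>) - 1 = (const (1 / \<kappa>) * const (\<kappa>\<^sup>2)) * b + const (1 / \<kappa>) * const (2 * \<kappa>) - 1"
    unfolding c_scaled by algebra
  also have "\<dots> = const \<kappa> * b + 1" unfolding k by simp
  finally show ?thesis unfolding t_scaled by simp
qed

text \<open>All first-order congruences therefore have the form \<open>x + y * s\<close> with scalars \<open>x\<close> and \<open>y\<close>, and \<open>s\<close> has half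
  the degree of \<open>c\<close>.\<close>

lemma scalar_plus_s:
  assumes "c dvd const x + const y * s"
  shows "x = 0" "y = 0"
proof -
  have "degree (const y * s) < degree c"
    using degree_s_half degree_c_pos by simp
  then have "degree (const x + const y * s) < degree c"
    using degree_c_pos by (intro degree_add_less) simp_all
  then have "const y * s + const x = 0" using dvd_degree_less_zero[OF assms] by (simp add: add.commute)
  moreover have "0 < degree s" using degree_s_half degree_c_pos by simp
  ultimately show "x = 0" "y = 0" using linear_relation_coeffs by blast+
qed

lemma scaled_solve_base_0:
  assumes dv: "c dvd a * of_int \<mu> ^ 2 + s * of_int \<mu> - (b * of_int \<nu> ^ 2 + t * of_int \<nu>)"
  shows "\<mu> = 0"
proof -
  define m where "m = real_of_int \<mu>"
  define n where "n = real_of_int \<nu>"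
  define A where "A = (\<kappa> - 1 / \<kappa>) / 2"
  have "c dvd const (A * m\<^sup>2 + 2 / \<kappa> * n\<^sup>2 + n) + const m * s"
    by (rule dvd_linear_shift[OF dv, of _ 1 "const (1 / \<kappa>\<^sup>2) * const n ^ 2 + const (1 / \<kappa>) * const n"])
      (unfold b_mod t_mod a_scaled A_def[symmetric] const_of_int[symmetric] m_def[symmetric] n_def[symmetric] const_hom(1,4,5), algebra)
  then have "m = 0" by (rule scalar_plus_s(2))
  then show ?thesis by (simp add: m_def)
qed

lemma scaled_solve_base_0_odd_a_even:
  assumes dv: "c dvd 2 * a * (of_int j ^ 2 + of_int j) + (2 * of_int j + 1) * s
      - (2 * b * of_int \<nu> ^ 2 + (a + b - d_minus) * of_int \<nu>)"
  shows False
proof -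
  define m where "m = real_of_int j"
  define n where "n = real_of_int \<nu>"
  define A where "A = (\<kappa> - 1 / \<kappa>) / 2"
  have "c dvd const (2 * A * (m\<^sup>2 + m) + 2 / \<kappa> * (2 * n\<^sup>2 + n)) + const (2 * m + 1) * s"
    by (rule dvd_linear_shift[OF dv, of _ 1 "const (1 / \<kappa>\<^sup>2) * (2 * const n ^ 2 + const n)"])
      (unfold minus_a, unfold b_mod a_scaled A_def[symmetric] const_of_int[symmetric] m_def[symmetric] n_def[symmetric] const_hom(1,4,5,7,8), algebra)
  then have "2 * m + 1 = 0" using scalar_plus_s(2) by blast
  then have "real_of_int (2 * j + 1) = 0" by (simp add: m_def)
  then show False using odd_ne_0[of j] by (simp only: of_int_eq_0_iff)
qed

lemma scaled_base_a_equation: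
  assumes dv: "c dvd 2 * a * of_int \<mu> ^ 2 + 2 * const k0 * of_int \<mu> - (2 * b * of_int \<nu> ^ 2 + (a + b - d_minus) * of_int \<nu>)"
  shows "(\<kappa>\<^sup>2 - 1) * (of_int \<mu>)\<^sup>2 + (\<kappa>\<^sup>2 + 1) * of_int \<mu> + 4 * (of_int \<nu>)\<^sup>2 + 2 * of_int \<nu> = 0"
proof -
  define m where "m = real_of_int \<mu>"
  define n where "n = real_of_int \<nu>"
  define A where "A = (\<kappa> - 1 / \<kappa>) / 2"
  have "c dvd const (2 * A * m\<^sup>2 + 2 * k0 * m + 2 / \<kappa> * (2 * n\<^sup>2 + n)) + const 0 * s"
    by (rule dvd_linear_shift[OF dv, of _ 1 "const (1 / \<kappa>\<^sup>2) * (2 * const n ^ 2 + const n)"])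
      (unfold minus_a, unfold b_mod a_scaled A_def[symmetric] const_of_int[symmetric] m_def[symmetric] n_def[symmetric] const_hom(1,4,5,6,7,8), algebra)
  then have "2 * A * m\<^sup>2 + 2 * k0 * m + 2 / \<kappa> * (2 * n\<^sup>2 + n) = 0" using scalar_plus_s(1) by blast
  then have "(\<kappa>\<^sup>2 - 1) * m\<^sup>2 + (\<kappa>\<^sup>2 + 1) * m + 4 * n\<^sup>2 + 2 * n = 0"
    using scalar_relations[folded A_def] by algebra
  then show ?thesis unfolding m_def n_def .
qed

lemma scaled_base_a_odd_0_even_equation:
  assumes dv: "c dvd a + 2 * a * (of_int j ^ 2 + of_int j) + (2 * of_int j + 1) * const k0 - (2 * b * of_int \<nu> ^ 2 + 2 * t * of_int \<nu>)"
  defines "W \<equiv> real_of_int (2 * j + 1)" and "l \<equiv> real_of_int (2 * \<nu>)"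
  shows "\<kappa>\<^sup>2 * (W + 1)\<^sup>2 - (W - 1)\<^sup>2 + 4 * l\<^sup>2 + 4 * \<kappa> * l = 0"
proof -
  define m where "m = real_of_int j"
  define n where "n = real_of_int \<nu>"
  define A where "A = (\<kappa> - 1 / \<kappa>) / 2"
  have "c dvd const (A + 2 * A * (m\<^sup>2 + m) + (2 * m + 1) * k0 + 2 / \<kappa> * (2 * n\<^sup>2) + 2 * n) + const 0 * s"
    by (rule dvd_linear_shift[OF dv, of _ 1 "const (1 / \<kappa>\<^sup>2) * (2 * const n ^ 2) + const (1 / \<kappa>) * (2 * const n)"])
      (unfold b_mod t_mod a_scaled A_def[symmetric] const_of_int[symmetric] m_def[symmetric] n_def[symmetric] const_hom(1,4,5,6,7,8), algebra)
  then have "A + 2 * A * (m\<^sup>2 + m) + (2 * m + 1) * k0 + 2 / \<kappa> * (2 * n\<^sup>2) + 2 * n = 0" using scalar_plus_s(1) by blast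
  then have "(\<kappa>\<^sup>2 - 1) * (1 + 2 * (m\<^sup>2 + m)) + (2 * m + 1) * (\<kappa>\<^sup>2 + 1) + 8 * n\<^sup>2 + 4 * \<kappa> * n = 0"
    using scalar_relations[folded A_def] by algebra
  moreover have "W = 2 * m + 1" "l = 2 * n" by (simp_all add: W_def l_def m_def n_def)
  ultimately show ?thesis by algebra
qed

lemma opposite_start:
  assumes z: "\<zeta> = 1 \<or> \<zeta> = - 1" and x: "\<xi> = 1 \<or> \<xi> = - 1" and dv: "c dvd \<zeta> - t * \<xi>"
  shows "\<xi> = - \<zeta>"
proof (rule ccontr)
  assume "\<xi> \<noteq> - \<zeta>"
  then have xz: "\<xi> = \<zeta>" using z x by auto
  have "c dvd 2 * \<zeta>" by (rule dvd_linear_shift[OF dv, of _ 1 "const (1 / \<kappa>) * \<zeta>"]) (unfold t_mod xz, algebra)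
  then have "2 * \<zeta> = 0" using z by (intro dvd_degree_less_zero) (use degree_c_pos in auto)
  then show False using z by auto
qed

lemma scaled_base_0_even_odd:
  assumes z: "\<zeta> = 1 \<or> \<zeta> = - 1" and x: "\<xi> = 1 \<or> \<xi> = - 1" and x0: "x0\<^sup>2 = 1" and y0: "y0\<^sup>2 = 1"
    and eq: "fst (ladder a c s \<zeta> x0 (2 * m)) = fst (ladder b c t \<xi> y0 (2 * n + 1))"
  shows "m = 0"
proof -
  have xx: "x0\<^sup>2 = \<zeta>\<^sup>2" "y0\<^sup>2 = \<xi>\<^sup>2" using assms by auto
  have z2: "\<zeta>\<^sup>2 = 1" using z by auto
  obtain \<mu> p where m: "\<bar>\<mu>\<bar> = int m"
    "fst (ladder a c s \<zeta> x0 (2 * m)) = \<zeta> + c * (2 * (a * \<zeta> * of_int \<mu> ^ 2 + s * \<zeta> * of_int \<mu>)) + c\<^sup>2 * p"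
    using ladder_even_signed[OF s_sq xx(1)] by metis
  obtain i q where i: "\<bar>2 * i + 1\<bar> = 2 * int n + 1"
    "fst (ladder b c t \<xi> y0 (2 * n + 1)) =
      t * \<xi> + c * (2 * b * t * \<xi> * (of_int i ^ 2 + of_int i) + (2 * of_int i + 1) * \<xi>) + c\<^sup>2 * q"
    using ladder_odd_signed[OF t_sq xx(2)] by metis
  define I :: "real poly" where "I = of_int i ^ 2 + of_int i"
  define V :: "real poly" where "V = 2 * of_int i + 1"
  define M :: "real poly" where "M = of_int \<mu>"
  note eq' = eq[unfolded m(2) i(2), folded I_def V_def M_def]
  have "\<zeta> - t * \<xi> = c * ((2 * b * t * \<xi> * I + V * \<xi>) + c * q - 2 * (a * \<zeta> * M ^ 2 + s * \<zeta> * M) - c * p)"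
    using eq' by algebra
  then have xi: "\<xi> = - \<zeta>" using opposite_start[OF z x] by simp
  have g: "\<zeta> - t * \<xi> = c * (const (1 / \<kappa>) * \<zeta>)" unfolding xi t_mod by algebra
  have dv: "c dvd const (1 / \<kappa>) * \<zeta> + 2 * (a * \<zeta> * M ^ 2 + s * \<zeta> * M) - (2 * b * t * \<xi> * I + V * \<xi>)"
    by (rule first_order_dvd[OF eq' g]) (use c_pos in simp)
  define mm where "mm = real_of_int \<mu>"
  define ii where "ii = real_of_int i"
  define A where "A = (\<kappa> - 1 / \<kappa>) / 2"
  have "c dvd const (1 / \<kappa> + 2 * A * mm\<^sup>2 + 2 * (2 / \<kappa>) * (ii\<^sup>2 + ii) + (2 * ii + 1)) + const (2 * mm) * s"
    by (rule dvd_linear_shift[OF dv, of _ \<zeta> "- 2 * (const (1 / \<kappa>\<^sup>2) * t - const (2 / \<kappa>) * const (1 / \<kappa>)) * (const ii ^ 2 + const ii)"])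
      (unfold I_def V_def M_def a_scaled A_def[symmetric] const_of_int[symmetric] mm_def[symmetric] ii_def[symmetric] const_hom(1,4,5,7,8),
        use z2 xi t_mod b_mod in algebra)
  then have "2 * mm = 0" using scalar_plus_s(2) by blast
  then show ?thesis using m(1) by (simp add: mm_def)
qed

lemma scaled_base_a_odd_0_odd_equation:
  assumes z: "\<zeta> = 1 \<or> \<zeta> = - 1" and x: "\<xi> = 1 \<or> \<xi> = - 1" and x0: "x0\<^sup>2 = (const k0)\<^sup>2" and y0: "y0\<^sup>2 = 1"
    and eq: "fst (ladder a c s (\<zeta> * s) x0 (2 * m + 1)) = fst (ladder b c t \<xi> y0 (2 * n + 1))"
  obtains W l :: int where "\<bar>W\<bar> = 2 * int m + 1" "\<bar>l\<bar> = 2 * int n + 1"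
    "\<kappa>\<^sup>2 * (real_of_int W + 1)\<^sup>2 - (real_of_int W - 1)\<^sup>2 + 4 * (real_of_int l)\<^sup>2 + 4 * \<kappa> * real_of_int l = 0"
proof -
  have z2: "\<zeta>\<^sup>2 = 1" using z by auto
  have xx: "x0\<^sup>2 = (\<zeta> * const k0)\<^sup>2" "y0\<^sup>2 = \<xi>\<^sup>2" using assms z2 by (auto simp: power_mult_distrib)
  obtain j p where j: "\<bar>2 * j + 1\<bar> = 2 * int m + 1"
    "fst (ladder a c s (\<zeta> * s) x0 (2 * m + 1)) =
      s * (\<zeta> * s) + c * (2 * a * s * (\<zeta> * s) * (of_int j ^ 2 + of_int j) + (2 * of_int j + 1) * (\<zeta> * const k0)) + c\<^sup>2 * p"
    using ladder_odd_signed[OF s_sq xx(1)] by metis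
  obtain i q where i: "\<bar>2 * i + 1\<bar> = 2 * int n + 1"
    "fst (ladder b c t \<xi> y0 (2 * n + 1)) =
      t * \<xi> + c * (2 * b * t * \<xi> * (of_int i ^ 2 + of_int i) + (2 * of_int i + 1) * \<xi>) + c\<^sup>2 * q"
    using ladder_odd_signed[OF t_sq xx(2)] by metis
  define I :: "real poly" where "I = of_int i ^ 2 + of_int i"
  define V :: "real poly" where "V = 2 * of_int i + 1"
  define J :: "real poly" where "J = of_int j ^ 2 + of_int j"
  define U :: "real poly" where "U = 2 * of_int j + 1"
  note eq' = eq[unfolded j(2) i(2), folded I_def V_def J_def U_def]
  have "\<zeta> - t * \<xi> = c * ((2 * b * t * \<xi> * I + V * \<xi>) + c * q - (2 * a * s * (\<zeta> * s) * J + U * (\<zeta> * const k0)) - c * p - a * \<zeta>)"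
    using eq' s_sq by algebra
  then have xi: "\<xi> = - \<zeta>" using opposite_start[OF z x] by simp
  have g: "s * (\<zeta> * s) - t * \<xi> = c * ((a + const (1 / \<kappa>)) * \<zeta>)" unfolding xi t_mod using s_sq by algebra
  have dv: "c dvd (a + const (1 / \<kappa>)) * \<zeta> + (2 * a * s * (\<zeta> * s) * J + U * (\<zeta> * const k0)) - (2 * b * t * \<xi> * I + V * \<xi>)"
    by (rule first_order_dvd[OF eq' g]) (use c_pos in simp)
  define mm where "mm = real_of_int j"
  define ii where "ii = real_of_int i"
  define A where "A = (\<kappa> - 1 / \<kappa>) / 2"
  have "c dvd const (A + 1 / \<kappa> + 2 * A * (mm\<^sup>2 + mm) + (2 * mm + 1) * k0 + 2 * (2 / \<kappa>) * (ii\<^sup>2 + ii) + (2 * ii + 1)) + const 0 * s"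
    by (rule dvd_linear_shift[OF dv, of _ \<zeta> "- 2 * (const (1 / \<kappa>\<^sup>2) * t - const (2 / \<kappa>) * const (1 / \<kappa>)) * (const ii ^ 2 + const ii)
          - 2 * const A * const A * (const mm ^ 2 + const mm)"])
      (unfold I_def V_def J_def U_def A_def[symmetric] const_of_int[symmetric] mm_def[symmetric] ii_def[symmetric] const_hom(1,4,5,6,7,8),
        use z2 xi t_mod b_mod s_sq a_scaled[folded A_def] in algebra)
  then have "A + 1 / \<kappa> + 2 * A * (mm\<^sup>2 + mm) + (2 * mm + 1) * k0 + 2 * (2 / \<kappa>) * (ii\<^sup>2 + ii) + (2 * ii + 1) = 0"
    using scalar_plus_s(1) by blast
  then have "(\<kappa>\<^sup>2 - 1) * (1 + 2 * (mm\<^sup>2 + mm)) + 2 + (2 * mm + 1) * (\<kappa>\<^sup>2 + 1) + 8 * (ii\<^sup>2 + ii) + 2 * \<kappa> * (2 * ii + 1) = 0"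
    using scalar_relations[folded A_def] by algebra
  then have "\<kappa>\<^sup>2 * (real_of_int (2 * j + 1) + 1)\<^sup>2 - (real_of_int (2 * j + 1) - 1)\<^sup>2 + 4 * (real_of_int (2 * i + 1))\<^sup>2 + 4 * \<kappa> * real_of_int (2 * i + 1) = 0"
    unfolding mm_def ii_def of_int_add of_int_mult of_int_numeral of_int_1 by algebra
  then show ?thesis using that[of "2 * j + 1" "2 * i + 1"] i(1) j(1) by simp
qed

end

text \<open>The condition on \<open>\<bar>W\<bar>\<close> expresses that both ladders lead to the same degree. One solution is left, which belongs to no
  quadruple but satisfies the first-order congruence; it has to be excluded by computing both ladders.\<close>

lemma scaled_numerical:
  fixes \<kappa> :: real and W l :: int
  assumes k: "1 < \<kappa>" and l: "l \<noteq> 0" and W: "\<bar>W\<bar> = 2 * \<bar>l\<bar> - 1"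
    and e: "\<kappa>\<^sup>2 * (real_of_int W + 1)\<^sup>2 - (real_of_int W - 1)\<^sup>2 + 4 * (real_of_int l)\<^sup>2 + 4 * \<kappa> * real_of_int l = 0"
  shows "\<kappa> = 2 \<and> W = - 3 \<and> l = - 2"
proof -
  define N where "N = \<bar>l\<bar>"
  have N: "1 \<le> N" using l by (simp add: N_def)
  then have rN: "1 \<le> real_of_int N" by simp
  have l2: "(real_of_int l)\<^sup>2 = (real_of_int N)\<^sup>2" by (simp add: N_def)
  have lN: "l = N \<or> l = - N" by (auto simp: N_def)
  have "W = 2 * N - 1 \<or> W = - (2 * N - 1)" using W N unfolding N_def[symmetric] by auto
  then show ?thesis
  proof
    assume w: "W = 2 * N - 1"
    then have rw: "real_of_int W = 2 * real_of_int N - 1" by simp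
    have "4 * ((\<kappa> * N)\<^sup>2 + (2 * real_of_int N - 1) + \<kappa> * l) = 0"
      using e unfolding of_int_power of_int_add of_int_diff of_int_1 l2 rw by algebra
    then have "(\<kappa> * N)\<^sup>2 + (2 * real_of_int N - 1) + \<kappa> * l = 0" by simp
    moreover have "- (\<kappa> * real_of_int N) \<le> \<kappa> * l" using lN k rN by auto
    moreover have "\<kappa> * real_of_int N * 1 \<le> (\<kappa> * N) * (\<kappa> * N)"
      using k rN mult_mono[of 1 \<kappa> 1 "real_of_int N"] by (intro mult_left_mono) auto
    ultimately show ?thesis using rN by (simp add: power2_eq_square)
  next
    assume w: "W = - (2 * N - 1)"
    then have rw: "real_of_int W = 1 - 2 * real_of_int N" by simp
    have "4 * (\<kappa> * (\<kappa> * (real_of_int N - 1)\<^sup>2 + l)) = 0"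
      using e unfolding of_int_power of_int_add of_int_diff of_int_1 l2 rw by algebra
    then have z: "\<kappa> * (real_of_int N - 1)\<^sup>2 + l = 0" using k by simp
    have "0 \<le> \<kappa> * (real_of_int N - 1)\<^sup>2" using k by simp
    then have lm: "l = - N" using lN z rN by auto
    have z': "\<kappa> * (real_of_int N - 1)\<^sup>2 = N" using z lm by simp
    have "N = 2"
    proof (rule ccontr)
      assume "N \<noteq> 2"
      moreover have "N \<noteq> 1" using z' by auto
      ultimately have "3 \<le> N" using N by simp
      then have N3: "3 \<le> real_of_int N" by simp
      then have "3 * real_of_int N \<le> real_of_int N * real_of_int N" by (intro mult_right_mono) auto
      then have "real_of_int N < (real_of_int N - 1)\<^sup>2" by (simp add: power2_eq_square algebra_simps)
      also have "\<dots> \<le> \<kappa> * (real_of_int N - 1)\<^sup>2" using k mult_right_mono[of 1 \<kappa> "(real_of_int N - 1)\<^sup>2"] by simp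
      finally show False using z' by simp
    qed
    then show ?thesis using z' lm w by simp
  qed
qed

section \<open>Combining the two ladders\<close>

lemma ladder_even_residue:
  assumes "s\<^sup>2 = a * c + 1" "even k" "ladder a c s z0 x0 k = (z, x)"
  shows "c dvd z - z0"
proof -
  obtain m where m: "k = 2 * m" using assms(2) by blast
  obtain p q where "ladder a c s z0 x0 (2 * m) =
    (z0 + 2 * c * (a * z0 * of_nat m ^ 2 + s * x0 * of_nat m) + c\<^sup>2 * p, x0 + 2 * of_nat m * a * s * z0 + c * q)"
    using ladder_even_mod[OF assms(1)] by blast
  then have "z - z0 = c * (2 * (a * z0 * of_nat m ^ 2 + s * x0 * of_nat m) + c * p)"
    using assms(3) m by (simp add: algebra_simps power2_eq_square)
  then show ?thesis by simp
qed

lemma ladder_odd_residue: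
  assumes "s\<^sup>2 = a * c + 1" "odd k" "ladder a c s z0 x0 k = (z, x)"
  shows "c dvd z - s * z0"
proof -
  obtain m where m: "k = 2 * m + 1" using assms(2) oddE by blast
  obtain p where "fst (ladder a c s z0 x0 (2 * m + 1)) =
    s * z0 + c * (2 * a * s * z0 * (of_nat m ^ 2 + of_nat m) + (2 * of_nat m + 1) * x0) + c\<^sup>2 * p"
    using ladder_odd_mod[OF assms(1)] by blast
  then have "z - s * z0 = c * ((2 * a * s * z0 * (of_nat m ^ 2 + of_nat m) + (2 * of_nat m + 1) * x0) + c * p)"
    using assms(3) m by (simp add: algebra_simps power2_eq_square)
  then show ?thesis by simp
qed

lemma degree_root_less:
  fixes c f z :: "real poly"
  assumes "z\<^sup>2 = c * f + 1" "degree f < degree c"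
  shows "degree z < degree c"
proof -
  have "degree (c * f + 1) \<le> degree c + degree f"
    using degree_mult_le[of c f] by (intro degree_add_le) auto
  then have "2 * degree z \<le> degree c + degree f" using assms(1) degree_sq[of z] by simp
  then show ?thesis using assms(2) by simp
qed

lemma degree_lower_neighbour:
  fixes a c s :: "real poly"
  assumes "2 * degree s = degree a + degree c" "degree a < degree c"
  shows "degree (a + c - 2 * s) = degree c"
proof -
  have "degree (2 * s) \<le> degree s" using const_mult_degree_le[of 2 s] by (simp add: const_hom)
  then have "degree (a - 2 * s) < degree c" using assms by (intro degree_diff_lt) auto
  then have "degree (c + (a - 2 * s)) = degree c" by (rule degree_add_eq_left)
  moreover have "c + (a - 2 * s) = a + c - 2 * s" by simp
  ultimately show ?thesis by simp
qed

text \<open>The residue modulo \<open>c\<close> by which \<open>z\<close> remembers the partner \<open>f\<close> it comes from. It has degree less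
  than \<open>degree c\<close>, hence it can be compared with the residue found on another ladder.\<close>

definition reduced_residue :: "real poly \<Rightarrow> real poly \<Rightarrow> real poly \<Rightarrow> real poly \<Rightarrow> bool" where
  "reduced_residue c z f R \<longleftrightarrow> c dvd z - R \<and> R\<^sup>2 = c * f + 1 \<and> degree f < degree c"

lemma reduced_residue_unique:
  assumes "reduced_residue c z f p" "reduced_residue c z g q"
  shows "p = q" "f = g"
proof -
  have "c dvd (z - q) - (z - p)" using assms dvd_diff unfolding reduced_residue_def by blast
  moreover have "degree p < degree c" "degree q < degree c"
    using assms degree_root_less unfolding reduced_residue_def by blast+
  ultimately have "p - q = 0" using dvd_degree_less_zero[of c "p - q"] degree_diff_lt by simp
  then show "p = q" by simp
  moreover have "p\<^sup>2 = c * f + 1" "q\<^sup>2 = c * g + 1" using assms unfolding reduced_residue_def by blast+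
  ultimately have "c * f = c * g" by (metis add_right_cancel)
  moreover have "c \<noteq> 0" using assms unfolding reduced_residue_def by auto
  ultimately show "f = g" by simp
qed

lemma reduced_residue_sign:
  assumes "\<epsilon> = 1 \<or> \<epsilon> = - 1" "R\<^sup>2 = c * f + 1" "c dvd z - R * \<epsilon>" "degree f < degree c"
  shows "reduced_residue c z f (R * \<epsilon>)"
  using assms unfolding reduced_residue_def by (auto simp: power_mult_distrib)

text \<open>The kinds of base to which a partner can be traced back: \<open>0\<close>, the scalar \<open>a\<close> itself, or any
  other partner of small degree, the last one after an even number of steps.\<close>

lemma ladder_base_cases:
  fixes a c s d x z :: "real poly"
  assumes a: "0 < a" and ac: "a < c" and c: "0 < degree c" and s: "0 < s" "s\<^sup>2 = a * c + 1"
    and d: "0 < d" and x: "0 < x" "x\<^sup>2 = a * d + 1" and z: "0 < z" "z\<^sup>2 = c * d + 1"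
  obtains
    (zero_even) \<zeta> x0 m where "ladder a c s \<zeta> x0 (2 * m) = (z, x)" "\<zeta> = 1 \<or> \<zeta> = - 1" "x0\<^sup>2 = 1" "0 < m"
      "degree d = degree c + (2 * m - 1) * (degree a + degree c)" "reduced_residue c z 0 \<zeta>"
  | (zero_odd) \<zeta> x0 m where "ladder a c s \<zeta> x0 (2 * m + 1) = (z, x)" "\<zeta> = 1 \<or> \<zeta> = - 1" "x0\<^sup>2 = 1"
      "degree d = degree c + 2 * m * (degree a + degree c)" "c dvd z - s * \<zeta>"
      "degree a < degree c \<Longrightarrow> reduced_residue c z a (s * \<zeta>)"
  | (scalar_even) \<epsilon> x0 m where "degree a = 0" "ladder a c s (\<epsilon> * s) x0 (2 * m) = (z, x)" "\<epsilon> = 1 \<or> \<epsilon> = - 1"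
      "x0\<^sup>2 = a\<^sup>2 + 1" "degree d = 2 * m * degree c" "reduced_residue c z a (s * \<epsilon>)"
  | (scalar_odd) \<epsilon> x0 m where "degree a = 0" "ladder a c s (\<epsilon> * s) x0 (2 * m + 1) = (z, x)" "\<epsilon> = 1 \<or> \<epsilon> = - 1"
      "x0\<^sup>2 = a\<^sup>2 + 1" "degree d = (2 * m + 1) * degree c" "reduced_residue c z 0 \<epsilon>"
  | (even) f z0 x0 m \<rho> j where "ladder a c s z0 x0 (2 * m) = (z, x)" "x0\<^sup>2 = a * f + 1"
      "0 \<le> f" "degree (a + c - 2 * s) = degree c \<Longrightarrow> f \<noteq> 0" "f \<noteq> 0 \<Longrightarrow> degree a \<noteq> 0 \<or> degree f \<noteq> 0"
      "degree d = \<rho> + j * (degree a + degree c)" "\<rho> < degree c" "reduced_residue c z f z0"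
proof -
  obtain f z0 x0 k where b: "ladder a c s z0 x0 k = (z, x)" "z0\<^sup>2 = c * f + 1" "x0\<^sup>2 = a * f + 1"
    "0 \<le> f" "degree f < degree c"
    "f = 0 \<Longrightarrow> 1 \<le> k \<and> degree d = degree c + (k - 1) * (degree a + degree c)"
    "f \<noteq> 0 \<Longrightarrow> degree d = degree f + k * (degree a + degree c)"
    using ladder_descent[OF assms] by metis
  have s': "s\<^sup>2 = c * a + 1" using s by (simp add: mult.commute)
  show ?thesis
  proof (cases "f = 0")
    case True
    then have z0: "z0 = 1 \<or> z0 = - 1" and x0: "x0\<^sup>2 = 1" using b(2,3) by (simp_all add: power2_eq_1_iff)
    show ?thesis
    proof (cases "even k")
      case k: True
      then obtain m where m: "k = 2 * m" by (rule evenE)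
      have "reduced_residue c z 0 z0"
        using ladder_even_residue[OF s(2) k b(1)] z0 c unfolding reduced_residue_def by auto
      then show ?thesis using zero_even[of z0 x0 m] b(1,6) True z0 x0 m by simp
    next
      case k: False
      then obtain m where m: "k = 2 * m + 1" by (rule oddE)
      note dv = ladder_odd_residue[OF s(2) k b(1)]
      show ?thesis
        by (rule zero_odd[OF b(1)[unfolded m] z0 x0 _ dv])
          (use b(6) True m reduced_residue_sign[OF z0 s' dv] in simp_all)
    qed
  next
    case ne: False
    then have fpos: "0 < f" using b(4) by simp
    show ?thesis
    proof (cases "degree a = 0 \<and> degree f = 0")
      case True
      then have fa: "f = a"
        using const_partner_unique[of f a c z0 s] fpos a c b(2) s(2) by (simp add: mult.commute)
      then have "z0\<^sup>2 = s\<^sup>2" using b(2) s' by simp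
      then have "z0 = s \<or> z0 = - s" by (simp only: power2_eq_iff)
      then obtain \<epsilon> :: "real poly" where e: "\<epsilon> = 1 \<or> \<epsilon> = - 1" "z0 = \<epsilon> * s" by (metis mult_1 mult_minus1)
      have x0: "x0\<^sup>2 = a\<^sup>2 + 1" using b(3) fa by (simp add: power2_eq_square)
      have dd: "degree d = k * degree c" using b(7) ne True by simp
      note lad = b(1)[unfolded e(2)]
      show ?thesis
      proof (cases "even k")
        case k: True
        then obtain m where m: "k = 2 * m" by (rule evenE)
        have "c dvd z - s * \<epsilon>" using ladder_even_residue[OF s(2) k lad] by (simp add: mult.commute)
        then show ?thesis using scalar_even[OF _ lad[unfolded m] e(1) x0] reduced_residue_sign[OF e(1) s'] True dd m c by simp
      next
        case k: False
        then obtain m where m: "k = 2 * m + 1" by (rule oddE)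
        have "c dvd (z - s * (\<epsilon> * s)) + c * (a * \<epsilon>)"
          using ladder_odd_residue[OF s(2) k lad] by simp
        also have "(z - s * (\<epsilon> * s)) + c * (a * \<epsilon>) = z - \<epsilon>" using s' by algebra
        finally have "reduced_residue c z 0 \<epsilon>" using e(1) c unfolding reduced_residue_def by auto
        then show ?thesis using scalar_odd[OF _ lad[unfolded m] e(1) x0] True dd m by simp
      qed
    next
      case False
      obtain g z1 x1 l where g: "even l" "ladder a c s z1 x1 l = ladder a c s z0 x0 k"
        "z1\<^sup>2 = c * g + 1" "x1\<^sup>2 = a * g + 1" "0 \<le> g" "degree g < degree c"
        "degree (a + c - 2 * s) = degree c \<Longrightarrow> g \<noteq> 0"
        "g \<noteq> 0 \<Longrightarrow> degree a \<noteq> 0 \<or> degree g \<noteq> 0"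
        using ladder_even_base[OF a ac c s b(2,3) fpos b(5), of k] False by metis
      obtain m where m: "l = 2 * m" using g(1) by (rule evenE)
      have "reduced_residue c z g z1"
        unfolding reduced_residue_def using ladder_even_residue[OF s(2) g(1)] g(2,3,6) b(1) by simp
      then show ?thesis using even[of z1 x1 m g "degree f" k] g b ne m by simp
    qed
  qed
qed

text \<open>A quadruple with largest member \<open>d\<close>, in which the extensions of \<open>{a, b, c}\<close> of small degree are
  already known to be regular.\<close>

locale D1_quadruple = D1_triple +
  fixes d x y z :: "real poly"
  assumes c_less_d: "c < d" and x_pos: "0 < x" and y_pos: "0 < y" and z_pos: "0 < z"
    and x_sq: "x\<^sup>2 = a * d + 1" and y_sq: "y\<^sup>2 = b * d + 1" and z_sq: "z\<^sup>2 = c * d + 1"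
    and small_extension: "\<And>f p q w. 0 < f \<Longrightarrow> f \<noteq> a \<Longrightarrow> f \<noteq> b \<Longrightarrow> degree f < degree c \<Longrightarrow>
      p\<^sup>2 = a * f + 1 \<Longrightarrow> q\<^sup>2 = b * f + 1 \<Longrightarrow> w\<^sup>2 = c * f + 1 \<Longrightarrow> f = d_minus"
begin

lemma d_pos: "0 < d"
  using c_less_d c_pos by simp

lemma degree_d: "degree c \<le> degree d"
  using degree_mono_nonneg c_pos c_less_d by (simp add: order_less_imp_le)

lemmas ladder_ac [consumes 0, case_names zero_even zero_odd scalar_even scalar_odd even] =
  ladder_base_cases[OF a_pos a_less_c degree_c_pos s_pos s_sq d_pos x_pos x_sq z_pos z_sq]

lemma ladder_bc [consumes 0, case_names zero_even zero_odd even]: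
  obtains
    (zero_even) \<xi> y0 n where "ladder b c t \<xi> y0 (2 * n) = (z, y)" "\<xi> = 1 \<or> \<xi> = - 1" "y0\<^sup>2 = 1" "0 < n"
      "degree d = degree c + (2 * n - 1) * (degree b + degree c)" "reduced_residue c z 0 \<xi>"
  | (zero_odd) \<xi> y0 n where "ladder b c t \<xi> y0 (2 * n + 1) = (z, y)" "\<xi> = 1 \<or> \<xi> = - 1" "y0\<^sup>2 = 1"
      "degree d = degree c + 2 * n * (degree b + degree c)" "c dvd z - t * \<xi>"
      "degree b < degree c \<Longrightarrow> reduced_residue c z b (t * \<xi>)"
  | (even) g z1 y1 n \<rho> j where "ladder b c t z1 y1 (2 * n) = (z, y)" "y1\<^sup>2 = b * g + 1"
      "0 \<le> g" "degree (b + c - 2 * t) = degree c \<Longrightarrow> g \<noteq> 0"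
      "degree d = \<rho> + j * (degree b + degree c)" "\<rho> < degree c" "reduced_residue c z g z1"
proof (cases rule: ladder_base_cases[OF b_pos b_less_c degree_c_pos t_pos t_sq d_pos y_pos y_sq z_pos z_sq,
      case_names zero_even zero_odd scalar_even scalar_odd even])
  case zero_even
  then show ?thesis by (rule that(1))
next
  case zero_odd
  then show ?thesis by (rule that(2))
next
  case scalar_even
  then show ?thesis using degree_b_pos by simp
next
  case scalar_odd
  then show ?thesis using degree_b_pos by simp
next
  case (even f z0 x0 m \<rho> j)
  then show ?thesis using that(3)[of z0 x0 m f \<rho> j] by blast
qed

text \<open>The degree of \<open>d\<close> is too large for a base.\<close>

lemma base_reached_after_steps:
  assumes "reduced_residue c z f R"
  shows "z \<noteq> R"
proof
  assume "z = R"
  moreover have "R\<^sup>2 = c * f + 1" using assms unfolding reduced_residue_def by blast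
  ultimately have "c * f = c * d" using z_sq by (metis add_right_cancel)
  then have "f = d" using c_pos by auto
  then show False using assms degree_d unfolding reduced_residue_def by simp
qed

text \<open>A common base is different from \<open>a\<close> and \<open>b\<close>, because \<open>p * p + 1\<close> is no square for non-constant \<open>p\<close>, so the
  assumption on extensions of small degree applies to it.\<close>

lemma common_base:
  assumes "reduced_residue c z f z0" "x0\<^sup>2 = a * f + 1" "y0\<^sup>2 = b * f + 1" "0 \<le> f" "f \<noteq> 0"
    and "degree a \<noteq> 0 \<or> degree f \<noteq> 0"
  shows "f = d_minus"
proof -
  have "f \<noteq> a"
  proof
    assume f: "f = a"
    then have "degree a \<noteq> 0" using assms(6) by auto
    then show False using self_product_not_square[of a x0] assms(2) f by auto
  qed
  moreover have "f \<noteq> b" using self_product_not_square[of b y0] assms(3) degree_b_pos by auto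
  ultimately show ?thesis using small_extension[of f x0 y0 z0] assms unfolding reduced_residue_def by auto
qed

end

locale D1_quadruple_gap = D1_quadruple + D1_triple_gap
begin

sublocale swapped: D1_roots b a c r t s d_minus
  using r_sq s_sq t_sq d_minus_def c_pos by unfold_locales (auto simp: algebra_simps)

text \<open>Two ladders can only meet in \<open>z\<close> if their residues belong to the same partner \<open>0\<close>, \<open>a\<close>, \<open>b\<close> or a
  common extension, and for each of these the first-order congruence has been solved.\<close>

lemma gap_plus: "z\<^sup>2 = (c * r + s * t)\<^sup>2"
proof -
  have ac: "degree a < degree c" using gap degree_a_le_b by simp
  have H: "degree (a + c - 2 * s) = degree c" "degree (b + c - 2 * t) = degree c"
    using degree_lower_neighbour degree_s degree_t gap ac by simp_all
  note ne = a_pos b_pos a_less_b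
  show ?thesis
  proof (cases rule: ladder_ac)
    case D: (zero_even \<zeta> x0 m)
    show ?thesis
    proof (cases rule: ladder_bc)
      case E: (zero_even \<xi> y0 n)
      have "fst (ladder a c s \<zeta> x0 (2 * m)) = fst (ladder b c t \<zeta> y0 (2 * n))"
        using D(1) E(1) reduced_residue_unique(1)[OF D(6) E(6)] by simp
      then obtain \<mu> \<nu> :: int where "\<bar>\<mu>\<bar> = int m"
        "c dvd a * of_int \<mu> ^ 2 + s * of_int \<mu> - (b * of_int \<nu> ^ 2 + t * of_int \<nu>)"
        using roots.congruence_base_0[OF D(2)[folded power2_eq_1_iff] D(3) E(3)] by metis
      then show ?thesis using solve_base_0 D(4) by fastforce
    next
      case E: (zero_odd \<xi> y0 n)
      then show ?thesis using reduced_residue_unique(2)[OF D(6) E(6)[OF gap]] ne by simp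
    next
      case E: (even g z1 y1 n \<rho> j)
      then show ?thesis using reduced_residue_unique(2)[OF D(6) E(7)] H by simp
    qed
  next
    case D: (zero_odd \<zeta> x0 m)
    note z2 = D(2)[folded power2_eq_1_iff] and RD = D(6)[OF ac]
    show ?thesis
    proof (cases rule: ladder_bc)
      case E: (zero_even \<xi> y0 n)
      then show ?thesis using reduced_residue_unique(2)[OF RD E(6)] ne by simp
    next
      case E: (zero_odd \<xi> y0 n)
      then show ?thesis using reduced_residue_unique(2)[OF RD E(6)[OF gap]] ne by simp
    next
      case E: (even g z1 y1 n \<rho> j)
      note RR = reduced_residue_unique[OF RD E(7)]
      have y1: "y1\<^sup>2 = r\<^sup>2" using E(2) r_sq RR(2) by (simp add: mult.commute)
      have "fst (ladder a c s \<zeta> x0 (2 * m + 1)) = fst (ladder b c t (s * \<zeta>) y1 (2 * n))"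
        using D(1) E(1) RR(1) by simp
      then obtain j \<nu> :: int where "\<bar>\<nu>\<bar> = int n"
        "c dvd 2 * a * (of_int j ^ 2 + of_int j) + (2 * of_int j + 1) * s - (2 * b * of_int \<nu> ^ 2 + (a + b - d_minus) * of_int \<nu>)"
        using roots.congruence_base_0_odd_a_even[OF z2 D(3) y1] by metis
      then have "n = 0" using solve_base_0_odd_a_even by fastforce
      then show ?thesis using base_reached_after_steps[OF E(7)] E(1) by simp
    qed
  next
    case D: (scalar_even \<epsilon> x0 m)
    note e2 = D(3)[folded power2_eq_1_iff]
    show ?thesis
    proof (cases rule: ladder_bc)
      case E: (zero_even \<xi> y0 n)
      then show ?thesis using reduced_residue_unique(2)[OF D(6) E(6)] ne by simp
    next
      case E: (zero_odd \<xi> y0 n)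
      then show ?thesis using reduced_residue_unique(2)[OF D(6) E(6)[OF gap]] ne by simp
    next
      case E: (even g z1 y1 n \<rho> j)
      note RR = reduced_residue_unique[OF D(6) E(7)]
      have y1: "y1\<^sup>2 = r\<^sup>2" using E(2) r_sq RR(2) by (simp add: mult.commute)
      have x0: "x0\<^sup>2 = \<bar>x0\<bar>\<^sup>2" "\<bar>x0\<bar>\<^sup>2 = a\<^sup>2 + 1" using D(4) by simp_all
      have "0 < a\<^sup>2 + 1" by (simp add: add_nonneg_pos)
      then have Kp: "0 < \<bar>x0\<bar>" using D(4) by auto
      have "fst (ladder a c s (\<epsilon> * s) x0 (2 * m)) = fst (ladder b c t (\<epsilon> * s) y1 (2 * n))"
        using D(2) E(1) RR(1) by (simp add: mult.commute)
      then obtain \<mu> \<nu> :: int where "\<bar>\<nu>\<bar> = int n"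
        "c dvd 2 * a * of_int \<mu> ^ 2 + 2 * \<bar>x0\<bar> * of_int \<mu> - (2 * b * of_int \<nu> ^ 2 + (a + b - d_minus) * of_int \<nu>)"
        using roots.congruence_base_a[OF e2 x0(1) y1] by metis
      then have "n = 0" using solve_base_a[OF D(1) x0(2) Kp] by fastforce
      then show ?thesis using base_reached_after_steps[OF E(7)] E(1) by simp
    qed
  next
    case D: (scalar_odd \<epsilon> x0 m)
    note e2 = D(3)[folded power2_eq_1_iff]
    show ?thesis
    proof (cases rule: ladder_bc)
      case E: (zero_even \<xi> y0 n)
      obtain A where A: "a = const A" using degree_0_const D(1) by blast
      have "x0\<^sup>2 = const (A\<^sup>2 + 1)" unfolding D(4) A const_hom ..
      then have dx: "degree x0 = 0" using degree_sq[of x0] by simp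
      have "fst (ladder a c s (\<epsilon> * s) x0 (2 * m + 1)) = fst (ladder b c t \<epsilon> y0 (2 * n))"
        using D(2) E(1) reduced_residue_unique(1)[OF D(6) E(6)] by simp
      then obtain j \<nu> :: int where "\<bar>\<nu>\<bar> = int n"
        "c dvd a + 2 * a * (of_int j ^ 2 + of_int j) + (2 * of_int j + 1) * x0 - (2 * b * of_int \<nu> ^ 2 + 2 * t * of_int \<nu>)"
        using roots.congruence_base_a_odd_0_even[OF e2 refl E(3)] by metis
      then show ?thesis using solve_base_a_odd_0_even[OF D(1) dx] E(4) by fastforce
    next
      case E: (zero_odd \<xi> y0 n)
      then show ?thesis using reduced_residue_unique(2)[OF D(6) E(6)[OF gap]] ne by simp
    next
      case E: (even g z1 y1 n \<rho> j)
      then show ?thesis using reduced_residue_unique(2)[OF D(6) E(7)] H by simp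
    qed
  next
    case D: (even f z0 x0 m \<rho> j)
    show ?thesis
    proof (cases rule: ladder_bc)
      case E: (zero_even \<xi> y0 n)
      then show ?thesis using reduced_residue_unique(2)[OF D(8) E(6)] D(4) H by simp
    next
      case E: (zero_odd \<xi> y0 n)
      note x2 = E(2)[folded power2_eq_1_iff]
      note RR = reduced_residue_unique[OF D(8) E(6)[OF gap]]
      have x0: "x0\<^sup>2 = r\<^sup>2" using D(2) r_sq RR(2) by simp
      have "fst (ladder b c t \<xi> y0 (2 * n + 1)) = fst (ladder a c s (t * \<xi>) x0 (2 * m))"
        using D(1) E(1) RR(1) by simp
      then obtain j \<mu> :: int where "\<bar>\<mu>\<bar> = int m"
        "c dvd 2 * b * (of_int j ^ 2 + of_int j) + (2 * of_int j + 1) * t - (2 * a * of_int \<mu> ^ 2 + (b + a - d_minus) * of_int \<mu>)"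
        using swapped.congruence_base_0_odd_a_even[OF x2 E(3) x0] by metis
      then have "m = 0" using solve_base_b_even_0_odd by fastforce
      then show ?thesis using base_reached_after_steps[OF D(8)] D(1) by simp
    next
      case E: (even g z1 y1 n \<rho>' j')
      note RR = reduced_residue_unique[OF D(8) E(7)]
      have fm: "f = d_minus"
        using common_base[OF D(8,2)] E(2) RR(2) D(3,4,5) H by simp
      have "z0\<^sup>2 = (c * r - s * t)\<^sup>2" using D(8) c_minus_sq fm unfolding reduced_residue_def by simp
      then have "z0 = c * r - s * t \<or> z0 = - (c * r - s * t)" by (simp only: power2_eq_iff)
      then obtain \<epsilon> :: "real poly" where e: "\<epsilon> = 1 \<or> \<epsilon> = - 1" "z0 = \<epsilon> * (c * r - s * t)" by (metis mult_1 mult_minus1)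
      note e2 = e(1)[folded power2_eq_1_iff]
      have "fst (ladder a c s (\<epsilon> * (c * r - s * t)) x0 (2 * m)) = fst (ladder b c t (\<epsilon> * (c * r - s * t)) y1 (2 * n))"
        using D(1) E(1) RR(1) e by simp
      then obtain \<mu> \<nu> :: int where mu: "\<bar>\<mu>\<bar> = int m" "of_nat m * x0 = of_int \<mu> * (\<epsilon> * (a * t - r * s))"
        "c dvd 2 * a * of_int \<mu> ^ 2 + (b - a - d_minus) * of_int \<mu> - (2 * b * of_int \<nu> ^ 2 + (a - b - d_minus) * of_int \<nu>)"
        using roots.congruence_base_minus[OF e2 D(2)[unfolded fm] E(2)[folded RR(2), unfolded fm]] by metis
      from solve_base_minus[OF mu(3)] show ?thesis
      proof
        assume "\<mu> = 0 \<and> \<nu> = 0"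
        then have "m = 0" using mu(1) by simp
        then show ?thesis using base_reached_after_steps[OF D(8)] D(1) by simp
      next
        \<comment> \<open>On the ladder of \<open>(a, c)\<close> two steps lead from \<open>d_minus\<close> over \<open>b\<close> to \<open>d_plus\<close>.\<close>
        assume "\<mu> = 1 \<and> \<nu> = 1"
        then have m1: "m = 1" and x0: "x0 = \<epsilon> * (a * t - r * s)" using mu(1,2) by auto
        have "z = s * (s * z0 + c * x0) + c * (s * x0 + a * z0)"
          using D(1) m1 by (simp add: numeral_2_eq_2)
        also have "\<dots> = \<epsilon> * (- (c * r + s * t))"
          unfolding e(2) x0 using s_sq by algebra
        finally show ?thesis using e2 by algebra
      qed
    qed
  qed
qed

end

lemma odd_multiple_unique:
  fixes g \<rho> i j :: nat
  assumes "g + i * (g + g) = \<rho> + j * (g + g)"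
  shows "g \<le> \<rho>"
proof (rule ccontr)
  assume "\<not> g \<le> \<rho>"
  then have "(g + i * (g + g)) mod (g + g) = g" "(\<rho> + j * (g + g)) mod (g + g) = \<rho>" by simp_all
  then show False using assms \<open>\<not> g \<le> \<rho>\<close> by simp
qed

lemma degree_scalar_root:
  fixes a x0 :: "real poly"
  assumes "degree a = 0" "x0\<^sup>2 = a\<^sup>2 + 1"
  shows "degree x0 = 0"
proof -
  obtain A where A: "a = const A" using degree_0_const assms(1) by blast
  have "x0\<^sup>2 = const (A\<^sup>2 + 1)" unfolding assms(2) A const_hom ..
  then show ?thesis using degree_sq[of x0] by simp
qed

locale D1_quadruple_sum = D1_quadruple + D1_triple_sum
begin

lemma cr_minus_st: "c * r - s * t = 1" and rt_minus_bs: "r * t - b * s = 1"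
  unfolding c_sum s_sum t_sum using r_sq by algebra+

text \<open>Two steps lead from \<open>0\<close> over \<open>b\<close> to \<open>d_plus\<close>, because \<open>d_minus = 0\<close>.\<close>

lemma zero_base_plus:
  assumes D: "ladder a c s \<zeta> x0 (2 * m) = (z, x)" "\<zeta> = 1 \<or> \<zeta> = - 1" "0 < m"
    and mu: "\<bar>\<mu>\<bar> = int m" "of_nat m * x0 = of_int \<mu> * \<zeta>" "\<mu> = 0 \<and> \<nu> = 0 \<or> \<mu> = - 1 \<and> \<nu> = - (1 :: int)"
  shows "z\<^sup>2 = (c * r + s * t)\<^sup>2"
proof -
  have m1: "m = 1" and x0: "x0 = - \<zeta>" using mu D(3) by auto
  have "z = s * (s * \<zeta> - c * \<zeta>) + c * (- s * \<zeta> + a * \<zeta>)"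
    using D(1) unfolding m1 x0 by (simp add: numeral_2_eq_2)
  also have "\<dots> = - (\<zeta> * (c * r + s * t))"
    unfolding c_sum s_sum t_sum by algebra
  finally show ?thesis using D(2)[folded power2_eq_1_iff] by algebra
qed

text \<open>On the side of \<open>b\<close> the neighbour of \<open>0\<close> is \<open>a\<close>, so an odd number of steps from \<open>0\<close> is an even
  number of steps from \<open>a\<close>.\<close>

lemma ladder_bc_even:
  assumes ac: "degree a < degree c"
  obtains g z1 y1 n where "ladder b c t z1 y1 (2 * n) = (z, y)" "y1\<^sup>2 = b * g + 1" "reduced_residue c z g z1"
proof (cases rule: ladder_bc)
  case E: (zero_even \<xi> y0 n)
  then show ?thesis using that[of \<xi> y0 n 0] by simp
next
  case E: (zero_odd \<xi> y0 n)
  note x2 = E(2)[folded power2_eq_1_iff]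
  have "c dvd (z - t * \<xi>) + c * \<xi>" using E(5) by simp
  then have "c dvd z - (- (s * \<xi>))" unfolding c_eq_s_plus_t by (simp add: algebra_simps)
  then have R: "reduced_residue c z a (- (s * \<xi>))"
    unfolding reduced_residue_def using s_sq x2 ac by (simp add: power_mult_distrib mult.commute)
  have sq: "(r * \<xi>)\<^sup>2 = b * a + 1"
    using r_sq x2 by (simp add: power_mult_distrib mult.commute)
  have "y0\<^sup>2 = \<xi>\<^sup>2" using E(3) x2 by simp
  then have "y0 = - \<xi> \<or> y0 = \<xi>" using power2_eq_iff by blast
  then show ?thesis
  proof
    assume y0: "y0 = - \<xi>"
    have st: "t * \<xi> + c * y0 = - (s * \<xi>)" "t * y0 + b * \<xi> = - (r * \<xi>)"
      unfolding y0 c_sum s_sum t_sum by algebra+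
    have "ladder b c t (- (s * \<xi>)) (- (r * \<xi>)) (2 * n) = (z, y)"
      using E(1) unfolding Suc_eq_plus1[symmetric] ladder.simps st .
    then show ?thesis by (rule that[OF _ _ R]) (use sq in simp)
  next
    assume y0: "y0 = \<xi>"
    have st: "t * (- (s * \<xi>)) + c * (r * \<xi>) = \<xi>" "t * (r * \<xi>) + b * (- (s * \<xi>)) = y0"
      unfolding y0 using cr_minus_st rt_minus_bs by algebra+
    have "ladder b c t (- (s * \<xi>)) (r * \<xi>) (Suc (2 * n + 1)) = (z, y)"
      unfolding ladder.simps st by (rule E(1))
    then show ?thesis by (intro that[of _ _ "n + 1", OF _ sq R]) simp
  qed
next
  case E: (even g z1 y1 n \<rho> j)
  then show ?thesis using that by blast
qed

lemma sum_plus_small_a: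
  assumes ac: "degree a < degree c"
  shows "z\<^sup>2 = (c * r + s * t)\<^sup>2"
proof -
  have H: "degree (a + c - 2 * s) = degree c" using degree_lower_neighbour degree_s ac by simp
  obtain g z1 y1 n where E: "ladder b c t z1 y1 (2 * n) = (z, y)" "y1\<^sup>2 = b * g + 1" "reduced_residue c z g z1"
    using ladder_bc_even[OF ac] .
  have n0: "n \<noteq> 0" using base_reached_after_steps[OF E(3)] E(1) by (cases "n = 0") auto
  show ?thesis
  proof (cases rule: ladder_ac)
    case D: (zero_even \<zeta> x0 m)
    note RR = reduced_residue_unique[OF D(6) E(3)]
    have "fst (ladder a c s \<zeta> x0 (2 * m)) = fst (ladder b c t \<zeta> y1 (2 * n))" and y1: "y1\<^sup>2 = 1"
      using D(1) E(1,2) RR by simp_all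
    then obtain \<mu> \<nu> :: int where mu: "\<bar>\<mu>\<bar> = int m" "of_nat m * x0 = of_int \<mu> * \<zeta>"
      "c dvd a * of_int \<mu> ^ 2 + s * of_int \<mu> - (b * of_int \<nu> ^ 2 + t * of_int \<nu>)"
      using roots.congruence_base_0[OF D(2)[folded power2_eq_1_iff] D(3) y1] by metis
    show ?thesis by (rule zero_base_plus[OF D(1,2,4) mu(1,2) sum_solve_base_0[OF ac mu(3)]])
  next
    case D: (zero_odd \<zeta> x0 m)
    note RR = reduced_residue_unique[OF D(6)[OF ac] E(3)]
    have "fst (ladder a c s \<zeta> x0 (2 * m + 1)) = fst (ladder b c t (s * \<zeta>) y1 (2 * n))" and y1: "y1\<^sup>2 = r\<^sup>2"
      using D(1) E(1,2) RR r_sq by (simp_all add: mult.commute)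
    then obtain j \<nu> :: int where
      "c dvd 2 * a * (of_int j ^ 2 + of_int j) + (2 * of_int j + 1) * s - (2 * b * of_int \<nu> ^ 2 + (a + b - d_minus) * of_int \<nu>)"
      using roots.congruence_base_0_odd_a_even[OF D(2)[folded power2_eq_1_iff] D(3) y1] by metis
    then show ?thesis using sum_solve_base_0_odd_a_even[OF ac] by blast
  next
    case D: (scalar_even \<epsilon> x0 m)
    note RR = reduced_residue_unique[OF D(6) E(3)]
    have "fst (ladder a c s (\<epsilon> * s) x0 (2 * m)) = fst (ladder b c t (\<epsilon> * s) y1 (2 * n))" and y1: "y1\<^sup>2 = r\<^sup>2"
      using D(2) E(1,2) RR r_sq by (simp_all add: mult.commute)
    then obtain \<mu> \<nu> :: int where "\<bar>\<nu>\<bar> = int n"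
      "c dvd 2 * a * of_int \<mu> ^ 2 + 2 * x0 * of_int \<mu> - (2 * b * of_int \<nu> ^ 2 + (a + b - d_minus) * of_int \<nu>)"
      using roots.congruence_base_a[OF D(3)[folded power2_eq_1_iff] refl y1] by metis
    then show ?thesis using sum_solve_base_a[OF D(1) degree_scalar_root[OF D(1,4)]] n0 by fastforce
  next
    case D: (scalar_odd \<epsilon> x0 m)
    note RR = reduced_residue_unique[OF D(6) E(3)]
    have "fst (ladder a c s (\<epsilon> * s) x0 (2 * m + 1)) = fst (ladder b c t \<epsilon> y1 (2 * n))" and y1: "y1\<^sup>2 = 1"
      using D(2) E(1,2) RR by simp_all
    then obtain j \<nu> :: int where "\<bar>\<nu>\<bar> = int n"
      "c dvd a + 2 * a * (of_int j ^ 2 + of_int j) + (2 * of_int j + 1) * x0 - (2 * b * of_int \<nu> ^ 2 + 2 * t * of_int \<nu>)"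
      using roots.congruence_base_a_odd_0_even[OF D(3)[folded power2_eq_1_iff] refl y1] by metis
    then show ?thesis using sum_solve_base_a_odd_0_even[OF D(1) degree_scalar_root[OF D(1,4)]] n0 by fastforce
  next
    case D: (even f z0 x0 m \<rho> j)
    have "f = d_minus"
      using common_base[OF D(8,2)] reduced_residue_unique(2)[OF D(8) E(3)] E(2) D(3,4,5) H by simp
    then show ?thesis using D(4) H minus_0 by simp
  qed
qed

text \<open>If \<open>a\<close>, \<open>b\<close>, \<open>c\<close> have the same degree, the residues modulo \<open>c\<close> are not reduced; instead the degree of
  \<open>d\<close>, an odd multiple of \<open>degree c\<close> exactly if the base is \<open>0\<close>, shows that both ladders have the same
  kind of base and, for base \<open>0\<close>, the same number of steps.\<close>

lemma sum_plus_equal_degrees: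
  assumes ac: "degree a = degree c"
  shows "z\<^sup>2 = (c * r + s * t)\<^sup>2"
proof -
  have bc: "degree b = degree c" using degree_c_b by simp
  have "a + c - 2 * s = b" "b + c - 2 * t = a" unfolding c_sum s_sum t_sum by simp_all
  then have H: "degree (a + c - 2 * s) = degree c" "degree (b + c - 2 * t) = degree c" using ac bc by simp_all
  have same: "i = j" if "degree c + i * (degree c + degree c) = degree c + j * (degree c + degree c)" for i j
    using that degree_c_pos by simp
  have parity: False if "degree c + i * (degree c + degree c) = \<rho> + j * (degree c + degree c)" "\<rho> < degree c" for i \<rho> j
    using odd_multiple_unique[OF that(1)] that(2) by simp
  show ?thesis
  proof (cases rule: ladder_ac)
    case D: (zero_even \<zeta> x0 m)
    show ?thesis
    proof (cases rule: ladder_bc)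
      case E: (zero_even \<xi> y0 n)
      have "2 * m - 1 = 2 * n - 1" by (rule same) (use D(5) E(5) ac bc in metis)
      then have "m = n" using D(4) E(4) by simp
      then have "fst (ladder a c s \<zeta> x0 (2 * m)) = fst (ladder b c t \<zeta> y0 (2 * m))"
        using D(1) E(1) reduced_residue_unique(1)[OF D(6) E(6)] by simp
      then obtain \<mu> \<nu> :: int where mu: "\<bar>\<mu>\<bar> = int m" "\<bar>\<nu>\<bar> = int m" "of_nat m * x0 = of_int \<mu> * \<zeta>"
        "c dvd a * of_int \<mu> ^ 2 + s * of_int \<mu> - (b * of_int \<nu> ^ 2 + t * of_int \<nu>)"
        using roots.congruence_base_0[OF D(2)[folded power2_eq_1_iff] D(3) E(3)] by metis
      have "\<mu> = 0 \<and> \<nu> = 0 \<or> \<mu> = - 1 \<and> \<nu> = - 1"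
        by (rule sum_solve_base_0_same_index[OF _ mu(4)]) (use mu in simp)
      then show ?thesis by (rule zero_base_plus[OF D(1,2,4) mu(1,3)])
    next
      case E: (zero_odd \<xi> y0 n)
      have "2 * m - 1 = 2 * n" by (rule same) (use D(5) E(4) ac bc in metis)
      then show ?thesis using D(4) by presburger
    next
      case E: (even g z1 y1 n \<rho> j)
      show ?thesis using parity[OF _ E(6)] D(5) E(5) ac bc by metis
    qed
  next
    case D: (zero_odd \<zeta> x0 m)
    show ?thesis
    proof (cases rule: ladder_bc)
      case E: (zero_even \<xi> y0 n)
      have "2 * m = 2 * n - 1" by (rule same) (use D(4) E(5) ac bc in metis)
      then show ?thesis using E(4) by presburger
    next
      case E: (zero_odd \<xi> y0 n)
      have "2 * m = 2 * n" by (rule same) (use D(4) E(4) ac bc in metis)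
      then have "fst (ladder a c s \<zeta> x0 (2 * m + 1)) = fst (ladder b c t \<xi> y0 (2 * m + 1))"
        using D(1) E(1) by simp
      then show ?thesis using sum_odd_same_index[OF D(2) E(2) D(3) E(3)] by blast
    next
      case E: (even g z1 y1 n \<rho> j)
      show ?thesis using parity[OF _ E(6)] D(4) E(5) ac bc by metis
    qed
  next
    case (scalar_even \<epsilon> x0 m)
    then show ?thesis using ac degree_c_pos by simp
  next
    case (scalar_odd \<epsilon> x0 m)
    then show ?thesis using ac degree_c_pos by simp
  next
    case D: (even f z0 x0 m \<rho> j)
    show ?thesis
    proof (cases rule: ladder_bc)
      case E: (zero_even \<xi> y0 n)
      show ?thesis using parity[OF _ D(7)] D(6) E(5) ac bc by metis
    next
      case E: (zero_odd \<xi> y0 n)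
      show ?thesis using parity[OF _ D(7)] D(6) E(4) ac bc by metis
    next
      case E: (even g z1 y1 n \<rho>' j')
      have "f = d_minus"
        using common_base[OF D(8,2)] reduced_residue_unique(2)[OF D(8) E(7)] E(2) D(3,4,5) H by simp
      then show ?thesis using D(4) H minus_0 by simp
    qed
  qed
qed

lemma sum_plus: "z\<^sup>2 = (c * r + s * t)\<^sup>2"
  using sum_plus_small_a sum_plus_equal_degrees degree_a_le_b degree_c_b by fastforce

end

locale D1_quadruple_scaled = D1_quadruple + D1_triple_scaled
begin

lemma cr_minus_st: "c * r - s * t = s" and rt_minus_bs: "r * t - b * s = r"
  unfolding c_scaled s_scaled t_scaled by (simp_all add: const_hom power2_eq_square algebra_simps)

lemma c_minus_k0: "\<kappa> * (k0 - (\<kappa> - 1 / \<kappa>) / 2) = 1"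
  using kappa by (simp add: k0_def field_simps)

lemma scalar_even_contradiction:
  fixes \<mu> \<nu> :: int
  assumes e: "(\<kappa>\<^sup>2 - 1) * (of_int \<mu>)\<^sup>2 + (\<kappa>\<^sup>2 + 1) * of_int \<mu> + 4 * (of_int \<nu>)\<^sup>2 + 2 * of_int \<nu> = 0"
    and n: "0 \<le> \<nu>" "\<bar>\<mu>\<bar> = 2 * \<nu>"
  shows "\<nu> = 0"
proof (rule ccontr)
  assume "\<nu> \<noteq> 0"
  then have n1: "1 \<le> \<nu>" using n by simp
  define n where "n = real_of_int \<nu>"
  have rn: "1 \<le> n" using n1 by (simp add: n_def)
  have k2: "1 < \<kappa>\<^sup>2" using kappa by simp
  have "\<mu> = 2 * \<nu> \<or> \<mu> = - (2 * \<nu>)" using n by auto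
  then have "real_of_int \<mu> = 2 * n \<or> real_of_int \<mu> = - (2 * n)" by (auto simp: n_def)
  then show False
  proof
    assume m: "real_of_int \<mu> = 2 * n"
    have "0 \<le> (\<kappa>\<^sup>2 - 1) * (2 * n)\<^sup>2" "0 \<le> (\<kappa>\<^sup>2 + 1) * (2 * n)" "0 \<le> n\<^sup>2" using k2 rn by simp_all
    then show False using e rn unfolding m n_def[symmetric] by linarith
  next
    assume m: "real_of_int \<mu> = - (2 * n)"
    have "(2 * n) * (\<kappa>\<^sup>2 * (2 * n - 1)) = 0" using e unfolding m n_def[symmetric] by algebra
    then show False using rn k2 by auto
  qed
qed

lemma scalar_odd_solution:
  fixes \<mu> \<nu> :: int
  assumes e: "(\<kappa>\<^sup>2 - 1) * (of_int \<mu>)\<^sup>2 + (\<kappa>\<^sup>2 + 1) * of_int \<mu> + 4 * (of_int \<nu>)\<^sup>2 + 2 * of_int \<nu> = 0"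
    and n: "\<nu> \<le> - 1" "\<bar>\<mu>\<bar> = - 2 * \<nu> - 1"
  shows "\<mu> = - 1"
proof -
  define n where "n = - real_of_int \<nu>"
  have rn: "1 \<le> n" using n by (simp add: n_def)
  have nu: "real_of_int \<nu> = - n" by (simp add: n_def)
  have k2: "1 < \<kappa>\<^sup>2" using kappa by simp
  have "\<mu> = - 2 * \<nu> - 1 \<or> \<mu> = - (- 2 * \<nu> - 1)" using n by auto
  then have "real_of_int \<mu> = 2 * n - 1 \<or> real_of_int \<mu> = - (2 * n - 1)" by (auto simp: n_def)
  then show ?thesis
  proof
    assume m: "real_of_int \<mu> = 2 * n - 1"
    have "0 \<le> (\<kappa>\<^sup>2 - 1) * (2 * n - 1)\<^sup>2" "0 < (\<kappa>\<^sup>2 + 1) * (2 * n - 1)" "0 \<le> 2 * n * (2 * n - 1)"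
      using k2 rn by (simp_all add: add_pos_pos)
    moreover have "(\<kappa>\<^sup>2 - 1) * (2 * n - 1)\<^sup>2 + (\<kappa>\<^sup>2 + 1) * (2 * n - 1) + 2 * n * (2 * n - 1) = 0"
      using e unfolding m nu by algebra
    ultimately show ?thesis by linarith
  next
    assume m: "real_of_int \<mu> = - (2 * n - 1)"
    have "(2 * n - 1) * (\<kappa>\<^sup>2 * (2 * (n - 1))) = 0" using e unfolding m nu by algebra
    then have "n = 1" using rn k2 by auto
    then have "real_of_int \<mu> = - 1" using m by simp
    then show ?thesis by linarith
  qed
qed

text \<open>If the base on the side of \<open>a\<close> is the scalar \<open>a\<close>, the degree of \<open>d\<close> determines the base and the
  number of steps on the side of \<open>b\<close>. An odd number of steps from \<open>(s, r)\<close> is an even number of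
  steps from \<open>(- s, r)\<close>, because \<open>a\<close> is its own lower neighbour there.\<close>

lemma scalar_base_even:
  assumes D: "ladder a c s (\<epsilon> * s) x0 (2 * m) = (z, x)" "\<epsilon> = 1 \<or> \<epsilon> = - 1" "x0\<^sup>2 = a\<^sup>2 + 1"
    and dd: "degree d = 2 * m * degree c"
  shows "z\<^sup>2 = (c * r + s * t)\<^sup>2"
proof -
  note e2 = D(2)[folded power2_eq_1_iff]
  have x0: "x0\<^sup>2 = (const k0)\<^sup>2" using D(3) k0_sq by simp
  have bc: "degree b = degree c" using degree_c_b by simp
  obtain f z1 y1 l where E: "ladder b c t z1 y1 l = (z, y)" "z1\<^sup>2 = c * f + 1" "y1\<^sup>2 = b * f + 1"
    "0 \<le> f" "degree f < degree c" "0 < y1"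
    "f = 0 \<Longrightarrow> 1 \<le> l \<and> degree d = degree c + (l - 1) * (degree b + degree c)"
    "f \<noteq> 0 \<Longrightarrow> degree d = degree f + l * (degree b + degree c)" "f \<noteq> 0 \<Longrightarrow> degree b \<noteq> 0 \<Longrightarrow> 0 < z1"
    using ladder_descent[OF b_pos b_less_c degree_c_pos t_pos t_sq d_pos y_pos y_sq z_pos z_sq] by metis
  have d2: "degree d = 0 + m * (degree c + degree c)" using dd by (simp add: algebra_simps)
  have f0: "f \<noteq> 0"
  proof
    assume "f = 0"
    then have "degree c + (l - 1) * (degree c + degree c) = 0 + m * (degree c + degree c)"
      using E(7) d2 bc by simp
    then have "degree c \<le> 0" by (rule odd_multiple_unique)
    then show False using degree_c_pos by simp
  qed
  have fm: "degree f + l * (degree c + degree c) = m * (degree c + degree c)"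
    using E(8)[OF f0] d2 bc by simp
  then have "(degree f + l * (degree c + degree c)) mod (degree c + degree c) = 0" by simp
  then have df: "degree f = 0" using E(5) by simp
  then have lm: "l = m" using fm degree_c_pos by simp
  have fa: "f = a"
    using const_partner_unique[OF df degree_a_0 _ a_pos degree_c_pos, of z1 s] E(2,4) f0 s_sq
    by (simp add: mult.commute)
  have z1: "z1 = s"
  proof (rule power2_eq_imp_eq)
    show "z1\<^sup>2 = s\<^sup>2" using E(2) s_sq fa by (simp add: mult.commute)
  qed (use E(9) f0 degree_b_pos s_pos in auto)
  have y1: "y1 = r"
  proof (rule power2_eq_imp_eq)
    show "y1\<^sup>2 = r\<^sup>2" using E(3) r_sq fa by (simp add: mult.commute)
  qed (use E(6) r_pos in auto)
  have s': "s\<^sup>2 = c * a + 1" using s_sq by (simp add: mult.commute)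
  have da: "degree a < degree c" using degree_a_0 degree_c_pos by simp
  have RD: "reduced_residue c z a (s * \<epsilon>)"
    using reduced_residue_sign[OF D(2) s' _ da] ladder_even_residue[OF s_sq _ D(1)] by (simp add: mult.commute)
  have s0: "s \<noteq> 0" "r \<noteq> 0" using s_pos r_pos by auto
  show ?thesis
  proof (cases "even l")
    case True
    then obtain n where n: "l = 2 * n" by (rule evenE)
    have "reduced_residue c z a s"
      unfolding reduced_residue_def using ladder_even_residue[OF t_sq True E(1)[unfolded z1]] s' da by simp
    then have "s * \<epsilon> = s * 1" using reduced_residue_unique(1)[OF RD] by simp
    then have e: "\<epsilon> = 1" using s0 by (simp only: mult_cancel_left) auto
    have "fst (ladder a c s (\<epsilon> * s) x0 (2 * m)) = fst (ladder b c t (\<epsilon> * s) r (2 * n))"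
      using D(1) E(1) z1 y1 e n by simp
    then obtain \<mu> \<nu> :: int where mu: "\<bar>\<mu>\<bar> = int m" "of_nat n * r = of_int \<nu> * (\<epsilon> * r)"
      "c dvd 2 * a * of_int \<mu> ^ 2 + 2 * const k0 * of_int \<mu> - (2 * b * of_int \<nu> ^ 2 + (a + b - d_minus) * of_int \<nu>)"
      using roots.congruence_base_a[OF e2 x0 refl] by metis
    have "of_nat n = (of_int \<nu> :: real poly)" using mu(2) e s0 by simp
    then have nu: "\<nu> = int n" by (metis of_int_eq_iff of_int_of_nat_eq)
    have "\<nu> = 0"
      by (rule scalar_even_contradiction[OF scaled_base_a_equation[OF mu(3)]]) (use nu mu(1) n lm in auto)
    then have "l = 0" using nu n by simp
    then have "z = z1" using E(1) by simp
    then show ?thesis using base_reached_after_steps[of f z1] E(2,5) unfolding reduced_residue_def by simp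
  next
    case False
    then obtain n' where n': "l = 2 * n' + 1" by (rule oddE)
    define n where "n = n' + 1"
    have n: "Suc l = 2 * n" using n' by (simp add: n_def)
    have st: "t * (- s) + c * r = s" "t * r + b * (- s) = r"
      using cr_minus_st rt_minus_bs by (simp_all add: algebra_simps)
    have E': "ladder b c t (- s) r (2 * n) = (z, y)"
      using E(1) unfolding n[symmetric] ladder.simps st z1 y1 .
    have "reduced_residue c z a (- s)"
      unfolding reduced_residue_def using ladder_even_residue[OF t_sq _ E'] s' da by simp
    then have "s * \<epsilon> = s * (- 1)" using reduced_residue_unique(1)[OF RD] by simp
    then have e: "\<epsilon> = - 1" using s0 by (simp only: mult_cancel_left) auto
    have "fst (ladder a c s (\<epsilon> * s) x0 (2 * m)) = fst (ladder b c t (\<epsilon> * s) r (2 * n))"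
      using D(1) E' e by simp
    then obtain \<mu> \<nu> :: int where mu: "\<bar>\<mu>\<bar> = int m" "of_nat m * x0 = of_int \<mu> * (\<epsilon> * const k0)"
      "of_nat n * r = of_int \<nu> * (\<epsilon> * r)"
      "c dvd 2 * a * of_int \<mu> ^ 2 + 2 * const k0 * of_int \<mu> - (2 * b * of_int \<nu> ^ 2 + (a + b - d_minus) * of_int \<nu>)"
      using roots.congruence_base_a[OF e2 x0 refl] by metis
    have "of_nat n * r = of_int (- \<nu>) * r" using mu(3) e by simp
    then have "of_nat n = (of_int (- \<nu>) :: real poly)" using s0 by (simp only: mult_cancel_right) auto
    then have nu: "- \<nu> = int n" by (metis of_int_eq_iff of_int_of_nat_eq)
    have "\<mu> = - 1"
      by (rule scalar_odd_solution[OF scaled_base_a_equation[OF mu(4)]]) (use nu mu(1) n n' lm in auto)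
    then have m1: "m = 1" and xk: "x0 = const k0" using mu(1,2) e by auto
    have "z = s * (s * (- s) + c * const k0) + c * (s * const k0 + a * (- s))"
      using D(1) unfolding m1 xk e by (simp add: numeral_2_eq_2)
    also have "\<dots> = - s + 2 * c * s * (const k0 - a)" using s_sq by algebra
    finally have z: "z = - s + 2 * c * s * (const k0 - a)" .
    have ka: "const \<kappa> * (const k0 - a) = 1"
      unfolding a_scaled using c_minus_k0 by (simp flip: const_hom)
    have "const \<kappa> * z = const \<kappa> * (c * r + s * t)"
    proof -
      have "const \<kappa> * (c * r + s * t) = c * s + s * (const \<kappa> * t)" unfolding s_scaled by algebra
      also have "const \<kappa> * t = c - const \<kappa>" unfolding t_scaled c_scaled const_hom by algebra
      finally have "const \<kappa> * (c * r + s * t) = c * s + s * (c - const \<kappa>)" .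
      then show ?thesis unfolding z using ka by algebra
    qed
    then have "z = c * r + s * t" using kappa by (simp add: const_eq_0)
    then show ?thesis by simp
  qed
qed

text \<open>Here the degree of \<open>d\<close> forces the base \<open>0\<close> on the side of \<open>b\<close>.\<close>

lemma scalar_base_odd:
  assumes D: "ladder a c s (\<epsilon> * s) x0 (2 * m + 1) = (z, x)" "\<epsilon> = 1 \<or> \<epsilon> = - 1" "x0\<^sup>2 = a\<^sup>2 + 1"
    and dd: "degree d = (2 * m + 1) * degree c" and RD: "reduced_residue c z 0 \<epsilon>"
  shows False
proof -
  note e2 = D(2)[folded power2_eq_1_iff]
  have x0: "x0\<^sup>2 = (const k0)\<^sup>2" using D(3) k0_sq by simp
  have bc: "degree b = degree c" using degree_c_b by simp
  obtain f z1 y1 l where E: "ladder b c t z1 y1 l = (z, y)" "z1\<^sup>2 = c * f + 1" "y1\<^sup>2 = b * f + 1"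
    "0 \<le> f" "degree f < degree c"
    "f = 0 \<Longrightarrow> 1 \<le> l \<and> degree d = degree c + (l - 1) * (degree b + degree c)"
    "f \<noteq> 0 \<Longrightarrow> degree d = degree f + l * (degree b + degree c)"
    using ladder_descent[OF b_pos b_less_c degree_c_pos t_pos t_sq d_pos y_pos y_sq z_pos z_sq] by metis
  have d2: "degree d = degree c + m * (degree c + degree c)" using dd by (simp add: algebra_simps)
  have f0: "f = 0"
  proof (rule ccontr)
    assume "f \<noteq> 0"
    then have "degree c + m * (degree c + degree c) = degree f + l * (degree c + degree c)"
      using E(7) d2 bc by simp
    then have "degree c \<le> degree f" by (rule odd_multiple_unique)
    then show False using E(5) by simp
  qed
  have l1: "1 \<le> l" using E(6) f0 by simp
  have "degree c + (l - 1) * (degree c + degree c) = degree c + m * (degree c + degree c)"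
    using E(6)[OF f0, unfolded bc] d2 by metis
  then have "l - 1 = m" using degree_c_pos by simp
  then have l: "l = m + 1" using l1 by simp
  have z1: "z1 = 1 \<or> z1 = - 1" and y1: "y1\<^sup>2 = 1" using E(2,3) f0 by (simp_all add: power2_eq_1_iff)
  show False
  proof (cases "even l")
    case True
    then obtain n where n: "l = 2 * n" by (rule evenE)
    have "reduced_residue c z f z1"
      unfolding reduced_residue_def using ladder_even_residue[OF t_sq True E(1)] E(2,5) by simp
    then have ez: "\<epsilon> = z1" using reduced_residue_unique(1)[OF RD] by simp
    have "fst (ladder a c s (\<epsilon> * s) x0 (2 * m + 1)) = fst (ladder b c t \<epsilon> y1 (2 * n))"
      using D(1) E(1) ez n by simp
    then obtain j \<nu> :: int where mu: "\<bar>2 * j + 1\<bar> = 2 * int m + 1"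
      "(2 * of_nat m + 1) * x0 = (2 * of_int j + 1) * (\<epsilon> * const k0)"
      "\<bar>\<nu>\<bar> = int n" "of_nat n * y1 = of_int \<nu> * \<epsilon>"
      "c dvd a + 2 * a * (of_int j ^ 2 + of_int j) + (2 * of_int j + 1) * const k0 - (2 * b * of_int \<nu> ^ 2 + 2 * t * of_int \<nu>)"
      using roots.congruence_base_a_odd_0_even[OF e2 x0 y1] by metis
    \<comment> \<open>In the exceptional case three steps from \<open>a\<close> and two steps from \<open>0\<close> are compared exactly.\<close>
    have "\<kappa> = 2 \<and> 2 * j + 1 = - 3 \<and> 2 * \<nu> = - 2"
      by (rule scaled_numerical[OF kappa _ _ scaled_base_a_odd_0_even_equation[OF mu(5)]])
        (use mu(1,3) n l l1 in auto)
    then have k: "\<kappa> = 2" "j = - 2" "\<nu> = - 1" by auto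
    then have nm: "n = 1" "m = 1" using mu(1,3) by auto
    have y1e: "y1 = - \<epsilon>" using mu(4) k nm by simp
    have "3 * x0 = 3 * (- \<epsilon> * const k0)" using mu(2) k nm by simp
    then have x0e: "x0 = - \<epsilon> * const k0" by (simp only: mult_cancel_left) simp
    have k0': "k0 = 5 / 4" using k0_def unfolding k(1) by simp
    have a': "a = const (3 / 4)" using a_scaled unfolding k(1) by simp
    have "const 4 * const k0 = const 5" "const 4 * a = const 3"
      unfolding k0' a' by (simp_all add: const_inject flip: const_hom(4))
    then have k0v: "4 * const k0 = 5" "4 * a = 3" by (simp_all add: const_hom)
    have cb: "c = 4 * b + 4" "t = 2 * b + 1"
      using c_scaled t_scaled unfolding k(1) by (simp_all add: const_hom)
    have "ladder a c s (\<epsilon> * s) x0 3 = (z, x)" "ladder b c t \<epsilon> y1 2 = (z, y)"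
      using D(1) E(1) ez n nm by (simp_all add: numeral_3_eq_3)
    then have zz: "z = s * (s * (s * (\<epsilon> * s) + c * x0) + c * (s * x0 + a * (\<epsilon> * s)))
        + c * (s * (s * x0 + a * (\<epsilon> * s)) + a * (s * (\<epsilon> * s) + c * x0))"
      "z = t * (t * \<epsilon> + c * y1) + c * (t * y1 + b * \<epsilon>)"
      by (simp_all add: numeral_2_eq_2 numeral_3_eq_3)
    have v1: "z = \<epsilon> * (s\<^sup>2 * s\<^sup>2 + 3 * (a * c) * s\<^sup>2 - const k0 * c * (3 * s\<^sup>2 + a * c))"
      unfolding zz(1) x0e by algebra
    have v2: "z = \<epsilon> * (t\<^sup>2 - 2 * c * t + b * c)"
      unfolding zz(2) y1e by algebra
    have "16 * z = \<epsilon> * (16 - 24 * c\<^sup>2)"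
    proof -
      have ac4: "4 * (a * c) = 3 * c" using k0v by (simp flip: mult.assoc)
      have "16 * z = \<epsilon> * (4 * (4 * (a * c))\<^sup>2 + 20 * (4 * (a * c)) + 16 - 4 * (4 * const k0) * c * (4 * (a * c) + 3))"
        unfolding v1 s_sq by algebra
      also have "\<dots> = \<epsilon> * (16 - 24 * c\<^sup>2)" unfolding ac4 k0v by algebra
      finally show ?thesis .
    qed
    moreover have "16 * z = \<epsilon> * (16 - 8 * c\<^sup>2)"
      unfolding v2 cb by algebra
    ultimately have "\<epsilon> * (16 * c\<^sup>2) = 0" by algebra
    then show False using D(2) c_pos by auto
  next
    case False
    then obtain n where n: "l = 2 * n + 1" by (rule oddE)
    have "fst (ladder a c s (\<epsilon> * s) x0 (2 * m + 1)) = fst (ladder b c t z1 y1 (2 * n + 1))"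
      using D(1) E(1) n by simp
    then obtain W i :: int where W: "\<bar>W\<bar> = 2 * int m + 1" "\<bar>i\<bar> = 2 * int n + 1"
      "\<kappa>\<^sup>2 * (real_of_int W + 1)\<^sup>2 - (real_of_int W - 1)\<^sup>2 + 4 * (real_of_int i)\<^sup>2 + 4 * \<kappa> * real_of_int i = 0"
      using scaled_base_a_odd_0_odd_equation[OF D(2) z1 x0 y1] by metis
    have "\<kappa> = 2 \<and> W = - 3 \<and> i = - 2"
      by (rule scaled_numerical[OF kappa _ _ W(3)]) (use W(1,2) n l in auto)
    then have "2 = 2 * int n + 1" using W(2) by simp
    then show False by presburger
  qed
qed

text \<open>Since \<open>t\<close> is congruent to \<open>- 1\<close>, every number of steps from \<open>0\<close> on the side of \<open>b\<close> leaves the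
  residue \<open>1\<close> or \<open>- 1\<close>.\<close>

lemma scaled_plus: "z\<^sup>2 = (c * r + s * t)\<^sup>2"
proof -
  have ac: "degree a < degree c" using degree_a_0 degree_c_pos by simp
  have H: "degree (a + c - 2 * s) = degree c" using degree_lower_neighbour degree_s ac by simp
  have Ht: "degree (b + c - 2 * t) = degree c"
  proof -
    have "b + c - 2 * t = const ((\<kappa> - 1)\<^sup>2) * b + const (2 * \<kappa> - 2)"
      unfolding c_scaled t_scaled const_hom by algebra
    then show ?thesis
      using degree_add_eq_left[of "const (2 * \<kappa> - 2)" "const ((\<kappa> - 1)\<^sup>2) * b"] kappa degree_b_pos degree_c_b by simp
  qed
  have odd_residue: "reduced_residue c z 0 (- \<xi>)" if "\<xi> = 1 \<or> \<xi> = - 1" "c dvd z - t * \<xi>" for \<xi>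
  proof -
    have "c dvd (z - t * \<xi>) + c * (const (1 / \<kappa>) * \<xi>)" using that(2) by simp
    also have "(z - t * \<xi>) + c * (const (1 / \<kappa>) * \<xi>) = z - (- \<xi>)" unfolding t_mod by algebra
    finally show ?thesis using that(1) degree_c_pos unfolding reduced_residue_def by auto
  qed
  show ?thesis
  proof (cases rule: ladder_ac)
    case D: (zero_even \<zeta> x0 m)
    show ?thesis
    proof (cases rule: ladder_bc)
      case E: (zero_even \<xi> y0 n)
      have "fst (ladder a c s \<zeta> x0 (2 * m)) = fst (ladder b c t \<zeta> y0 (2 * n))"
        using D(1) E(1) reduced_residue_unique(1)[OF D(6) E(6)] by simp
      then obtain \<mu> \<nu> :: int where "\<bar>\<mu>\<bar> = int m"
        "c dvd a * of_int \<mu> ^ 2 + s * of_int \<mu> - (b * of_int \<nu> ^ 2 + t * of_int \<nu>)"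
        using roots.congruence_base_0[OF D(2)[folded power2_eq_1_iff] D(3) E(3)] by metis
      then show ?thesis using scaled_solve_base_0 D(4) by fastforce
    next
      case E: (zero_odd \<xi> y0 n)
      have "fst (ladder a c s \<zeta> x0 (2 * m)) = fst (ladder b c t \<xi> y0 (2 * n + 1))"
        using D(1) E(1) by simp
      then have "m = 0" using scaled_base_0_even_odd[OF D(2) E(2) D(3) E(3)] by blast
      then show ?thesis using D(4) by simp
    next
      case E: (even g z1 y1 n \<rho> j)
      then show ?thesis using reduced_residue_unique(2)[OF D(6) E(7)] Ht by simp
    qed
  next
    case D: (zero_odd \<zeta> x0 m)
    note RD = D(6)[OF ac]
    show ?thesis
    proof (cases rule: ladder_bc)
      case E: (zero_even \<xi> y0 n)
      then show ?thesis using reduced_residue_unique(2)[OF RD E(6)] a_pos by simp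
    next
      case E: (zero_odd \<xi> y0 n)
      then show ?thesis using reduced_residue_unique(2)[OF RD odd_residue[OF E(2,5)]] a_pos by simp
    next
      case E: (even g z1 y1 n \<rho> j)
      note RR = reduced_residue_unique[OF RD E(7)]
      have "fst (ladder a c s \<zeta> x0 (2 * m + 1)) = fst (ladder b c t (s * \<zeta>) y1 (2 * n))" and y1: "y1\<^sup>2 = r\<^sup>2"
        using D(1) E(1,2) RR r_sq by (simp_all add: mult.commute)
      then obtain j \<nu> :: int where
        "c dvd 2 * a * (of_int j ^ 2 + of_int j) + (2 * of_int j + 1) * s - (2 * b * of_int \<nu> ^ 2 + (a + b - d_minus) * of_int \<nu>)"
        using roots.congruence_base_0_odd_a_even[OF D(2)[folded power2_eq_1_iff] D(3) y1] by metis
      then show ?thesis using scaled_solve_base_0_odd_a_even by blast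
    qed
  next
    case D: (scalar_even \<epsilon> x0 m)
    show ?thesis by (rule scalar_base_even[OF D(2-5)])
  next
    case D: (scalar_odd \<epsilon> x0 m)
    show ?thesis using scalar_base_odd[OF D(2-6)] ..
  next
    case D: (even f z0 x0 m \<rho> j)
    show ?thesis
    proof (cases rule: ladder_bc)
      case E: (zero_even \<xi> y0 n)
      then show ?thesis using reduced_residue_unique(2)[OF D(8) E(6)] D(4) H by simp
    next
      case E: (zero_odd \<xi> y0 n)
      then show ?thesis using reduced_residue_unique(2)[OF D(8) odd_residue[OF E(2,5)]] D(4) H by simp
    next
      case E: (even g z1 y1 n \<rho>' j')
      have "f = d_minus"
        using common_base[OF D(8,2)] reduced_residue_unique(2)[OF D(8) E(7)] E(2) D(3,4,5) H by simp
      then show ?thesis using D(5)[OF D(4)[OF H]] minus_a degree_a_0 by simp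
    qed
  qed
qed

end

section \<open>Regularity\<close>

lemma regular_quadruple_symmetric_form:
  "regular_quadruple a b c d \<longleftrightarrow>
    a\<^sup>2 + b\<^sup>2 + c\<^sup>2 + d\<^sup>2 - 2 * (a * b + a * c + a * d + b * c + b * d + c * d) - 4 * a * b * c * d - 4 = 0"
proof -
  have "(a + b - c - d) ^ 2 - 4 * (a * b + 1) * (c * d + 1)
    = a\<^sup>2 + b\<^sup>2 + c\<^sup>2 + d\<^sup>2 - 2 * (a * b + a * c + a * d + b * c + b * d + c * d) - 4 * a * b * c * d - 4"
    by algebra
  then show ?thesis unfolding regular_quadruple_def by (metis eq_iff_diff_eq_0)
qed

context D1_triple
begin

lemma regular_factorization:
  "(f - d_minus) * (f - d_plus) = a\<^sup>2 + b\<^sup>2 + c\<^sup>2 + f\<^sup>2 - 2 * (a * b + a * c + a * f + b * c + b * f + c * f) - 4 * a * b * c * f - 4"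
proof -
  have "(f - d_minus) * (f - d_plus) = (f - (a + b + c + 2 * a * b * c))\<^sup>2 - 4 * (r\<^sup>2 * s\<^sup>2 * t\<^sup>2)"
    unfolding d_minus_def d_plus_def by algebra
  then show ?thesis unfolding r_sq s_sq t_sq by algebra
qed

lemma regular_iff: "regular_quadruple a b c f \<longleftrightarrow> f = d_minus \<or> f = d_plus"
  unfolding regular_quadruple_symmetric_form regular_factorization[symmetric] by simp

end

context D1_quadruple
begin

lemma d_eq_plus: "z\<^sup>2 = (c * r + s * t)\<^sup>2"
proof (cases "degree b < degree c")
  case True
  interpret g: D1_quadruple_gap a b c r s t d x y z
    by unfold_locales (rule True)
  show ?thesis by (rule g.gap_plus)
next
  case False
  then have bc: "degree c = degree b" using degree_b_le_c by simp
  show ?thesis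
  proof (cases "d_minus = 0")
    case True
    interpret g: D1_quadruple_sum a b c r s t d x y z
      by unfold_locales (rule True)
    show ?thesis by (rule g.sum_plus)
  next
    case False
    obtain \<kappa> where k: "\<kappa> > 1" "a = const ((\<kappa> - 1 / \<kappa>) / 2)" "d_minus = a"
      "c = const (\<kappa>\<^sup>2) * b + const (2 * \<kappa>)" "s = const \<kappa> * r" "t = const \<kappa> * b + 1"
      using same_degree_minus_ne_0[OF False bc] by metis
    interpret g: D1_quadruple_scaled a b c r s t d x y z \<kappa>
      by unfold_locales (rule k)+
    show ?thesis by (rule g.scaled_plus)
  qed
qed

lemma regular: "regular_quadruple a b c d"
proof -
  have "c * d = c * d_plus" using d_eq_plus z_sq plus_sq by algebra
  then have "d = d_plus" using c_pos by auto
  then show ?thesis using regular_iff by simp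
qed

end

definition positive_quadruple :: "real poly \<Rightarrow> real poly \<Rightarrow> real poly \<Rightarrow> real poly \<Rightarrow> bool" where
  "positive_quadruple a b c d \<longleftrightarrow> polynomial_D1_tuple 4 {a, b, c, d} \<and> 0 < a \<and> 0 < b \<and> 0 < c \<and> 0 < d"

lemma card_4_iff_distinct: "card {a, b, c, d} = 4 \<longleftrightarrow> distinct [a, b, c, d]"
proof -
  have "card (set [a, b, c, d]) = length [a, b, c, d] \<longleftrightarrow> distinct [a, b, c, d]"
    using distinct_card card_distinct by blast
  moreover have "set [a, b, c, d] = {a, b, c, d}" "length [a, b, c, d] = 4" by simp_all
  ultimately show ?thesis by (simp only:)
qed

lemma positive_quadruple_iff:
  "positive_quadruple a b c d \<longleftrightarrow>
    distinct [a, b, c, d] \<and> 0 < a \<and> 0 < b \<and> 0 < c \<and> 0 < d \<and>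
    (degree a \<noteq> 0 \<or> degree b \<noteq> 0 \<or> degree c \<noteq> 0 \<or> degree d \<noteq> 0) \<and>
    (\<exists>r. a * b + 1 = r\<^sup>2) \<and> (\<exists>r. a * c + 1 = r\<^sup>2) \<and> (\<exists>r. a * d + 1 = r\<^sup>2) \<and>
    (\<exists>r. b * c + 1 = r\<^sup>2) \<and> (\<exists>r. b * d + 1 = r\<^sup>2) \<and> (\<exists>r. c * d + 1 = r\<^sup>2)"
proof -
  have "polynomial_D1_tuple 4 {a, b, c, d} \<longleftrightarrow>
    distinct [a, b, c, d] \<and> 0 \<notin> {a, b, c, d} \<and>
    (degree a \<noteq> 0 \<or> degree b \<noteq> 0 \<or> degree c \<noteq> 0 \<or> degree d \<noteq> 0) \<and>
    (\<forall>p\<in>{a, b, c, d}. \<forall>q\<in>{a, b, c, d}. p \<noteq> q \<longrightarrow> (\<exists>r. p * q + 1 = r\<^sup>2))"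
    unfolding polynomial_D1_tuple_def card_4_iff_distinct by simp
  moreover have "(\<forall>p\<in>{a, b, c, d}. \<forall>q\<in>{a, b, c, d}. p \<noteq> q \<longrightarrow> (\<exists>r. p * q + 1 = r\<^sup>2)) \<longleftrightarrow>
    (\<exists>r. a * b + 1 = r\<^sup>2) \<and> (\<exists>r. a * c + 1 = r\<^sup>2) \<and> (\<exists>r. a * d + 1 = r\<^sup>2) \<and>
    (\<exists>r. b * c + 1 = r\<^sup>2) \<and> (\<exists>r. b * d + 1 = r\<^sup>2) \<and> (\<exists>r. c * d + 1 = r\<^sup>2)"
    if dist: "distinct [a, b, c, d]"
  proof -
    have symmetric_ball: "(\<forall>p\<in>{a, b, c, d}. \<forall>q\<in>{a, b, c, d}. p \<noteq> q \<longrightarrow> R p q) \<longleftrightarrow>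
      R a b \<and> R a c \<and> R a d \<and> R b c \<and> R b d \<and> R c d"
      if "\<And>p q. R p q \<longleftrightarrow> R q p" for R :: "real poly \<Rightarrow> real poly \<Rightarrow> bool"
      using dist that by (simp; metis)
    show ?thesis by (rule symmetric_ball) (simp add: mult.commute)
  qed
  moreover have "0 \<notin> {a, b, c, d}" if "0 < a \<and> 0 < b \<and> 0 < c \<and> 0 < d" using that by blast
  ultimately show ?thesis unfolding positive_quadruple_def by blast
qed

text \<open>The descent stays inside the class of quadruples: an extension of \<open>{a, b, c}\<close> that has smaller degree
  than \<open>c\<close> is regular by the hypothesis \<open>IH\<close>, and its degree excludes that it is \<open>d_plus\<close>.\<close>

lemma sorted_quadruple_regular:
  assumes q: "positive_quadruple a b c d" and ord: "a < b" "b < c" "c < d"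
    and IH: "\<And>f. degree f < degree d \<Longrightarrow> positive_quadruple a b c f \<Longrightarrow> regular_quadruple a b c f"
  shows "regular_quadruple a b c d"
proof -
  note q' = q[unfolded positive_quadruple_iff]
  have pos: "0 < a" "0 < b" "0 < c" "0 < d" using q' by blast+
  have nn: "0 \<le> a" "0 \<le> b" "0 \<le> c" "0 \<le> d" using pos by (simp_all add: order_less_imp_le)
  have sq: "\<exists>r. a * b + 1 = r\<^sup>2" "\<exists>r. a * c + 1 = r\<^sup>2" "\<exists>r. b * c + 1 = r\<^sup>2"
    "\<exists>r. a * d + 1 = r\<^sup>2" "\<exists>r. b * d + 1 = r\<^sup>2" "\<exists>r. c * d + 1 = r\<^sup>2"
    using q' by blast+
  obtain r where r: "0 < r" "r\<^sup>2 = a * b + 1" using square_root_pos[OF sq(1) nn(1,2)] by blast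
  obtain s where s: "0 < s" "s\<^sup>2 = a * c + 1" using square_root_pos[OF sq(2) nn(1,3)] by blast
  obtain t where t: "0 < t" "t\<^sup>2 = b * c + 1" using square_root_pos[OF sq(3) nn(2,3)] by blast
  obtain x where x: "0 < x" "x\<^sup>2 = a * d + 1" using square_root_pos[OF sq(4) nn(1,4)] by blast
  obtain y where y: "0 < y" "y\<^sup>2 = b * d + 1" using square_root_pos[OF sq(5) nn(2,4)] by blast
  obtain z where z: "0 < z" "z\<^sup>2 = c * d + 1" using square_root_pos[OF sq(6) nn(3,4)] by blast
  note roots = r s t x y z
  have db: "0 < degree b"
  proof (rule ccontr)
    assume "\<not> 0 < degree b"
    then have d0: "degree b = 0" "degree a = 0"
      using degree_mono_nonneg[of a b] nn ord by (simp_all add: order_less_imp_le)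
    then consider "0 < degree c" | "0 < degree d" using q' by blast
    then have "a = b"
    proof cases
      case 1
      show ?thesis by (rule const_partner_unique[OF d0(2,1) pos(1,2) 1 roots(4,6)])
    next
      case 2
      show ?thesis by (rule const_partner_unique[OF d0(2,1) pos(1,2) 2 roots(8,10)])
    qed
    then show False using ord by simp
  qed
  interpret T: D1_triple a b c r s t
    using pos ord db roots by unfold_locales auto
  have dcd: "degree c \<le> degree d" using degree_mono_nonneg nn ord by (simp add: order_less_imp_le)
  have small: "f = T.d_minus"
    if f: "0 < f" "f \<noteq> a" "f \<noteq> b" "degree f < degree c" "p\<^sup>2 = a * f + 1" "q\<^sup>2 = b * f + 1" "w\<^sup>2 = c * f + 1"
    for f p q w
  proof -
    have "distinct [a, b, c, f]" using f ord by auto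
    moreover have "\<exists>r. a * f + 1 = r\<^sup>2" "\<exists>r. b * f + 1 = r\<^sup>2" "\<exists>r. c * f + 1 = r\<^sup>2" using f(5-7) by metis+
    ultimately have "positive_quadruple a b c f"
      unfolding positive_quadruple_iff using q' f(1) db by blast
    then have "regular_quadruple a b c f" using IH f(4) dcd by simp
    then have "f = T.d_minus \<or> f = T.d_plus" by (simp only: T.regular_iff)
    then show ?thesis using T.degree_plus f(4) by auto
  qed
  interpret Q: D1_quadruple a b c r s t d x y z
    using ord roots small by unfold_locales auto
  show ?thesis by (rule Q.regular)
qed

lemma symmetric_wlog_sorted:
  fixes P :: "'a::linorder \<Rightarrow> 'a \<Rightarrow> 'a \<Rightarrow> 'a \<Rightarrow> bool"
  assumes swap12: "\<And>a b c d. P a b c d \<Longrightarrow> P b a c d" and swap23: "\<And>a b c d. P a b c d \<Longrightarrow> P a c b d"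
    and swap34: "\<And>a b c d. P a b c d \<Longrightarrow> P a b d c"
    and sorted: "\<And>a b c d. a < b \<Longrightarrow> b < c \<Longrightarrow> c < d \<Longrightarrow> P a b c d"
    and dist: "distinct [a, b, c, d]"
  shows "P a b c d"
proof -
  have three_sorted: "P a b c d" if "a < b" "b < c" "distinct [a, b, c, d]" for a b c d
  proof -
    have "d \<noteq> a" "d \<noteq> b" "d \<noteq> c" using that by auto
    then consider "c < d" | "b < d" "d < c" | "a < d" "d < b" | "d < a" by (meson linorder_neqE)
    then show ?thesis
    proof cases
      case 1
      then show ?thesis using sorted that by blast
    next
      case 2
      then show ?thesis using swap34 sorted that by blast
    next
      case 3
      then have "P a d b c" using sorted that by blast
      then show ?thesis using swap34 swap23 by blast
    next
      case 4
      then have "P d a b c" using sorted that by blast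
      then show ?thesis using swap34 swap23 swap12 by blast
    qed
  qed
  have two_sorted: "P a b c d" if "a < b" "distinct [a, b, c, d]" for a b c d
  proof -
    have "c \<noteq> a" "c \<noteq> b" using that by auto
    then consider "b < c" | "a < c" "c < b" | "c < a" by (meson linorder_neqE)
    then show ?thesis
    proof cases
      case 1
      show ?thesis by (rule three_sorted) (use \<open>b < c\<close> that in auto)
    next
      case 2
      have "P a c b d" by (rule three_sorted) (use 2 that in auto)
      then show ?thesis using swap23 by blast
    next
      case 3
      have "P c a b d" by (rule three_sorted) (use 3 that in auto)
      then show ?thesis using swap23 swap12 by blast
    qed
  qed
  show ?thesis
  proof (cases "a < b")
    case True
    then show ?thesis using two_sorted dist by blast
  next
    case False
    have "P b a c d" by (rule two_sorted) (use False dist in auto)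
    then show ?thesis using swap12 by blast
  qed
qed

lemma positive_quadruple_regular:
  assumes "positive_quadruple a b c d"
  shows "regular_quadruple a b c d"
  using assms
proof (induction "degree a + degree b + degree c + degree d" arbitrary: a b c d rule: less_induct)
  case less
  let ?P = "\<lambda>p q u v. positive_quadruple p q u v \<longrightarrow>
    degree p + degree q + degree u + degree v = degree a + degree b + degree c + degree d \<longrightarrow> regular_quadruple p q u v"
  have dist: "distinct [a, b, c, d]" using less.prems unfolding positive_quadruple_iff by blast
  have "?P a b c d"
  proof (rule symmetric_wlog_sorted[of ?P, OF _ _ _ _ dist])
    fix p q u v assume P: "?P p q u v"
    show "?P q p u v" "?P p u q v" "?P p q v u"
      using P unfolding positive_quadruple_def regular_quadruple_symmetric_form
      by (auto simp: insert_commute algebra_simps)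
  next
    fix p q u v :: "real poly"
    assume ord: "p < q" "q < u" "u < v"
    show "?P p q u v"
    proof (intro impI)
      assume quad: "positive_quadruple p q u v"
        and deg: "degree p + degree q + degree u + degree v = degree a + degree b + degree c + degree d"
      show "regular_quadruple p q u v"
      proof (rule sorted_quadruple_regular[OF quad ord])
        fix f assume "degree f < degree v" "positive_quadruple p q u f"
        then show "regular_quadruple p q u f" using less.hyps[of p q u f] deg by simp
      qed
    qed
  qed
  then show ?case using less.prems by simp
qed

lemma regular_quadruple_uminus:
  "regular_quadruple (- a) (- b) (- c) (- d) \<longleftrightarrow> regular_quadruple a b c d"
  unfolding regular_quadruple_symmetric_form by simp

text \<open>Multiplication with a non-constant member shows that all members have the same sign.\<close>

lemma D1_tuple_same_sign:
  assumes "polynomial_D1_tuple m S"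
  shows "(\<forall>q\<in>S. 0 < q) \<or> (\<forall>q\<in>S. q < 0)"
proof -
  obtain p where p: "p \<in> S" "degree p \<noteq> 0" using assms unfolding polynomial_D1_tuple_def by blast
  have sq: "\<exists>r. p * q + 1 = r\<^sup>2" if "q \<in> S" "q \<noteq> p" for q
    using assms p that unfolding polynomial_D1_tuple_def by metis
  have ne: "q \<noteq> 0" if "q \<in> S" for q using assms that unfolding polynomial_D1_tuple_def by blast
  consider "0 < p" | "0 < - p" using ne[OF p(1)] by (auto simp: neq_iff)
  then show ?thesis
  proof cases
    case 1
    have "0 < q" if qS: "q \<in> S" for q
    proof (cases "q = p")
      case False
      then obtain r where "p * q + 1 = r\<^sup>2" using sq[OF qS] by blast
      then have "0 \<le> q" using nonneg_of_square[OF 1 _ sym] p by simp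
      then show ?thesis using ne[OF qS] by (simp add: order_less_le)
    qed (use 1 in simp)
    then show ?thesis by blast
  next
    case 2
    have "q < 0" if qS: "q \<in> S" for q
    proof (cases "q = p")
      case False
      then obtain r where "p * q + 1 = r\<^sup>2" using sq[OF qS] by blast
      then have "0 \<le> - q" using nonneg_of_square[OF 2, of r "- q"] p by simp
      then show ?thesis using ne[OF qS] by (simp add: order_less_le)
    qed (use 2 in simp)
    then show ?thesis by blast
  qed
qed

theorem theorem1:
  fixes a b c d :: "real poly"
  assumes "polynomial_D1_tuple 4 {a, b, c, d}"
  shows "regular_quadruple a b c d"
proof -
  from D1_tuple_same_sign[OF assms] show ?thesis
  proof
    assume "\<forall>q\<in>{a, b, c, d}. 0 < q"
    then have "positive_quadruple a b c d" using assms unfolding positive_quadruple_def by simp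
    then show ?thesis by (rule positive_quadruple_regular)
  next
    assume neg: "\<forall>q\<in>{a, b, c, d}. q < 0"
    have dist: "distinct [a, b, c, d]"
      and nonconst: "degree a \<noteq> 0 \<or> degree b \<noteq> 0 \<or> degree c \<noteq> 0 \<or> degree d \<noteq> 0"
      using assms unfolding polynomial_D1_tuple_def card_4_iff_distinct by blast+
    have "\<exists>r. p * q + 1 = r\<^sup>2" if "p \<in> {a, b, c, d}" "q \<in> {a, b, c, d}" "p \<noteq> q" for p q
      using assms that unfolding polynomial_D1_tuple_def by blast
    then have "\<exists>r. a * b + 1 = r\<^sup>2" "\<exists>r. a * c + 1 = r\<^sup>2" "\<exists>r. a * d + 1 = r\<^sup>2"
      "\<exists>r. b * c + 1 = r\<^sup>2" "\<exists>r. b * d + 1 = r\<^sup>2" "\<exists>r. c * d + 1 = r\<^sup>2"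
      using dist by simp_all
    then have "positive_quadruple (- a) (- b) (- c) (- d)"
      unfolding positive_quadruple_iff degree_minus minus_mult_minus using neg dist nonconst by simp
    then show ?thesis using positive_quadruple_regular regular_quadruple_uminus by blast
  qed
qed

end
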